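(* Let $\Phi=\{\varphi_n\}_{n\in\mathbb{N}}$ be a uniformly bounded orthonormal system on $[0;1]$ and let $p(\cdot)\in P_{\ln}$. Then there exists a measure preserving transformation $\omega:[0;1]\to[0;1]$ and a function $f\in L^{p(\omega(\cdot))}[0;1]$ such that the Fourier series $\sum_{n=1}^\infty c_n(f)\varphi_n(x)$ of $f$ with respect to $\Phi$ diverges at every point $x$ of some set $E\subset[0;1]$ with $m(E)>0$.
   Context: $m$ denotes Lebesgue measure. An orthonormal system $\Phi=\{\varphi_n\}_{n\in\mathbb{N}}$ on $[0;1]$ is a sequence of real-valued measurable functions with $\int_0^1\varphi_n\varphi_k\,dx=\delta_{nk}$; it is uniformly bounded if there is $M>0$ with $|\varphi_n(t)|<M$ for almost all $t\in[0;1]$ and all $n\in\mathbb{N}$. For $f\in L^1[0;1]$, its Fourier coefficients are $c_n(f)=\int_0^1 f(t)\varphi_n(t)\,dt$, and its Fourier series with respect to $\Phi$ is $\sum_{n=1}^\infty c_n(f)\varphi_n(x)$ (with partial sums $S_N(f,x)=\sum_{n=1}^N c_n(f)\varphi_n(x)$). $P_{\ln}$ is the set of all functions $p:[0;1]\to[1;\infty)$ such that $p$ is increasing, $p(0)=1$, $p(t)>1$ for $t\in(0;1]$, and $\liminf_{t\to0+}(p(t)-1)\ln(e/t)<\infty$. For a measurable $r:[0;1]\to[1;\infty)$, the variable exponent Lebesgue space $L^{r(\cdot)}[0;1]$ is the set of measurable $f$ on $[0;1]$ such that $\int_0^1(|f(x)|/\lambda)^{r(x)}dx<\infty$ for some $\lambda>0$,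 with norm $\|f\|_{r(\cdot)}=\inf\{\lambda>0:\int_0^1(|f(x)|/\lambda)^{r(x)}dx\le1\}$. A map $\omega:[0;1]\to[0;1]$ is a measure preserving transformation if it is measurable and $m(\omega^{-1}(A))=m(A)$ for every measurable $A\subset[0;1]$; $L^{p(\omega(\cdot))}[0;1]$ is the variable exponent space with exponent $x\mapsto p(\omega(x))$. *)

theory Defs
  imports "HOL-Analysis.Analysis"
begin

abbreviation unit_leb :: "real measure" where
  "unit_leb \<equiv> lebesgue_on {0..1}"

definition orthonormal_system :: "(nat \<Rightarrow> real \<Rightarrow> real) \<Rightarrow> bool" where
  "orthonormal_system \<phi> \<longleftrightarrow>
     (\<forall>n. \<phi> n \<in> borel_measurable unit_leb) \<and>
     (\<forall>n k. integrable unit_leb (\<lambda>x. \<phi> n x * \<phi> k x) \<and>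
            (\<integral>x. \<phi> n x * \<phi> k x \<partial>unit_leb) = (if n = k then 1 else 0))"

definition uniformly_bounded :: "(nat \<Rightarrow> real \<Rightarrow> real) \<Rightarrow> bool" where
  "uniformly_bounded \<phi> \<longleftrightarrow>
     (\<exists>M>0. \<forall>n. AE t in unit_leb. \<bar>\<phi> n t\<bar> < M)"

definition fourier_coeff :: "(nat \<Rightarrow> real \<Rightarrow> real) \<Rightarrow> (real \<Rightarrow> real) \<Rightarrow> nat \<Rightarrow> real" where
  "fourier_coeff \<phi> f n = (\<integral>t. f t * \<phi> n t \<partial>unit_leb)"

definition fourier_partial_sum ::
    "(nat \<Rightarrow> real \<Rightarrow> real) \<Rightarrow> (real \<Rightarrow> real) \<Rightarrow> nat \<Rightarrow> real \<Rightarrow> real" where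
  "fourier_partial_sum \<phi> f N x = (\<Sum>n<N. fourier_coeff \<phi> f n * \<phi> n x)"

definition P_ln :: "(real \<Rightarrow> real) \<Rightarrow> bool" where
  "P_ln p \<longleftrightarrow>
     (\<forall>t\<in>{0..1}. p t \<ge> 1) \<and>
     mono_on {0..1} p \<and>
     p 0 = 1 \<and>
     (\<forall>t\<in>{0<..1}. p t > 1) \<and>
     Liminf (at_right 0) (\<lambda>t. ereal ((p t - 1) * ln (exp 1 / t))) < \<infinity>"

definition in_var_Lebesgue :: "(real \<Rightarrow> real) \<Rightarrow> (real \<Rightarrow> real) \<Rightarrow> bool" where
  "in_var_Lebesgue r f \<longleftrightarrow>
     f \<in> borel_measurable unit_leb \<and>
     (\<exists>c>0. (\<integral>\<^sup>+x. ennreal ((\<bar>f x\<bar> / c) powr r x) \<partial>unit_leb) < \<infinity>)"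

definition measure_preserving_01 :: "(real \<Rightarrow> real) \<Rightarrow> bool" where
  "measure_preserving_01 \<omega> \<longleftrightarrow>
     \<omega> \<in> unit_leb \<rightarrow>\<^sub>M unit_leb \<and>
     (\<forall>A\<in>sets unit_leb. emeasure unit_leb (\<omega> -` A \<inter> {0..1}) = emeasure unit_leb A)"

end

theory Submission
  imports Defs "HOL-Probability.Probability" "HOL-Library.Diagonal_Subsequence"
begin

text \<open>
  For a sequence with increments at most \<open>b\<close> the discrete \<open>H^(1/2)\<close> energy
  \<open>\<Sum> (D k - D j)^2 / (k - j)^2\<close> is at most a multiple of \<open>b \<Sum> |D j|\<close>.  Integrating this over \<open>t\<close> for the
  partial kernels \<open>D j = \<Sum>l<j. \<phi> (p + l) x \<phi> (p + l) t\<close> and using orthonormality, some kernel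
  from every long block has \<open>L^1\<close> norm of logarithmic size, for all \<open>x\<close> in a set whose measure
  is bounded below.  Kernels from blocks moving to infinity are weakly null; choosing
  independent random points \<open>t 1, ..., t n\<close>, this makes the sign patterns of the values \<open>K (t i)\<close> so rich
  that with high probability some kernel satisfies \<open>\<Sum> K (t i) \<ge> c n \<integral>|K|\<close>.  Replacing the points by
  small sets gives functions \<open>F\<close> of \<open>L^1\<close> norm one, of height \<open>1 / s\<close> on sets of arbitrarily small measure
  and with large partial sums on a set of measure bounded below.  The condition on \<open>p\<close> provides
  scales along which such functions have bounded \<open>p \<circ> \<omega>\<close>-modular once \<open>\<omega>\<close> maps their supports next
  to \<open>0\<close>.  A series \<open>\<Sum> \<plusminus> 4^(-k) F k\<close> with random signs then has unbounded partial sums on a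
  set of positive measure.
\<close>

subsection \<open>Energy of a Lipschitz sequence\<close>

text \<open>For fixed x, duality turns a large \<open>L^1\<close> norm of the kernel into a function
  with a large partial sum at x, but that function depends on x. The obstacle is to find one
  function that serves many x at once. A mean of point masses at random points does: for each x the
  probability of failure is at most q^n with the same q < 1, so Fubini yields one choice of points
  that is good for many x. The blocks start at arbitrary p because only kernels whose indices tend
  to infinity are weakly null; a block sum is a difference of two partial sums, one of which is at
  least half as large in absolute value. The sets replacing the points are pieces of joint
  near-level sets of finitely many \<phi> k, so their position is out of control, and it is \<omega>
  that must bring them to where the exponent is close to 1. Along the scales provided by the finite
  lower limit, (1/s)^(p \<sigma> - 1) stays bounded, so there the modular of these functions is
  controlled by their \<open>L^1\<close> norm.\<close>

lemma sum_min_square_le: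
  fixes w :: real
  assumes "w \<ge> 0"
  shows "(\<Sum>r=1..R. min 1 (w\<^sup>2 / (real r)\<^sup>2)) \<le> 4 * w"
proof (cases "w = 0")
  case True
  then show ?thesis by simp
next
  case False
  then have w: "w > 0" using assms by simp
  \<comment> \<open>Since w + r is at most twice the larger of w and r, each term is at most
    \<open>4 * w\<^sup>2 / (w + real r)\<^sup>2\<close>, and this is bounded by a telescoping
    difference.\<close>
  have bnd: "min 1 (w\<^sup>2 / (real r)\<^sup>2) \<le> 4 * w\<^sup>2 * (1 / (w + real r - 1) - 1 / (w + real r))"
    if "r \<ge> 1" for r
  proof -
    have r: "real r \<ge> 1" using that by simp
    have "min 1 (w\<^sup>2 / (real r)\<^sup>2) \<le> 4 * w\<^sup>2 / (w + real r)\<^sup>2"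
    proof (cases "real r \<le> w")
      case True
      then have "(w + real r)\<^sup>2 \<le> (2 * w)\<^sup>2" using r by (intro power_mono) auto
      then have "1 \<le> 4 * w\<^sup>2 / (w + real r)\<^sup>2" using w r by (simp add: field_simps)
      then show ?thesis by linarith
    next
      case False
      then have "(w + real r)\<^sup>2 \<le> (2 * real r)\<^sup>2" using w r by (intro power_mono) auto
      then have "w\<^sup>2 * (w + real r)\<^sup>2 \<le> w\<^sup>2 * (4 * (real r)\<^sup>2)"
        by (intro mult_left_mono) (auto simp: power_mult_distrib)
      then have "w\<^sup>2 / (real r)\<^sup>2 \<le> 4 * w\<^sup>2 / (w + real r)\<^sup>2" using w r
        by (simp add: divide_simps mult_ac)
      then show ?thesis by linarith
    qed
    also have "\<dots> \<le> 4 * w\<^sup>2 * (1 / (w + real r - 1) - 1 / (w + real r))"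
    proof -
      have "1 / (w + real r)\<^sup>2 \<le> 1 / ((w + real r - 1) * (w + real r))"
        using w r by (intro divide_left_mono) (auto simp: power2_eq_square)
      also have "\<dots> = 1 / (w + real r - 1) - 1 / (w + real r)"
        using w r by (simp add: field_simps)
      finally show ?thesis
        using mult_left_mono[of "1 / (w + real r)\<^sup>2" _ "4 * w\<^sup>2"] by simp
    qed
    finally show ?thesis .
  qed
  have tele: "(\<Sum>r=1..R. 1 / (w + real r - 1) - 1 / (w + real r)) = 1 / w - 1 / (w + real R)"
    by (induction R) (auto simp: algebra_simps)
  have "(\<Sum>r=1..R. min 1 (w\<^sup>2 / (real r)\<^sup>2))
      \<le> (\<Sum>r=1..R. 4 * w\<^sup>2 * (1 / (w + real r - 1) - 1 / (w + real r)))"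
    by (intro sum_mono bnd) auto
  also have "\<dots> = 4 * w\<^sup>2 * (1 / w - 1 / (w + real R))"
    unfolding sum_distrib_left[symmetric] tele ..
  also have "\<dots> \<le> 4 * w\<^sup>2 * (1 / w)"
    using w by (intro mult_left_mono) auto
  also have "\<dots> = 4 * w" using w by (simp add: power2_eq_square)
  finally show ?thesis .
qed

lemma abs_diff_le_lipschitz:
  fixes D :: "nat \<Rightarrow> real"
  assumes step: "\<And>i. i < N \<Longrightarrow> \<bar>D (Suc i) - D i\<bar> \<le> b" and "j + r \<le> N"
  shows "\<bar>D (j + r) - D j\<bar> \<le> b * real r"
  using assms(2)
proof (induction r)
  case (Suc r)
  then have "\<bar>D (j + r) - D j\<bar> \<le> b * real r" by simp
  moreover have "\<bar>D (Suc (j + r)) - D (j + r)\<bar> \<le> b" using Suc by (intro step) auto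
  ultimately show ?case by (simp add: algebra_simps)
qed simp

text \<open>One of the two values has at least half the absolute value of the difference, and the
  pair (j, j + r) is charged to it. The charge \<open>\<theta> y r\<close> is the smaller of
  \<open>b\<^sup>2\<close>, from the Lipschitz bound, and \<open>4 * y\<^sup>2 / r\<^sup>2\<close>;
  its sum over all lags r is linear in y. Each value is charged at most twice per lag.\<close>

lemma lipschitz_energy_le:
  fixes D :: "nat \<Rightarrow> real"
  assumes step: "\<And>i. i < N \<Longrightarrow> \<bar>D (Suc i) - D i\<bar> \<le> b" and b: "b > 0"
  shows "(\<Sum>r=1..N. \<Sum>j\<le>N - r. (D (j + r) - D j)\<^sup>2 / (real r)\<^sup>2) \<le> 16 * b * (\<Sum>j\<le>N. \<bar>D j\<bar>)"
proof -
  define \<theta> where "\<theta> y r = b\<^sup>2 * min 1 ((2 * y / b)\<^sup>2 / (real r)\<^sup>2)" for y r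
  have \<theta>0: "\<theta> y r \<ge> 0" for y r unfolding \<theta>_def by simp
  have \<theta>sum: "(\<Sum>r=1..N. \<theta> y r) \<le> 8 * b * y" if "y \<ge> 0" for y
  proof -
    have "(\<Sum>r=1..N. \<theta> y r) = b\<^sup>2 * (\<Sum>r=1..N. min 1 ((2 * y / b)\<^sup>2 / (real r)\<^sup>2))"
      unfolding \<theta>_def sum_distrib_left ..
    also have "\<dots> \<le> b\<^sup>2 * (4 * (2 * y / b))"
      using that b by (intro mult_left_mono sum_min_square_le) auto
    also have "\<dots> = 8 * b * y" using b by (simp add: power2_eq_square)
    finally show ?thesis .
  qed
  have pair: "(D (j + r) - D j)\<^sup>2 / (real r)\<^sup>2 \<le> \<theta> (\<bar>D j\<bar>) r + \<theta> (\<bar>D (j + r)\<bar>) r"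
    if "r \<ge> 1" "j + r \<le> N" for j r
  proof -
    let ?v = "\<bar>D (j + r) - D j\<bar>"
    have lip: "?v \<le> b * real r" using abs_diff_le_lipschitz[of N D b j r] step that by auto
    have one: "?v\<^sup>2 / (real r)\<^sup>2 \<le> \<theta> y r" if y: "?v \<le> 2 * y" for y
    proof -
      have "?v\<^sup>2 \<le> (b * real r)\<^sup>2" using lip by (intro power_mono) auto
      then have "?v\<^sup>2 / (real r)\<^sup>2 \<le> b\<^sup>2" using \<open>r \<ge> 1\<close> by (simp add: field_simps)
      moreover have "?v\<^sup>2 \<le> (2 * y)\<^sup>2" using y by (intro power_mono) auto
      then have "?v\<^sup>2 / (real r)\<^sup>2 \<le> b\<^sup>2 * ((2 * y / b)\<^sup>2 / (real r)\<^sup>2)"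
        using b \<open>r \<ge> 1\<close> by (simp add: field_simps)
      ultimately show ?thesis unfolding \<theta>_def by (auto simp: min_def)
    qed
    have "?v \<le> 2 * \<bar>D j\<bar> \<or> ?v \<le> 2 * \<bar>D (j + r)\<bar>" by linarith
    then show ?thesis using one \<theta>0[of "\<bar>D j\<bar>" r] \<theta>0[of "\<bar>D (j+r)\<bar>" r] by force
  qed
  have "(\<Sum>r=1..N. \<Sum>j\<le>N - r. (D (j + r) - D j)\<^sup>2 / (real r)\<^sup>2)
     \<le> (\<Sum>r=1..N. \<Sum>j\<le>N - r. \<theta> (\<bar>D j\<bar>) r + \<theta> (\<bar>D (j + r)\<bar>) r)"
    by (intro sum_mono pair) auto
  also have "\<dots> = (\<Sum>r=1..N. (\<Sum>j\<le>N - r. \<theta> (\<bar>D j\<bar>) r) + (\<Sum>j\<le>N - r. \<theta> (\<bar>D (j + r)\<bar>) r))"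
    by (simp add: sum.distrib)
  also have "\<dots> \<le> (\<Sum>r=1..N. (\<Sum>j\<le>N. \<theta> (\<bar>D j\<bar>) r) + (\<Sum>j\<le>N. \<theta> (\<bar>D j\<bar>) r))"
  proof (intro sum_mono add_mono)
    fix r assume r: "r \<in> {1..N}"
    show "(\<Sum>j\<le>N - r. \<theta> (\<bar>D j\<bar>) r) \<le> (\<Sum>j\<le>N. \<theta> (\<bar>D j\<bar>) r)"
      by (intro sum_mono2) (auto intro: \<theta>0)
    have "(\<Sum>j\<le>N - r. \<theta> (\<bar>D (j + r)\<bar>) r) = (\<Sum>j\<in>(\<lambda>j. j + r) ` {..N - r}. \<theta> (\<bar>D j\<bar>) r)"
      by (subst sum.reindex) (auto simp: inj_on_def)
    also have "\<dots> \<le> (\<Sum>j\<le>N. \<theta> (\<bar>D j\<bar>) r)"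
      using r by (intro sum_mono2) (auto intro: \<theta>0)
    finally show "(\<Sum>j\<le>N - r. \<theta> (\<bar>D (j + r)\<bar>) r) \<le> (\<Sum>j\<le>N. \<theta> (\<bar>D j\<bar>) r)" .
  qed
  also have "\<dots> = (\<Sum>j\<le>N. \<Sum>r=1..N. 2 * \<theta> (\<bar>D j\<bar>) r)"
    by (subst sum.swap) (simp add: sum_distrib_left)
  also have "\<dots> = (\<Sum>j\<le>N. 2 * (\<Sum>r=1..N. \<theta> (\<bar>D j\<bar>) r))"
    by (simp add: sum_distrib_left)
  also have "\<dots> \<le> (\<Sum>j\<le>N. 2 * (8 * b * \<bar>D j\<bar>))"
    by (intro sum_mono mult_left_mono \<theta>sum) auto
  also have "\<dots> = 16 * b * (\<Sum>j\<le>N. \<bar>D j\<bar>)"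
    by (simp add: sum_distrib_left mult_ac)
  finally show ?thesis .
qed

text \<open>Every index in the middle third of a block of length 3R lies in exactly r windows of
  length r, and since r \<le> R none of these is cut off at the ends of the block.\<close>

lemma sum_windows_ge:
  fixes a :: "nat \<Rightarrow> real"
  assumes a: "\<And>l. a l \<ge> 0" and r: "1 \<le> r" "r \<le> R"
  shows "real r * (\<Sum>l=R..<2*R. a l) \<le> (\<Sum>j\<le>3*R - r. \<Sum>l=j..<j+r. a l)"
proof -
  have "real r * (\<Sum>l=R..<2*R. a l) = (\<Sum>l=R..<2*R. \<Sum>j=l+1-r..l. a l)"
    using r by (auto simp: sum_distrib_left intro!: sum.cong)
  also have "\<dots> = (\<Sum>(l,j)\<in>(SIGMA l:{R..<2*R}. {l+1-r..l}). a l)"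
    by (rule sum.Sigma) auto
  also have "\<dots> \<le> (\<Sum>(l,j)\<in>(\<lambda>(j,l). (l,j)) ` (SIGMA j:{..3*R-r}. {j..<j+r}). a l)"
    using r a by (intro sum_mono2) (auto simp: image_iff)
  also have "\<dots> = (\<Sum>(j,l)\<in>(SIGMA j:{..3*R-r}. {j..<j+r}). a l)"
    by (subst sum.reindex) (auto simp: inj_on_def case_prod_unfold)
  also have "\<dots> = (\<Sum>j\<le>3*R - r. \<Sum>l=j..<j+r. a l)"
    by (rule sum.Sigma[symmetric]) auto
  finally show ?thesis .
qed

subsection \<open>Bounded orthonormal systems and their Lebesgue functions\<close>

lemma prob_space_unit_leb: "prob_space unit_leb"
  by (rule prob_spaceI) (simp add: emeasure_restrict_space)

interpretation unit: prob_space unit_leb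
  by (rule prob_space_unit_leb)

text \<open>The tail unions decrease and each contains a set of measure at least c. This later
  yields points lying in infinitely many of the sets.\<close>

lemma (in finite_measure) measure_limsup_ge:
  assumes A[measurable]: "\<And>n. A n \<in> sets M" and ge: "\<And>n::nat. measure M (A n) \<ge> c"
  shows "measure M (\<Inter>n. \<Union>p\<in>{n..}. A p) \<ge> c"
proof (rule LIMSEQ_le_const)
  show "(\<lambda>n. measure M (\<Union>p\<in>{n..}. A p)) \<longlonglongrightarrow> measure M (\<Inter>n. \<Union>p\<in>{n..}. A p)"
    by (rule finite_Lim_measure_decseq) (auto simp: decseq_def intro: order_trans)
  have "c \<le> measure M (\<Union>p\<in>{n..}. A p)" for n
    using ge[of n] by (rule order_trans) (auto intro!: finite_measure_mono)
  then show "\<exists>N. \<forall>n\<ge>N. c \<le> measure M (\<Union>p\<in>{n..}. A p)" by blast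
qed

lemma integrable_bounded_unit_leb:
  fixes f :: "real \<Rightarrow> real"
  assumes "f \<in> borel_measurable unit_leb" "\<And>x. \<bar>f x\<bar> \<le> B"
  shows "integrable unit_leb f"
  using assms by (intro unit.integrable_const_bound[of _ B]) auto

text \<open>The bound is required at every point, so that estimates need no exceptional sets; the
  final theorem reduces to this case by modifying each function on a null set.\<close>

locale bounded_ons =
  fixes \<phi> :: "nat \<Rightarrow> real \<Rightarrow> real" and M :: real
  assumes meas[measurable]: "\<And>n. \<phi> n \<in> borel_measurable unit_leb"
    and bound: "\<And>n x. \<bar>\<phi> n x\<bar> \<le> M"
    and ortho: "\<And>n k. (\<integral>x. \<phi> n x * \<phi> k x \<partial>unit_leb) = (if n = k then 1 else 0)"
begin

lemma bound_mult: "\<bar>\<phi> n x * \<phi> k y\<bar> \<le> M\<^sup>2"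
  unfolding abs_mult power2_eq_square using bound[of n x] by (intro mult_mono bound) auto

lemma int_mult[simp]: "integrable unit_leb (\<lambda>x. \<phi> n x * \<phi> k x)"
  by (rule integrable_bounded_unit_leb[OF _ bound_mult]) simp

lemma M_pos: "M > 0"
proof (rule ccontr)
  assume "\<not> M > 0"
  then have "\<phi> 0 x = 0" for x using bound[of 0 x] by auto
  then show False using ortho[of 0 0] by simp
qed

lemma integral_combination_square:
  assumes "finite S"
  shows "integrable unit_leb (\<lambda>t. (\<Sum>l\<in>S. c l * \<phi> l t)\<^sup>2)"
    and "(\<integral>t. (\<Sum>l\<in>S. c l * \<phi> l t)\<^sup>2 \<partial>unit_leb) = (\<Sum>l\<in>S. (c l)\<^sup>2)"
proof -
  have eq: "(\<Sum>l\<in>S. c l * \<phi> l t)\<^sup>2 = (\<Sum>l\<in>S. \<Sum>k\<in>S. c l * c k * (\<phi> l t * \<phi> k t))" for t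
    unfolding power2_eq_square sum_product by (simp add: mult_ac)
  show "integrable unit_leb (\<lambda>t. (\<Sum>l\<in>S. c l * \<phi> l t)\<^sup>2)"
    unfolding eq by simp
  show "(\<integral>t. (\<Sum>l\<in>S. c l * \<phi> l t)\<^sup>2 \<partial>unit_leb) = (\<Sum>l\<in>S. (c l)\<^sup>2)"
    unfolding eq using assms by (simp add: ortho power2_eq_square if_distrib cong: if_cong)
qed

text \<open>By Bessel's inequality the squares of the coefficients are summable.\<close>

lemma coeff_tendsto_0:
  assumes g[measurable]: "g \<in> borel_measurable unit_leb" and B: "\<And>x. \<bar>g x\<bar> \<le> B"
  shows "(\<lambda>n. \<integral>t. g t * \<phi> n t \<partial>unit_leb) \<longlonglongrightarrow> 0"
proof -
  define c where "c n = (\<integral>t. g t * \<phi> n t \<partial>unit_leb)" for n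
  have B0: "B \<ge> 0" using B[of 0] by simp
  have ig: "integrable unit_leb (\<lambda>t. g t * \<phi> n t)" for n
    using B0 by (intro integrable_bounded_unit_leb[of _ "B * M"])
      (auto simp: abs_mult intro!: mult_mono B bound)
  have ig2: "integrable unit_leb (\<lambda>t. (g t)\<^sup>2)"
    using B0 by (intro integrable_bounded_unit_leb[of _ "B\<^sup>2"])
      (auto simp: abs_square_le_1 power_mono[OF B] abs_le_square_iff[symmetric] B)
  have "(\<Sum>n<N. (c n)\<^sup>2) \<le> (\<integral>t. (g t)\<^sup>2 \<partial>unit_leb)" for N
  proof -
    let ?s = "\<lambda>t. \<Sum>n<N. c n * \<phi> n t"
    have "0 \<le> (\<integral>t. (g t - ?s t)\<^sup>2 \<partial>unit_leb)" by simp
    also have "(\<lambda>t. (g t - ?s t)\<^sup>2) = (\<lambda>t. (g t)\<^sup>2 - 2 * (\<Sum>n<N. c n * (g t * \<phi> n t)) + (?s t)\<^sup>2)"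
      by (auto simp: power2_diff sum_distrib_left mult_ac intro!: sum.cong)
    also have "(\<integral>t. \<dots> t \<partial>unit_leb) = (\<integral>t. (g t)\<^sup>2 \<partial>unit_leb) - 2 * (\<Sum>n<N. c n * c n) + (\<Sum>n<N. (c n)\<^sup>2)"
      using ig ig2 integral_combination_square[of "{..<N}" c] by (simp add: c_def[symmetric])
    finally show ?thesis by (simp add: power2_eq_square)
  qed
  then have "summable (\<lambda>n. (c n)\<^sup>2)"
    by (intro summableI_nonneg_bounded) auto
  then have "(\<lambda>n. sqrt ((c n)\<^sup>2)) \<longlonglongrightarrow> 0"
    using summable_LIMSEQ_zero tendsto_real_sqrt by fastforce
  then show ?thesis unfolding c_def by (simp add: tendsto_rabs_zero_iff)
qed

text \<open>By orthonormality the integrated square of a kernel difference is the sum of the squares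
  \<open>(\<phi> (p + l) x)\<^sup>2\<close> over a window. For lag r the windows contribute at least
  r * R / 2, and the weight 1 / r^2 leaves R / (2 r), whose sum over r \<le> R is the harmonic sum.
  The energy bound with increments at most \<open>M\<^sup>2\<close> then rules out that all kernels
  are small.\<close>

lemma block_kernel_large:
  assumes R: "R \<ge> 1" and x: "(\<Sum>l=R..<2*R. (\<phi> (p + l) x)\<^sup>2) \<ge> real R / 2"
  shows "\<exists>i\<le>3*R. (\<integral>t. \<bar>\<Sum>l<i. \<phi> (p + l) x * \<phi> (p + l) t\<bar> \<partial>unit_leb) \<ge> harm R / (128 * M\<^sup>2)"
proof (rule ccontr)
  define D where "D t i = (\<Sum>l<i. \<phi> (p + l) x * \<phi> (p + l) t)" for t i
  \<comment> \<open>There are 3R + 1 \<le> 4R kernels, so c solves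
    \<open>16 * M\<^sup>2 * (4 * R * c) = R / 2 * harm R\<close>.\<close>
  define c where "c = harm R / (128 * M\<^sup>2)"
  assume "\<not> ?thesis"
  then have small: "(\<integral>t. \<bar>D t i\<bar> \<partial>unit_leb) < c" if "i \<le> 3 * R" for i
    using that unfolding D_def c_def by force
  have [measurable]: "(\<lambda>t. D t i) \<in> borel_measurable unit_leb" for i unfolding D_def by simp
  have Db: "\<bar>D t i\<bar> \<le> real i * M\<^sup>2" for t i
    unfolding D_def using sum_norm_bound[of "{..<i}" "\<lambda>l. \<phi> (p + l) x * \<phi> (p + l) t" "M\<^sup>2"] bound_mult
    by auto
  have iD: "integrable unit_leb (\<lambda>t. \<bar>D t i\<bar>)" for i
    by (rule integrable_bounded_unit_leb[of _ "real i * M\<^sup>2"]) (auto simp: Db)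
  have diff: "D t (j + r) - D t j = (\<Sum>l\<in>{p+j..<p+j+r}. \<phi> l x * \<phi> l t)" for t j r
  proof -
    have "D t (j + r) - D t j = (\<Sum>l\<in>{j..<j+r}. \<phi> (p + l) x * \<phi> (p + l) t)"
      unfolding D_def by (induction r) auto
    also have "\<dots> = (\<Sum>l\<in>{p+j..<p+j+r}. \<phi> l x * \<phi> l t)"
      by (rule sum.reindex_bij_witness[of _ "\<lambda>l. l - p" "\<lambda>l. p + l"]) auto
    finally show ?thesis .
  qed
  have idiff: "integrable unit_leb (\<lambda>t. (D t (j + r) - D t j)\<^sup>2)"
    and diff_int: "(\<integral>t. (D t (j + r) - D t j)\<^sup>2 \<partial>unit_leb) = (\<Sum>l=j..<j+r. (\<phi> (p+l) x)\<^sup>2)" for j r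
  proof -
    show "integrable unit_leb (\<lambda>t. (D t (j + r) - D t j)\<^sup>2)"
      unfolding diff by (rule integral_combination_square) simp
    have "(\<integral>t. (D t (j + r) - D t j)\<^sup>2 \<partial>unit_leb) = (\<Sum>l\<in>{p+j..<p+j+r}. (\<phi> l x)\<^sup>2)"
      unfolding diff by (rule integral_combination_square) simp
    also have "\<dots> = (\<Sum>l=j..<j+r. (\<phi> (p+l) x)\<^sup>2)"
      by (rule sum.reindex_bij_witness[of _ "\<lambda>l. p + l" "\<lambda>l. l - p"]) auto
    finally show "(\<integral>t. (D t (j + r) - D t j)\<^sup>2 \<partial>unit_leb) = (\<Sum>l=j..<j+r. (\<phi> (p+l) x)\<^sup>2)" .
  qed
  have "real R / 2 * harm R = (\<Sum>r=1..R. real R / 2 / real r)"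
    by (simp add: harm_def sum_distrib_left field_simps)
  also have "\<dots> \<le> (\<Sum>r=1..R. \<Sum>j\<le>3*R - r. (\<Sum>l=j..<j+r. (\<phi> (p+l) x)\<^sup>2) / (real r)\<^sup>2)"
  proof (rule sum_mono)
    fix r assume r: "r \<in> {1..R}"
    have "real r * (real R / 2) \<le> real r * (\<Sum>l=R..<2*R. (\<phi> (p + l) x)\<^sup>2)"
      using x by (intro mult_left_mono) auto
    also have "\<dots> \<le> (\<Sum>j\<le>3*R - r. \<Sum>l=j..<j+r. (\<phi> (p+l) x)\<^sup>2)"
      using r by (intro sum_windows_ge) auto
    finally have "real r * (real R / 2) / (real r)\<^sup>2 \<le> (\<Sum>j\<le>3*R - r. \<Sum>l=j..<j+r. (\<phi> (p+l) x)\<^sup>2) / (real r)\<^sup>2"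
      by (intro divide_right_mono) auto
    then show "real R / 2 / real r \<le> (\<Sum>j\<le>3*R - r. (\<Sum>l=j..<j+r. (\<phi> (p+l) x)\<^sup>2) / (real r)\<^sup>2)"
      using r by (simp add: sum_divide_distrib power2_eq_square)
  qed
  also have "\<dots> \<le> (\<Sum>r=1..3*R. \<Sum>j\<le>3*R - r. (\<Sum>l=j..<j+r. (\<phi> (p+l) x)\<^sup>2) / (real r)\<^sup>2)"
    by (intro sum_mono2) (auto intro!: sum_nonneg divide_nonneg_nonneg)
  also have "\<dots> = (\<integral>t. (\<Sum>r=1..3*R. \<Sum>j\<le>3*R - r. (D t (j + r) - D t j)\<^sup>2 / (real r)\<^sup>2) \<partial>unit_leb)"
    using idiff by (simp add: diff_int)
  also have "\<dots> \<le> (\<integral>t. 16 * M\<^sup>2 * (\<Sum>j\<le>3*R. \<bar>D t j\<bar>) \<partial>unit_leb)"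
  proof (rule integral_mono)
    show "integrable unit_leb (\<lambda>t. \<Sum>r=1..3*R. \<Sum>j\<le>3*R - r. (D t (j + r) - D t j)\<^sup>2 / (real r)\<^sup>2)"
      using idiff by simp
    show "integrable unit_leb (\<lambda>t. 16 * M\<^sup>2 * (\<Sum>j\<le>3*R. \<bar>D t j\<bar>))" using iD by simp
    show "(\<Sum>r=1..3*R. \<Sum>j\<le>3*R - r. (D t (j + r) - D t j)\<^sup>2 / (real r)\<^sup>2) \<le> 16 * M\<^sup>2 * (\<Sum>j\<le>3*R. \<bar>D t j\<bar>)" for t
      using M_pos by (intro lipschitz_energy_le) (auto simp: D_def bound_mult)
  qed
  also have "\<dots> = 16 * M\<^sup>2 * (\<Sum>j\<le>3*R. (\<integral>t. \<bar>D t j\<bar> \<partial>unit_leb))" using iD by simp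
  also have "\<dots> < 16 * M\<^sup>2 * (\<Sum>j\<le>3*R. c)"
    using M_pos by (intro mult_strict_left_mono sum_strict_mono small) auto
  also have "\<dots> = 16 * M\<^sup>2 * (real (3 * R + 1) * c)" by simp
  also have "\<dots> \<le> 16 * M\<^sup>2 * (real (4 * R) * c)"
    using R by (intro mult_left_mono mult_right_mono) (auto simp: c_def harm_nonneg)
  also have "\<dots> = real R / 2 * harm R" using M_pos by (simp add: c_def)
  finally show False by simp
qed

text \<open>The sum has integral R, so these are the points where the middle third of the block
  carries at least half of its mean.\<close>

definition block_set :: "nat \<Rightarrow> nat \<Rightarrow> real set" where
  "block_set R p = {x \<in> {0..1}. (\<Sum>l=R..<2*R. (\<phi> (p + l) x)\<^sup>2) \<ge> real R / 2}"

lemma block_set_sets[measurable]: "block_set R p \<in> sets unit_leb"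
proof -
  have "block_set R p = {x \<in> space unit_leb. (\<Sum>l=R..<2*R. (\<phi> (p + l) x)\<^sup>2) \<ge> real R / 2}"
    unfolding block_set_def by simp
  also have "\<dots> \<in> sets unit_leb" by measurable
  finally show ?thesis .
qed

text \<open>The sum has integral R, contributes at most R / 2 where it is below R / 2, and never
  exceeds \<open>R * M\<^sup>2\<close>; hence the set where it is large cannot be small. The bound
  depends neither on R nor on p.\<close>

lemma measure_block_set:
  assumes R: "R \<ge> 1"
  shows "measure unit_leb (block_set R p) \<ge> 1 / (2 * M\<^sup>2)"
proof -
  let ?s = "\<lambda>x. \<Sum>l=R..<2*R. (\<phi> (p + l) x)\<^sup>2"
  have isq: "integrable unit_leb (\<lambda>x. (\<phi> n x)\<^sup>2)" "(\<integral>x. (\<phi> n x)\<^sup>2 \<partial>unit_leb) = 1" for n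
    using ortho[of n n] int_mult[of n n] by (auto simp: power2_eq_square)
  have prob1: "measure unit_leb {0..1} = 1" using unit.prob_space by simp
  have sub: "block_set R p \<inter> {0..1} = block_set R p" unfolding block_set_def by blast
  have "real R = (\<integral>x. ?s x \<partial>unit_leb)" using isq by simp
  also have "\<dots> \<le> (\<integral>x. real R / 2 + real R * M\<^sup>2 * indicator (block_set R p) x \<partial>unit_leb)"
  proof (rule integral_mono)
    show "integrable unit_leb ?s" using isq by simp
    show "integrable unit_leb (\<lambda>x. real R / 2 + real R * M\<^sup>2 * indicator (block_set R p) x)"
      by (intro Bochner_Integration.integrable_add integrable_const integrable_mult_right integrable_real_indicator) (auto simp: unit.emeasure_eq_measure)
    fix x assume "x \<in> space unit_leb"
    then have x: "x \<in> {0..1}" by simp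
    have "?s x \<le> (\<Sum>l=R..<2*R. M\<^sup>2)"
      by (intro sum_mono) (use bound_mult[of _ x _ x] in \<open>auto simp: power2_eq_square abs_le_iff\<close>)
    then have "?s x \<le> real R * M\<^sup>2" by simp
    then show "?s x \<le> real R / 2 + real R * M\<^sup>2 * indicator (block_set R p) x"
      using x by (auto simp: block_set_def indicator_def)
  qed
  also have "\<dots> = real R / 2 + real R * M\<^sup>2 * measure unit_leb (block_set R p)"
    by (subst Bochner_Integration.integral_add)
      (auto intro!: integrable_real_indicator simp: prob1 sub unit.emeasure_eq_measure)
  finally have "real R * (1 / 2) \<le> real R * (M\<^sup>2 * measure unit_leb (block_set R p))" by simp
  then show ?thesis using M_pos R by (simp add: field_simps)
qed

end

subsection \<open>Weak convergence against product densities\<close>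

lemma diagonal_convergent:
  fixes f :: "nat \<Rightarrow> nat \<Rightarrow> real"
  assumes bdd: "\<And>k n. \<bar>f k n\<bar> \<le> B"
  obtains d where "strict_mono d" "\<And>n. convergent (\<lambda>k. f (d k) n)"
proof -
  interpret subseqs "\<lambda>n s. convergent (\<lambda>k. f (s k) n)"
  proof
    fix n :: nat and s :: "nat \<Rightarrow> nat"
    have "\<And>k. f (s k) n \<in> {-B..B}" using bdd by (simp add: abs_le_iff minus_le_iff)
    then obtain l s' where "strict_mono s'" "((\<lambda>k. f (s k) n) \<circ> s') \<longlonglongrightarrow> l"
      using compact_Icc compact_imp_seq_compact seq_compactE by metis
    then show "\<exists>r'. strict_mono r' \<and> convergent (\<lambda>k. f ((s \<circ> r') k) n)"
      by (auto simp: comp_def convergent_def)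
  qed
  have "convergent (\<lambda>k. f (diagseq k) n)" for n
  proof -
    have "convergent (\<lambda>k. f ((diagseq \<circ> ((+) (Suc n))) k) n)"
    proof (rule diagseq_holds)
      fix r s :: "nat \<Rightarrow> nat" and n :: nat
      assume "strict_mono r" "convergent (\<lambda>k. f (s k) n)"
      then show "convergent (\<lambda>k. f ((s \<circ> r) k) n)"
        using convergent_subseq_convergent[of "\<lambda>k. f (s k) n" r] by (simp add: comp_def)
    qed
    then have "convergent (\<lambda>k. f (diagseq (k + Suc n)) n)" by (simp add: comp_def add.commute)
    then show ?thesis using convergent_ignore_initial_segment[of "\<lambda>k. f (diagseq k) n" "Suc n"] by simp
  qed
  then show ?thesis using that subseq_diagseq by blast
qed

text \<open>The sets with limit 0 form a Dynkin system. For a disjoint union the limit passes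
  through the series by Tannery's theorem, the i-th integral being at most C times the measure of
  the i-th set for all j. \<open>\<Omega>\<close> may be larger than the space, so that half-lines
  of the whole real line can serve as generators.\<close>

lemma (in finite_measure) weak_null_generator:
  fixes w :: "nat \<Rightarrow> 'a \<Rightarrow> real"
  assumes E: "Int_stable E" "E \<subseteq> Pow \<Omega>" "space M \<subseteq> \<Omega>"
    and sub: "\<And>A. A \<in> sigma_sets \<Omega> E \<Longrightarrow> A \<inter> space M \<in> sets M"
    and w[measurable]: "\<And>j. w j \<in> borel_measurable M" and C: "\<And>j x. \<bar>w j x\<bar> \<le> C"
    and lim: "\<And>A. A \<in> E \<Longrightarrow> (\<lambda>j. \<integral>x. w j x * indicator A x \<partial>M) \<longlonglongrightarrow> 0"
    and lim_space: "(\<lambda>j. \<integral>x. w j x \<partial>M) \<longlonglongrightarrow> 0"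
    and A: "A \<in> sigma_sets \<Omega> E"
  shows "(\<lambda>j. \<integral>x. w j x * indicator A x \<partial>M) \<longlonglongrightarrow> 0"
proof -
  have C0: "C \<ge> 0" using C[of 0 undefined] by linarith
  have iw: "integrable M (w j)" for j
    by (rule integrable_const_bound[of _ C]) (auto simp: C)
  have ind[measurable]: "(\<lambda>x. indicator A x :: real) \<in> borel_measurable M" if "A \<in> sigma_sets \<Omega> E" for A
    using sub[OF that] by (subst borel_measurable_indicator_iff) simp
  have iwA: "integrable M (\<lambda>x. w j x * indicator A x)" if "A \<in> sigma_sets \<Omega> E" for j A
    using ind[OF that] C C0 by (intro integrable_const_bound[of _ C])
      (auto simp: abs_mult split: split_indicator)
  show ?thesis
    using E(1,2) A
  proof (induct rule: sigma_sets_induct_disjoint)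
    case (basic A)
    then show ?case by (rule lim)
  next
    case empty
    then show ?case by simp
  next
    case (compl A)
    have "(\<integral>x. w j x * indicator (\<Omega> - A) x \<partial>M) = (\<integral>x. w j x \<partial>M) - (\<integral>x. w j x * indicator A x \<partial>M)" for j
      unfolding Bochner_Integration.integral_diff[OF iw iwA[OF compl(1)], symmetric]
      using E(3) by (intro Bochner_Integration.integral_cong) (auto split: split_indicator)
    then show ?case using tendsto_diff[OF lim_space compl(2)] by simp
  next
    case (union A)
    have Ai: "A i \<in> sigma_sets \<Omega> E" for i using union by auto
    have meas: "A i \<inter> space M \<in> sets M" for i using sub Ai by auto
    have bd: "\<bar>\<integral>x. w j x * indicator (A i) x \<partial>M\<bar> \<le> C * measure M (A i \<inter> space M)" for i j
    proof -
      have "\<bar>\<integral>x. w j x * indicator (A i) x \<partial>M\<bar> \<le> (\<integral>x. \<bar>w j x * indicator (A i) x\<bar> \<partial>M)"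
        by (rule integral_abs_bound)
      also have "\<dots> \<le> (\<integral>x. C * indicator (A i \<inter> space M) x \<partial>M)"
      proof (intro integral_mono integrable_abs iwA[OF Ai] integrable_mult_right integrable_real_indicator)
        show "emeasure M (A i \<inter> space M) < \<infinity>" by (simp add: emeasure_eq_measure)
      qed (use meas[of i] C C0 in \<open>auto simp: abs_mult split: split_indicator\<close>)
      also have "\<dots> = C * measure M (A i \<inter> space M)" using meas by simp
      finally show ?thesis .
    qed
    have disj: "disjoint_family (\<lambda>i. A i \<inter> space M)"
      using union(1) by (auto simp: disjoint_family_on_def)
    have sm: "summable (\<lambda>i. C * measure M (A i \<inter> space M))"
      using meas disj by (intro summable_mult sums_summable[OF finite_measure_UNION]) auto
    have eq: "(\<integral>x. w j x * indicator (\<Union>i. A i) x \<partial>M) = (\<Sum>i. \<integral>x. w j x * indicator (A i) x \<partial>M)" for j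
    proof -
      have U: "(\<Union>i. A i) \<in> sigma_sets \<Omega> E" using Ai by (intro sigma_sets.Union) auto
      have sums: "(\<lambda>i. w j x * indicator (A i) x) sums (w j x * indicator (\<Union>i. A i) x)" for x
        using union(1) by (intro sums_mult indicator_sums) (auto simp: disjoint_family_on_def)
      have "(\<lambda>n. \<integral>x. (\<Sum>i<n. w j x * indicator (A i) x) \<partial>M) \<longlonglongrightarrow> (\<integral>x. w j x * indicator (\<Union>i. A i) x \<partial>M)"
      proof (rule integral_dominated_convergence[where w="\<lambda>_. C"])
        show "AE x in M. (\<lambda>n. \<Sum>i<n. w j x * indicator (A i) x) \<longlonglongrightarrow> w j x * indicator (\<Union> (range A)) x"
          using sums by (auto simp: sums_def)
        show "AE x in M. norm (\<Sum>i<n. w j x * indicator (A i) x) \<le> C" for n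
        proof (rule AE_I2)
          fix x
          have "(\<Sum>i<n. w j x * indicator (A i) x) = w j x * indicator (\<Union>i<n. A i) x"
            using union(1) by (subst indicator_UN_disjoint) (auto simp: disjoint_family_on_def sum_distrib_left)
          then show "norm (\<Sum>i<n. w j x * indicator (A i) x) \<le> C"
            using C[of j x] C0 by (auto simp: abs_mult indicator_def)
        qed
        show "(\<lambda>x. w j x * indicator (\<Union> (range A)) x) \<in> borel_measurable M"
          using ind[OF U] by measurable
        show "(\<lambda>x. \<Sum>i<n. w j x * indicator (A i) x) \<in> borel_measurable M" for n
          using ind[OF Ai] by measurable
      qed auto
      also have "(\<lambda>n. \<integral>x. (\<Sum>i<n. w j x * indicator (A i) x) \<partial>M) = (\<lambda>n. \<Sum>i<n. \<integral>x. w j x * indicator (A i) x \<partial>M)"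
        by (intro ext Bochner_Integration.integral_sum iwA Ai)
      finally show ?thesis by (simp add: sums_def[symmetric] sums_iff)
    qed
    have "(\<lambda>j. \<Sum>i. \<integral>x. w j x * indicator (A i) x \<partial>M) \<longlonglongrightarrow> (\<Sum>i. 0)"
    proof (rule tannerys_theorem[of _ "\<lambda>_. 0", rotated 2, THEN conjunct2, THEN conjunct2])
      show "summable (\<lambda>i. C * measure M (A i \<inter> space M))" by (rule sm)
      show "\<forall>\<^sub>F (k, n) in at_top \<times>\<^sub>F sequentially. norm (\<integral>x. w n x * indicator (A k) x \<partial>M) \<le> C * measure M (A k \<inter> space M)"
        using bd by (auto intro!: always_eventually)
      show "\<And>k. (\<lambda>n. \<integral>x. w n x * indicator (A k) x \<partial>M) \<longlonglongrightarrow> 0" using union(3) .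
    qed auto
    then show ?case unfolding eq by simp
  qed
qed

lemma weak_null_unit_leb:
  fixes w :: "nat \<Rightarrow> real \<Rightarrow> real"
  assumes w[measurable]: "\<And>j. w j \<in> borel_measurable unit_leb" and C: "\<And>j x. \<bar>w j x\<bar> \<le> C"
    and lim: "\<And>q. q \<in> \<rat> \<Longrightarrow> (\<lambda>j. \<integral>x. w j x * indicator {..q} x \<partial>unit_leb) \<longlonglongrightarrow> 0"
    and A: "A \<in> sets unit_leb"
  shows "(\<lambda>j. \<integral>x. w j x * indicator A x \<partial>unit_leb) \<longlonglongrightarrow> 0"
proof -
  define E :: "real set set" where "E = atMost ` \<rat>"
  \<comment> \<open>Only rational half-lines are assumed, because a diagonal sequence can handle
    only countably many sets.\<close>
  have "borel = sigma UNIV (atMost ` (\<rat>::real set))"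
  proof (rule borel_eq_sigmaI1[OF borel_eq_atMost])
    fix X :: "real set" assume "X \<in> range atMost"
    then obtain a where X: "X = {..a}" by auto
    have "X = (\<Inter>q\<in>{q\<in>\<rat>. a < q}. {..q})"
    proof -
      have "x \<le> a" if "\<forall>q. q \<in> \<rat> \<and> a < q \<longrightarrow> x \<le> q" for x
      proof (rule ccontr)
        assume "\<not> x \<le> a"
        then obtain q where "q \<in> \<rat>" "a < q" "q < x" using Rats_dense_in_real[of a x] by auto
        then show False using that by force
      qed
      then show ?thesis unfolding X by force
    qed
    also have "\<dots> \<in> sets (sigma UNIV (atMost ` \<rat>))"
    proof (rule sets.countable_INT')
      show "countable {q \<in> \<rat>. a < q}" by (rule countable_subset[OF _ countable_rat]) auto
      show "{q \<in> \<rat>. a < q} \<noteq> {}" using Rats_dense_in_real[of a "a+1"] by auto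
    qed auto
    finally show "X \<in> sets (sigma UNIV (atMost ` \<rat>))" .
  qed auto
  then have E: "sigma_sets UNIV E = sets borel"
    unfolding E_def by (metis sets_measure_of subset_UNIV Pow_UNIV)
  have lim_space: "(\<lambda>j. \<integral>x. w j x \<partial>unit_leb) \<longlonglongrightarrow> 0"
  proof -
    have "(\<integral>x. w j x \<partial>unit_leb) = (\<integral>x. w j x * indicator {..1} x \<partial>unit_leb)" for j
      by (intro Bochner_Integration.integral_cong) auto
    then show ?thesis using lim[of 1] by simp
  qed
  have bor: "(\<lambda>j. \<integral>x. w j x * indicator B x \<partial>unit_leb) \<longlonglongrightarrow> 0" if B: "B \<in> sets borel" for B
  proof (rule unit.weak_null_generator[where E=E and \<Omega>=UNIV and C=C])
    show "Int_stable E" unfolding E_def Int_stable_def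
    proof (clarify)
      fix a b :: real assume "a \<in> \<rat>" "b \<in> \<rat>"
      then have "min a b \<in> \<rat>" by (simp add: min_def)
      moreover have "{..a} \<inter> {..b} = {..min a b}" by auto
      ultimately show "{..a} \<inter> {..b} \<in> atMost ` \<rat>" by blast
    qed
    show "A \<in> sigma_sets UNIV E \<Longrightarrow> A \<inter> space unit_leb \<in> sets unit_leb" for A
      unfolding E by (auto simp: sets_restrict_space Int_commute)
  qed (use lim lim_space C B E in \<open>auto simp: E_def\<close>)
  have "A \<in> sets lebesgue" using A by (auto simp: sets_restrict_space)
  then obtain B N where B: "B \<in> sets borel" and N: "negligible N" "B \<union> N = A"
    using sets_lebesgue_almost_borel by metis
  have "AE x in lebesgue. x \<notin> N" using N(1) by (simp add: AE_not_in negligible_iff_null_sets)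
  then have AEN: "AE x in unit_leb. x \<notin> N" by (subst AE_restrict_space_iff) auto
  have "(\<integral>x. w j x * indicator A x \<partial>unit_leb) = (\<integral>x. w j x * indicator B x \<partial>unit_leb)" for j
  proof (rule integral_cong_AE)
    have [measurable]: "B \<inter> {0..1} \<in> sets unit_leb"
      using B by (auto simp: sets_restrict_space Int_commute)
    then have [measurable]: "(\<lambda>x. indicator B x::real) \<in> borel_measurable unit_leb"
      by (subst borel_measurable_indicator_iff) simp
    show "(\<lambda>x. w j x * indicator A x) \<in> borel_measurable unit_leb" using A by measurable
    show "(\<lambda>x. w j x * indicator B x) \<in> borel_measurable unit_leb" by measurable
    show "AE x in unit_leb. w j x * indicator A x = w j x * indicator B x"
      using AEN N(2) by (elim AE_mp) (intro AE_I2, auto split: split_indicator)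
  qed
  then show ?thesis using bor[OF B] by simp
qed

text \<open>On a box the integral factorises and the limit is taken in each factor. Boxes are stable
  under intersection and generate the product \<sigma>-algebra; the products of densities stay
  bounded by \<open>C ^ card I\<close>, so the limit extends to every measurable set, in particular
  to one described by all coordinates jointly.\<close>

lemma weak_tensor_limit:
  fixes \<rho> :: "nat \<Rightarrow> 'a \<Rightarrow> real"
  assumes N: "prob_space N" and \<rho>[measurable]: "\<And>j. \<rho> j \<in> borel_measurable N"
    and C: "\<And>j x. \<bar>\<rho> j x\<bar> \<le> C"
    and lim: "\<And>A. A \<in> sets N \<Longrightarrow> (\<lambda>j. \<integral>x. \<rho> j x * indicator A x \<partial>N) \<longlonglongrightarrow> measure N A"
    and I: "finite I" and G: "G \<in> sets (Pi\<^sub>M I (\<lambda>_. N))"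
  shows "(\<lambda>j. \<integral>t. (\<Prod>i\<in>I. \<rho> j (t i)) * indicator G t \<partial>Pi\<^sub>M I (\<lambda>_. N)) \<longlonglongrightarrow> measure (Pi\<^sub>M I (\<lambda>_. N)) G"
proof -
  interpret N: prob_space N by (rule N)
  interpret P: finite_product_prob_space "\<lambda>_. N" I by standard (rule I)
  let ?P = "Pi\<^sub>M I (\<lambda>_. N)"
  let ?w = "\<lambda>j t. (\<Prod>i\<in>I. \<rho> j (t i)) - 1"
  have C0: "C \<ge> 0" using C[of 0 undefined] by linarith
  have pb: "\<bar>\<Prod>i\<in>I. \<rho> j (t i)\<bar> \<le> C ^ card I" for j t
    using prod_mono[of I "\<lambda>i. \<bar>\<rho> j (t i)\<bar>" "\<lambda>_. C"] C by (simp add: abs_prod)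
  have split: "(\<integral>t. ?w j t * indicator A t \<partial>?P) =
      (\<integral>t. (\<Prod>i\<in>I. \<rho> j (t i)) * indicator A t \<partial>?P) - measure ?P A" if A: "A \<in> sets ?P" for j A
  proof -
    have "integrable ?P (\<lambda>t. (\<Prod>i\<in>I. \<rho> j (t i)) * indicator A t)"
      using A pb C0 by (intro P.integrable_const_bound[of _ "C ^ card I"])
        (auto simp: abs_mult indicator_def)
    moreover have "integrable ?P (indicator A :: _ \<Rightarrow> real)"
      using A by (intro integrable_real_indicator) (auto simp: P.emeasure_eq_measure)
    ultimately show ?thesis
      using A by (simp add: left_diff_distrib sets.Int_space_eq2)
  qed
  have main: "(\<lambda>j. \<integral>t. (\<Prod>i\<in>I. \<rho> j (t i)) * indicator A t \<partial>?P) \<longlonglongrightarrow> measure ?P A"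
    if "A \<in> prod_algebra I (\<lambda>_. N)" for A
  proof -
    from that obtain F where F: "A = Pi\<^sub>E I F" "\<And>i. i \<in> I \<Longrightarrow> F i \<in> sets N"
      by (elim prod_algebraE_all) auto
    have "(\<integral>t. (\<Prod>i\<in>I. \<rho> j (t i)) * indicator A t \<partial>?P) = (\<Prod>i\<in>I. \<integral>x. \<rho> j x * indicator (F i) x \<partial>N)" for j
    proof -
      have "(\<integral>t. (\<Prod>i\<in>I. \<rho> j (t i)) * indicator A t \<partial>?P) = (\<integral>t. (\<Prod>i\<in>I. \<rho> j (t i) * indicator (F i) (t i)) \<partial>?P)"
      proof (rule Bochner_Integration.integral_cong)
        fix t assume t: "t \<in> space ?P"
        have "indicator A t = (\<Prod>i\<in>I. indicator (F i) (t i) :: real)"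
        proof (cases "t \<in> A")
          case True
          then have "(\<Prod>i\<in>I. indicator (F i) (t i) :: real) = 1"
            unfolding F by (intro prod.neutral) (auto simp: PiE_iff)
          then show ?thesis using True by simp
        next
          case False
          then obtain i where "i \<in> I" "t i \<notin> F i" using t unfolding F by (auto simp: space_PiM PiE_iff)
          then have "(\<Prod>i\<in>I. indicator (F i) (t i) :: real) = 0"
            using I by (intro prod_zero) (auto intro!: bexI[of _ i])
          then show ?thesis using False by simp
        qed
        then show "(\<Prod>i\<in>I. \<rho> j (t i)) * indicator A t = (\<Prod>i\<in>I. \<rho> j (t i) * indicator (F i) (t i))"
          by (simp add: prod.distrib)
      qed simp
      also have "\<dots> = (\<Prod>i\<in>I. \<integral>x. \<rho> j x * indicator (F i) x \<partial>N)"
        using F C C0 by (intro P.product_integral_prod I N.integrable_const_bound[of _ C])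
          (auto simp: abs_mult indicator_def)
      finally show ?thesis .
    qed
    moreover have "measure ?P A = (\<Prod>i\<in>I. measure N (F i))" unfolding F(1) using F(2) by (rule P.prob_times)
    ultimately show ?thesis using F(2) by (auto intro!: tendsto_prod lim)
  qed
  have "(\<lambda>j. \<integral>t. ?w j t * indicator G t \<partial>?P) \<longlonglongrightarrow> 0"
  proof (rule P.weak_null_generator[where E="prod_algebra I (\<lambda>_. N)" and \<Omega>="space ?P" and C="C ^ card I + 1"])
    show "Int_stable (prod_algebra I (\<lambda>_. N))" by (rule Int_stable_prod_algebra)
    show "prod_algebra I (\<lambda>_. N) \<subseteq> Pow (space ?P)" unfolding space_PiM by (rule prod_algebra_sets_into_space)
    show "A \<in> sigma_sets (space ?P) (prod_algebra I (\<lambda>_. N)) \<Longrightarrow> A \<inter> space ?P \<in> sets ?P" for A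
      unfolding space_PiM sets_PiM[symmetric] by (simp add: sets.Int_space_eq2 flip: space_PiM)
    show "\<bar>?w j t\<bar> \<le> C ^ card I + 1" for j t using pb[of j t] by linarith
    show "(\<lambda>j. \<integral>t. ?w j t * indicator A t \<partial>?P) \<longlonglongrightarrow> 0" if "A \<in> prod_algebra I (\<lambda>_. N)" for A
    proof -
      have "A \<in> sets ?P" using that by (auto simp: sets_PiM)
      from split[OF this] show ?thesis using tendsto_diff[OF main[OF that] tendsto_const[of "measure ?P A"]] by simp
    qed
    show "(\<lambda>j. \<integral>t. ?w j t \<partial>?P) \<longlonglongrightarrow> 0"
    proof -
      have top: "space ?P \<in> prod_algebra I (\<lambda>_. N)"
        using space_in_prod_algebra[of I "\<lambda>_. N"] by (simp add: space_PiM)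
      have "(\<integral>t. ?w j t \<partial>?P) = (\<integral>t. ?w j t * indicator (space ?P) t \<partial>?P)" for j
        by (intro Bochner_Integration.integral_cong) auto
      then show ?thesis
        using split[of "space ?P"] tendsto_diff[OF main[OF top] tendsto_const[of "measure ?P (space ?P)"]] by simp
    qed
    show "G \<in> sigma_sets (space ?P) (prod_algebra I (\<lambda>_. N))" using G by (simp add: sets_PiM space_PiM)
  qed auto
  then have "(\<lambda>j. (\<integral>t. ?w j t * indicator G t \<partial>?P) + measure ?P G) \<longlonglongrightarrow> 0 + measure ?P G"
    by (intro tendsto_intros)
  then show ?thesis unfolding split[OF G] by simp
qed

section \<open>Signs of weakly null kernels and an exponential moment bound\<close>

lemma exp_le_quadratic:
  fixes z :: real
  assumes "z \<le> 1"
  shows "exp z \<le> 1 + z + z\<^sup>2"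
proof (cases "z \<ge> 0")
  case True
  then show ?thesis using exp_bound[of z] assms by simp
next
  case False
  have "1 - z \<le> exp (- z)" using exp_ge_add_one_self[of "-z"] by simp
  then have "exp z \<le> 1 / (1 - z)"
    using False by (simp add: exp_minus field_simps)
  also have "\<dots> \<le> 1 + z + z\<^sup>2"
  proof -
    have "(1 + z + z\<^sup>2) * (1 - z) = 1 - z ^ 3"
      by (simp add: algebra_simps power2_eq_square power3_eq_cube)
    moreover have "z ^ 3 \<le> 0" using False by (simp add: power_less_zero_eq odd_pos)
    ultimately show ?thesis using False by (simp add: divide_simps)
  qed
  finally show ?thesis .
qed

text \<open>The signs of a weakly null sequence need not be weakly null, but halved differences
  of two suitably spaced signs are, and the sign with the larger index still captures
  a fixed part of the \<open>L\<^sup>1\<close> norm.\<close>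
lemma weakly_null_signs:
  fixes K :: "nat \<Rightarrow> real \<Rightarrow> real"
  assumes K[measurable]: "\<And>j. K j \<in> borel_measurable unit_leb"
    and B: "\<And>j x. \<bar>K j x\<bar> \<le> B"
    and weak: "\<And>g. g \<in> borel_measurable unit_leb \<Longrightarrow> (\<And>x. \<bar>g x\<bar> \<le> 1) \<Longrightarrow>
        (\<lambda>j. \<integral>t. K j t * g t \<partial>unit_leb) \<longlonglongrightarrow> 0"
    and A: "A > 0" and large: "\<And>j. (\<integral>t. \<bar>K j t\<bar> \<partial>unit_leb) \<ge> A"
  shows "\<exists>k s. (\<forall>l. s l \<in> borel_measurable unit_leb) \<and> (\<forall>l x. \<bar>s l x\<bar> \<le> 1) \<and>
    (\<forall>S\<in>sets unit_leb. (\<lambda>l. \<integral>x. s l x * indicator S x \<partial>unit_leb) \<longlonglongrightarrow> 0) \<and>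
    (\<forall>l::nat. (\<integral>t. K (k l) t * (1 + s l t) \<partial>unit_leb) \<ge> A / 4)"
proof -
  define e where "e j t = sgn (K j t)" for j t
  have e[measurable]: "e j \<in> borel_measurable unit_leb" for j unfolding e_def by simp
  have e1: "\<bar>e j t\<bar> \<le> 1" for j t by (simp add: e_def sgn_real_def)
  have B0: "B \<ge> 0" using B[of 0 0] by linarith
  have iK: "integrable unit_leb (K j)" for j by (rule integrable_bounded_unit_leb[OF K B])
  have iKe: "integrable unit_leb (\<lambda>t. K j t * e i t)" for i j
    using mult_mono[OF B e1 B0] by (intro integrable_bounded_unit_leb[of _ B]) (auto simp: abs_mult)
  have cutm[measurable]: "(\<lambda>x. indicator {..q::real} x :: real) \<in> borel_measurable unit_leb" for q
    by (intro measurable_restrict_space1 borel_measurable_indicator) simp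
  have ieq: "integrable unit_leb (\<lambda>t. e j t * indicator {..q::real} t)" for j q
    using e1 by (intro integrable_bounded_unit_leb[of _ 1]) (auto split: split_indicator)
  have bde: "\<bar>\<integral>t. e j t * indicator {..q} t \<partial>unit_leb\<bar> \<le> 1" for j q
  proof -
    have "\<bar>\<integral>t. e j t * indicator {..q} t \<partial>unit_leb\<bar> \<le> (\<integral>t. \<bar>e j t * indicator {..q} t\<bar> \<partial>unit_leb)"
      by (rule integral_abs_bound)
    also have "\<dots> \<le> (\<integral>t. 1 \<partial>unit_leb)"
      using e1 by (intro integral_mono integrable_abs ieq) (auto split: split_indicator)
    finally show ?thesis using unit.prob_space by simp
  qed
  \<comment> \<open>Along d the integrals of the signs over rational half-lines converge, though
    perhaps not to 0; in the difference of two signs with growing indices the limits cancel.\<close>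
  obtain d where d: "strict_mono d"
    and conv: "\<And>n. convergent (\<lambda>j. \<integral>t. e (d j) t * indicator {..real_of_rat (from_nat n)} t \<partial>unit_leb)"
    by (rule diagonal_convergent[of "\<lambda>j n. \<integral>t. e j t * indicator {..real_of_rat (from_nat n)} t \<partial>unit_leb" 1])
       (use bde in auto)
  \<comment> \<open>For fixed l a late kernel is almost orthogonal to 1 and to the earlier sign
    \<open>e (d l)\<close>. The tolerances leave A / 2 - A / 8 - A / 8 = A / 4 in the final
    estimate.\<close>
  have ex: "\<exists>m\<ge>l. \<bar>\<integral>t. K (d m) t * 1 \<partial>unit_leb\<bar> < A / 8 \<and> \<bar>\<integral>t. K (d m) t * e (d l) t \<partial>unit_leb\<bar> < A / 4" for l
  proof -
    have "eventually (\<lambda>m. \<bar>\<integral>t. K (d m) t * 1 \<partial>unit_leb\<bar> < A / 8) sequentially"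
      using tendstoD[OF LIMSEQ_subseq_LIMSEQ[OF weak[of "\<lambda>_. 1"] d], of "A / 8"] A
      by (simp add: dist_real_def comp_def)
    moreover have "eventually (\<lambda>m. \<bar>\<integral>t. K (d m) t * e (d l) t \<partial>unit_leb\<bar> < A / 4) sequentially"
      using tendstoD[OF LIMSEQ_subseq_LIMSEQ[OF weak[OF e[of "d l"] e1] d], of "A / 4"] A
      by (simp add: dist_real_def comp_def)
    ultimately have "eventually (\<lambda>m. m \<ge> l \<and> \<bar>\<integral>t. K (d m) t * 1 \<partial>unit_leb\<bar> < A / 8 \<and>
        \<bar>\<integral>t. K (d m) t * e (d l) t \<partial>unit_leb\<bar> < A / 4) sequentially"
      using eventually_ge_at_top[of l] by eventually_elim auto
    then show ?thesis by (rule eventually_happens'[OF sequentially_bot])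
  qed
  define m where "m l = (SOME m. m \<ge> l \<and> \<bar>\<integral>t. K (d m) t * 1 \<partial>unit_leb\<bar> < A / 8 \<and>
      \<bar>\<integral>t. K (d m) t * e (d l) t \<partial>unit_leb\<bar> < A / 4)" for l
  have m: "m l \<ge> l" "\<bar>\<integral>t. K (d (m l)) t \<partial>unit_leb\<bar> < A / 8"
    "\<bar>\<integral>t. K (d (m l)) t * e (d l) t \<partial>unit_leb\<bar> < A / 4" for l
  proof -
    have "m l \<ge> l \<and> \<bar>\<integral>t. K (d (m l)) t * 1 \<partial>unit_leb\<bar> < A / 8 \<and>
        \<bar>\<integral>t. K (d (m l)) t * e (d l) t \<partial>unit_leb\<bar> < A / 4"
      unfolding m_def by (rule someI_ex[OF ex])
    then show "m l \<ge> l" "\<bar>\<integral>t. K (d (m l)) t \<partial>unit_leb\<bar> < A / 8"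
      "\<bar>\<integral>t. K (d (m l)) t * e (d l) t \<partial>unit_leb\<bar> < A / 4" by simp_all
  qed
  have mtop: "filterlim m at_top sequentially"
    using m(1) by (intro filterlim_at_top_mono[OF filterlim_ident]) auto
  define s where "s l t = (e (d (m l)) t - e (d l) t) / 2" for l t
  have s[measurable]: "s l \<in> borel_measurable unit_leb" for l unfolding s_def by simp
  have s1: "\<bar>s l t\<bar> \<le> 1" for l t
    using e1[of "d (m l)" t] e1[of "d l" t] unfolding s_def by (auto simp: abs_le_iff field_simps)
  have lim: "(\<lambda>l. \<integral>x. s l x * indicator S x \<partial>unit_leb) \<longlonglongrightarrow> 0" if S: "S \<in> sets unit_leb" for S
  proof (rule weak_null_unit_leb[OF s s1 _ S])
    fix q :: real assume "q \<in> \<rat>"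
    then obtain n where q: "q = real_of_rat (from_nat n)" by (metis Rats_cases from_nat_to_nat)
    define f where "f j = (\<integral>t. e (d j) t * indicator {..q} t \<partial>unit_leb)" for j
    from conv[of n] obtain L where L: "f \<longlonglongrightarrow> L" unfolding convergent_def f_def q by blast
    have "(\<integral>x. s l x * indicator {..q} x \<partial>unit_leb) = (f (m l) - f l) / 2" for l
    proof -
      have "(\<integral>x. s l x * indicator {..q} x \<partial>unit_leb) =
         (\<integral>x. (e (d (m l)) x * indicator {..q} x - e (d l) x * indicator {..q} x) / 2 \<partial>unit_leb)"
        by (simp add: s_def algebra_simps diff_divide_distrib)
      also have "\<dots> = (f (m l) - f l) / 2" unfolding f_def
        using ieq by simp
      finally show ?thesis .
    qed
    moreover have "(\<lambda>l. (f (m l) - f l) / 2) \<longlonglongrightarrow> (L - L) / 2"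
      by (intro tendsto_intros L filterlim_compose[OF L mtop]) simp
    ultimately show "(\<lambda>l. \<integral>x. s l x * indicator {..q} x \<partial>unit_leb) \<longlonglongrightarrow> 0"
      by (simp only: diff_self div_0)
  qed
  have ge: "(\<integral>t. K (d (m l)) t * (1 + s l t) \<partial>unit_leb) \<ge> A / 4" for l
  proof -
    let ?K = "K (d (m l))"
    have "?K t * (1 + s l t) = ?K t + (\<bar>?K t\<bar> - ?K t * e (d l) t) / 2" for t
      by (simp add: s_def e_def abs_sgn algebra_simps)
    then have "(\<integral>t. ?K t * (1 + s l t) \<partial>unit_leb) =
       (\<integral>t. ?K t \<partial>unit_leb) + ((\<integral>t. \<bar>?K t\<bar> \<partial>unit_leb) - (\<integral>t. ?K t * e (d l) t \<partial>unit_leb)) / 2"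
      using iK iKe by simp
    moreover have "A / 4 \<le> I" if "I = X + (Y - Z) / 2" "\<bar>X\<bar> < A / 8" "\<bar>Z\<bar> < A / 4" "A \<le> Y" for I X Y Z :: real
      using that by (simp add: abs_less_iff field_simps)
    ultimately show ?thesis using m(2)[of l] m(3)[of l] large[of "d (m l)"] by blast
  qed
  show ?thesis
    using s s1 lim ge by (intro exI[of _ "\<lambda>l. d (m l)"] exI[of _ s]) simp
qed

text \<open>This is a Chernoff bound after a change of measure. Under the product of the densities
  \<open>1 + s l\<close> the kernel \<open>K (k l)\<close> has mean at least A / 4, so it is
  exponentially unlikely that its sum over the n points stays below n A / 8. The event that all
  kernels have small sums lies in each of these events and does not change with l, whereas the
  densities tend weakly to 1; so the bound for large l passes to the measure of that event under
  independent uniform points.\<close>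

lemma random_points_kernel_large:
  fixes K :: "nat \<Rightarrow> real \<Rightarrow> real" and n :: nat
  assumes K[measurable]: "\<And>j. K j \<in> borel_measurable unit_leb"
    and B: "\<And>j x. \<bar>K j x\<bar> \<le> B"
    and weak: "\<And>g. g \<in> borel_measurable unit_leb \<Longrightarrow> (\<And>x. \<bar>g x\<bar> \<le> 1) \<Longrightarrow>
        (\<lambda>j. \<integral>t. K j t * g t \<partial>unit_leb) \<longlonglongrightarrow> 0"
    and A: "A > 0" and large: "\<And>j. (\<integral>t. \<bar>K j t\<bar> \<partial>unit_leb) \<ge> A"
  defines "P \<equiv> Pi\<^sub>M {..<n} (\<lambda>_::nat. unit_leb)"
  shows "measure P {t \<in> space P. \<forall>j. (\<Sum>i<n. K j (t i)) \<le> real n * (A / 8)} \<le> (1 - A\<^sup>2 / (4096 * B\<^sup>2)) ^ n"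
proof -
  interpret P: finite_product_prob_space "\<lambda>_. unit_leb" "{..<n}"
    by unfold_locales (rule finite_lessThan)
  have "\<exists>k s. (\<forall>l. s l \<in> borel_measurable unit_leb) \<and> (\<forall>l x. \<bar>s l x\<bar> \<le> 1) \<and>
    (\<forall>S\<in>sets unit_leb. (\<lambda>l. \<integral>x. s l x * indicator S x \<partial>unit_leb) \<longlonglongrightarrow> 0) \<and>
    (\<forall>l::nat. (\<integral>t. K (k l) t * (1 + s l t) \<partial>unit_leb) \<ge> A / 4)"
    by (rule weakly_null_signs[OF K B weak A large])
  then obtain k :: "nat \<Rightarrow> nat" and s where "(\<forall>l. s l \<in> borel_measurable unit_leb) \<and> (\<forall>l x. \<bar>s l x\<bar> \<le> 1) \<and>
    (\<forall>S\<in>sets unit_leb. (\<lambda>l. \<integral>x. s l x * indicator S x \<partial>unit_leb) \<longlonglongrightarrow> 0) \<and>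
    (\<forall>l::nat. (\<integral>t. K (k l) t * (1 + s l t) \<partial>unit_leb) \<ge> A / 4)"
    by (elim exE)
  then have s[measurable]: "\<And>l. s l \<in> borel_measurable unit_leb" and s1: "\<And>l x. \<bar>s l x\<bar> \<le> 1"
    and slim: "\<And>S. S \<in> sets unit_leb \<Longrightarrow> (\<lambda>l. \<integral>x. s l x * indicator S x \<partial>unit_leb) \<longlonglongrightarrow> 0"
    and Ks: "\<And>l. (\<integral>t. K (k l) t * (1 + s l t) \<partial>unit_leb) \<ge> A / 4"
    by blast+
  define \<rho> where "\<rho> l t = 1 + s l t" for l t
  have \<rho>m[measurable]: "\<rho> l \<in> borel_measurable unit_leb" for l unfolding \<rho>_def by simp
  have \<rho>0: "\<rho> l t \<ge> 0" "\<rho> l t \<le> 2" for l t using s1[of l t] unfolding \<rho>_def by (auto simp: abs_le_iff)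
  have iK: "integrable unit_leb (K j)" for j by (rule integrable_bounded_unit_leb[OF K B])
  have isn: "integrable unit_leb (s l)" for l by (rule integrable_bounded_unit_leb[OF s s1])
  have "A \<le> (\<integral>t. \<bar>K 0 t\<bar> \<partial>unit_leb)" by (rule large)
  also have "\<dots> \<le> (\<integral>t. B \<partial>unit_leb)" using iK B by (intro integral_mono) auto
  finally have AB: "A \<le> B" using unit.prob_space by simp
  define a where "a = A / 8"
  \<comment> \<open>This choice gives \<open>(\<mu> * (2 * B))\<^sup>2 = \<mu> * a / 4\<close>, so
    the quadratic term of the exponential costs only a fraction of the linear gain
    \<open>\<mu> * a\<close>.\<close>
  define \<mu> where "\<mu> = a / (16 * B\<^sup>2)"
  define G where "G = {t \<in> space P. \<forall>j. (\<Sum>i<n. K j (t i)) \<le> real n * a}"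
  have a: "0 < a" "8 * a \<le> B" using A AB by (auto simp: a_def)
  have \<mu>0: "\<mu> > 0" unfolding \<mu>_def using A AB a by simp
  have q: "1 - A\<^sup>2 / (4096 * B\<^sup>2) = 1 - \<mu> * a / 4"
    by (simp add: \<mu>_def a_def power2_eq_square)
  have G[measurable]: "G \<in> sets P" unfolding G_def P_def by measurable
  define h where "h l t = \<rho> l t * exp (- \<mu> * (K (k l) t - a))" for l t
  have hm[measurable]: "h l \<in> borel_measurable unit_leb" for l unfolding h_def by simp
  have h0: "h l t \<ge> 0" for l t unfolding h_def using \<rho>0 by simp
  have arg: "\<bar>\<mu> * (K j t - a)\<bar> \<le> \<mu> * (2 * B)" for j t
    using B[of j t] a \<mu>0 by (auto simp: abs_mult intro!: mult_left_mono)
  have \<mu>B: "\<mu> * (2 * B) \<le> 1" using a by (simp add: \<mu>_def power2_eq_square field_simps)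
  \<comment> \<open>The quadratic error \<open>\<mu> * a / 4\<close> is multiplied by a density of
    at most 2; this is the last summand.\<close>
  have hq: "h l t \<le> (1 + \<mu> * a) * (1 + s l t) - \<mu> * (K (k l) t * (1 + s l t)) + \<mu> * a / 2" for l t
  proof -
    let ?y = "\<mu> * (K (k l) t - a)"
    have "exp (- ?y) \<le> 1 + (- ?y) + (- ?y)\<^sup>2"
      using arg[of "k l" t] \<mu>B by (intro exp_le_quadratic) linarith
    moreover have "(- ?y)\<^sup>2 \<le> (\<mu> * (2 * B))\<^sup>2" using arg[of "k l" t] by (intro abs_le_square_iff[THEN iffD1]) auto
    moreover have "(\<mu> * (2 * B))\<^sup>2 = \<mu> * a / 4"
      using a by (simp add: \<mu>_def power2_eq_square field_simps)
    ultimately have "exp (- ?y) \<le> 1 - ?y + \<mu> * a / 4" by linarith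
    then have "h l t \<le> \<rho> l t * (1 - ?y + \<mu> * a / 4)"
      unfolding h_def using \<rho>0[of l t] by (intro mult_left_mono) auto
    also have "\<dots> = \<rho> l t * (1 - ?y) + \<rho> l t * (\<mu> * a / 4)" by (simp add: algebra_simps)
    also have "\<dots> \<le> \<rho> l t * (1 - ?y) + 2 * (\<mu> * a / 4)"
      using \<rho>0[of l t] \<mu>0 a by (intro add_left_mono mult_right_mono) auto
    finally show ?thesis by (simp add: \<rho>_def algebra_simps)
  qed
  have hb: "\<bar>h l t\<bar> \<le> 2 * exp 1" for l t
  proof -
    have "- \<mu> * (K (k l) t - a) \<le> 1" using arg[of "k l" t] \<mu>B by linarith
    then show ?thesis unfolding h_def using \<rho>0[of l t] by (simp add: abs_mult) (intro mult_mono, auto)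
  qed
  have ih: "integrable unit_leb (h l)" for l by (rule integrable_bounded_unit_leb[OF hm hb])
  have iKs: "integrable unit_leb (\<lambda>t. K (k l) t * (1 + s l t))" for l
  proof (rule integrable_bounded_unit_leb[of _ "B * 2"])
    show "\<bar>K (k l) x * (1 + s l x)\<bar> \<le> B * 2" for x
      unfolding abs_mult using \<rho>0[of l x] B[of "k l" x] by (intro mult_mono) (auto simp: \<rho>_def)
  qed simp
  have int_h: "(\<integral>t. h l t \<partial>unit_leb) \<le> 1 + 2 * \<bar>\<integral>t. s l t \<partial>unit_leb\<bar> - \<mu> * a / 2" for l
  proof -
    have "(\<integral>t. h l t \<partial>unit_leb) \<le> (\<integral>t. (1 + \<mu> * a) * (1 + s l t) - \<mu> * (K (k l) t * (1 + s l t)) + \<mu> * a / 2 \<partial>unit_leb)"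
      using isn ih iKs by (intro integral_mono hq) auto
    also have "\<dots> = (1 + \<mu> * a) * (1 + (\<integral>t. s l t \<partial>unit_leb)) - \<mu> * (\<integral>t. K (k l) t * (1 + s l t) \<partial>unit_leb) + \<mu> * a / 2"
      using isn iKs unit.prob_space by simp
    also have "\<dots> \<le> (1 + \<mu> * a) * (1 + (\<integral>t. s l t \<partial>unit_leb)) - \<mu> * (2 * a) + \<mu> * a / 2"
      using Ks[of l] \<mu>0 by (intro add_right_mono diff_left_mono mult_left_mono) (auto simp: a_def)
    also have "(1 + \<mu> * a) * (1 + (\<integral>t. s l t \<partial>unit_leb)) \<le> (1 + \<mu> * a) + 2 * \<bar>\<integral>t. s l t \<partial>unit_leb\<bar>"
    proof -
      have "\<mu> * a \<le> 1" using mult_left_mono[of a "2 * B" \<mu>] \<mu>0 \<mu>B a by linarith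
      then have "(1 + \<mu> * a) * (\<integral>t. s l t \<partial>unit_leb) \<le> 2 * \<bar>\<integral>t. s l t \<partial>unit_leb\<bar>"
        using \<mu>0 a by (intro order_trans[OF mult_left_mono[OF abs_ge_self] mult_right_mono]) auto
      then show ?thesis by (simp add: distrib_left)
    qed
    finally show ?thesis by (simp add: algebra_simps)
  qed
  \<comment> \<open>Exponential Markov inequality: on G the sum of \<open>K (k l)\<close> is at most
    n a, so the exponential factor is at least 1, and the integral of the product
    factorises.\<close>
  have bound: "(\<integral>t. (\<Prod>i<n. \<rho> l (t i)) * indicator G t \<partial>P) \<le> (\<integral>t. h l t \<partial>unit_leb) ^ n" for l
  proof -
    have "(\<integral>t. (\<Prod>i<n. \<rho> l (t i)) * indicator G t \<partial>P) \<le> (\<integral>t. (\<Prod>i<n. h l (t i)) \<partial>P)"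
    proof (rule integral_mono_AE)
      have pb: "\<bar>\<Prod>i<n. \<rho> l (t i)\<bar> \<le> 2 ^ n" for t
        using prod_mono[of "{..<n}" "\<lambda>i. \<rho> l (t i)" "\<lambda>_. 2"] \<rho>0 by (simp add: abs_prod)
      show "integrable P (\<lambda>t. (\<Prod>i<n. \<rho> l (t i)) * indicator G t)"
        using G pb unfolding P_def by (intro P.integrable_const_bound[of _ "2 ^ n"])
          (auto split: split_indicator)
      show "integrable P (\<lambda>t. \<Prod>i<n. h l (t i))"
        unfolding P_def by (intro P.product_integrable_prod ih) auto
      show "AE t in P. (\<Prod>i<n. \<rho> l (t i)) * indicator G t \<le> (\<Prod>i<n. h l (t i))"
      proof (rule AE_I2)
        fix t assume "t \<in> space P"
        show "(\<Prod>i<n. \<rho> l (t i)) * indicator G t \<le> (\<Prod>i<n. h l (t i))"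
        proof (cases "t \<in> G")
          case True
          have "(\<Prod>i<n. h l (t i)) = (\<Prod>i<n. \<rho> l (t i)) * exp (\<Sum>i<n. - \<mu> * (K (k l) (t i) - a))"
            by (simp add: h_def prod.distrib exp_sum)
          also have "(\<Sum>i<n. - \<mu> * (K (k l) (t i) - a)) = \<mu> * (real n * a - (\<Sum>i<n. K (k l) (t i)))"
            by (simp add: sum_distrib_left[symmetric] sum_negf sum_subtractf algebra_simps)
          finally have eq: "(\<Prod>i<n. h l (t i)) = (\<Prod>i<n. \<rho> l (t i)) * exp (\<mu> * (real n * a - (\<Sum>i<n. K (k l) (t i))))" .
          have "1 \<le> exp (\<mu> * (real n * a - (\<Sum>i<n. K (k l) (t i))))"
            using True \<mu>0 by (auto simp: G_def)
          then have "(\<Prod>i<n. \<rho> l (t i)) * 1 \<le> (\<Prod>i<n. h l (t i))"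
            unfolding eq using \<rho>0 by (intro mult_left_mono prod_nonneg) auto
          then show ?thesis using True by simp
        next
          case False
          then show ?thesis using h0 by (auto intro: prod_nonneg)
        qed
      qed
    qed
    also have "\<dots> = (\<integral>t. h l t \<partial>unit_leb) ^ n"
      unfolding P_def by (subst P.product_integral_prod) (auto intro: ih)
    finally show ?thesis .
  qed
  have slim': "(\<lambda>l. \<integral>x. s l x \<partial>unit_leb) \<longlonglongrightarrow> 0"
  proof -
    have "(\<integral>x. s l x \<partial>unit_leb) = (\<integral>x. s l x * indicator (space unit_leb) x \<partial>unit_leb)" for l
      by (intro Bochner_Integration.integral_cong) auto
    then show ?thesis using slim[of "space unit_leb"] by (simp only: sets.top)
  qed
  \<comment> \<open>The integral of \<open>h l\<close> is at most \<open>1 - \<mu> * a / 2\<close>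
    up to twice the integral of \<open>s l\<close>; that error tends to 0 and eventually uses up
    less than half of the gain.\<close>
  have ev: "eventually (\<lambda>l. (\<integral>t. (\<Prod>i<n. \<rho> l (t i)) * indicator G t \<partial>P) \<le> (1 - \<mu> * a / 4) ^ n) sequentially"
  proof -
    have "eventually (\<lambda>l. \<bar>\<integral>t. s l t \<partial>unit_leb\<bar> < \<mu> * a / 8) sequentially"
      using tendstoD[OF slim', of "\<mu> * a / 8"] \<mu>0 a by (simp add: dist_real_def)
    then show ?thesis
    proof eventually_elim
      case (elim l)
      have "(\<integral>t. h l t \<partial>unit_leb) \<le> 1 - \<mu> * a / 4" using int_h[of l] elim by linarith
      then show ?case using bound[of l] power_mono[of "\<integral>t. h l t \<partial>unit_leb" "1 - \<mu> * a / 4" n] h0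
        by (meson Bochner_Integration.integral_nonneg order_trans)
    qed
  qed
  have "(\<lambda>l. \<integral>t. (\<Prod>i<n. \<rho> l (t i)) * indicator G t \<partial>P) \<longlonglongrightarrow> measure P G"
    unfolding P_def
  proof (rule weak_tensor_limit[OF prob_space_unit_leb \<rho>m])
    show "\<bar>\<rho> j x\<bar> \<le> 2" for j x using \<rho>0[of j x] by simp
    show "G \<in> sets (Pi\<^sub>M {..<n} (\<lambda>_. unit_leb))" using G unfolding P_def .
    fix S assume S: "S \<in> sets unit_leb"
    have Sf: "emeasure unit_leb S < \<infinity>" by (simp add: unit.emeasure_eq_measure)
    have "(\<integral>x. \<rho> j x * indicator S x \<partial>unit_leb) = measure unit_leb S + (\<integral>x. s j x * indicator S x \<partial>unit_leb)" for j
    proof -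
      have "integrable unit_leb (\<lambda>x. s j x * indicator S x)"
        using S s1 by (intro integrable_bounded_unit_leb[of _ 1]) (auto split: split_indicator)
      moreover have "integrable unit_leb (indicator S :: real \<Rightarrow> real)" using S Sf by (rule integrable_real_indicator)
      moreover have "(\<integral>x. indicator S x \<partial>unit_leb) = measure unit_leb S"
        using sets.sets_into_space[OF S] by (simp add: Int_absorb2)
      ultimately show ?thesis by (simp add: \<rho>_def distrib_right)
    qed
    then show "(\<lambda>j. \<integral>x. \<rho> j x * indicator S x \<partial>unit_leb) \<longlonglongrightarrow> measure unit_leb S"
      using tendsto_add[OF tendsto_const[of "measure unit_leb S"] slim[OF S]] by simp
  qed simp
  from tendsto_upperbound[OF this ev] have "measure P G \<le> (1 - \<mu> * a / 4) ^ n" by simp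
  then show ?thesis unfolding q G_def a_def .
qed

subsection \<open>Sums of kernels at random points\<close>

text \<open>The measure of \<open>U \<inter> {..a}\<close> is a Lipschitz function of a with
  constant 1, so the intermediate value theorem applies.\<close>

lemma exists_subset_of_measure:
  assumes U: "U \<in> sets unit_leb" and s: "0 \<le> s" "s \<le> measure unit_leb U"
  obtains V where "V \<in> sets unit_leb" "V \<subseteq> U" "measure unit_leb V = s"
proof -
  define F where "F a = measure unit_leb (U \<inter> {..a})" for a
  have cut: "U \<inter> {..a} \<in> sets unit_leb" for a
  proof -
    have "{0..1} \<inter> {..a} \<in> sets unit_leb" by (auto simp: sets_restrict_space)
    with U have "U \<inter> ({0..1} \<inter> {..a}) \<in> sets unit_leb" by (rule sets.Int)
    moreover have "U \<inter> {..a} = U \<inter> ({0..1} \<inter> {..a})" using sets.sets_into_space[OF U] by auto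
    ultimately show ?thesis by simp
  qed
  have lip: "F b - F a \<le> b - a" and mono: "F a \<le> F b" if "0 \<le> a" "a \<le> b" "b \<le> 1" for a b
  proof -
    have ab: "{a<..b} \<in> sets unit_leb" using that by (auto simp: sets_restrict_space)
    have "F b \<le> measure unit_leb ((U \<inter> {..a}) \<union> {a<..b})"
      unfolding F_def using cut[of a] ab by (intro unit.finite_measure_mono) auto
    also have "\<dots> \<le> F a + measure unit_leb {a<..b}"
      unfolding F_def using cut[of a] ab by (intro measure_Un_le)
    also have "measure unit_leb {a<..b} = b - a"
      using that by (subst measure_restrict_space) auto
    finally show "F b - F a \<le> b - a" by simp
    show "F a \<le> F b" unfolding F_def using that cut by (intro unit.finite_measure_mono) auto
  qed
  have "\<bar>F x - F y\<bar> \<le> \<bar>x - y\<bar>" if "x \<in> {0..1}" "y \<in> {0..1}" for x y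
    using lip[of x y] lip[of y x] mono[of x y] mono[of y x] that by (cases "x \<le> y") auto
  then have cont: "continuous_on {0..1} F"
    unfolding continuous_on_iff dist_real_def by (metis order.strict_trans1)
  have "F 0 = 0"
  proof -
    have "F 0 \<le> measure unit_leb {0}"
      unfolding F_def using sets.sets_into_space[OF U]
      by (intro unit.finite_measure_mono) (auto simp: sets_restrict_space)
    also have "\<dots> = 0" by (subst measure_restrict_space) auto
    finally show ?thesis using measure_nonneg[of unit_leb "U \<inter> {..0}"] unfolding F_def by linarith
  qed
  moreover have "F 1 = measure unit_leb U"
    unfolding F_def using sets.sets_into_space[OF U] by (auto intro!: arg_cong[where f="measure unit_leb"])
  ultimately obtain a where "F a = s"
    using IVT'[of F 0 s 1] s cont by auto
  then show ?thesis using that[OF cut[of a]] unfolding F_def by auto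
qed

text \<open>There are only countably many cells, so the null cells together form a null set. Thus a
  random point almost surely lies in a cell with room for small sets.\<close>

lemma AE_cell_positive:
  fixes c :: "real \<Rightarrow> 'b::countable"
  assumes "\<And>v. {t \<in> space unit_leb. c t = v} \<in> sets unit_leb"
  shows "AE t in unit_leb. measure unit_leb {s \<in> space unit_leb. c s = c t} > 0"
proof -
  have "AE t in unit_leb. \<forall>v. measure unit_leb {s \<in> space unit_leb. c s = v} = 0 \<longrightarrow> c t \<noteq> v"
  proof (subst AE_all_countable, rule allI)
    fix v
    show "AE t in unit_leb. measure unit_leb {s \<in> space unit_leb. c s = v} = 0 \<longrightarrow> c t \<noteq> v"
    proof (cases "measure unit_leb {s \<in> space unit_leb. c s = v} = 0")
      case True
      then have "{s \<in> space unit_leb. c s = v} \<in> null_sets unit_leb"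
        using assms[of v] by (auto simp: null_sets_def unit.emeasure_eq_measure)
      then show ?thesis by (rule AE_I') auto
    qed simp
  qed
  then show ?thesis
    by eventually_elim (metis measure_nonneg order_le_less)
qed

context bounded_ons
begin

text \<open>Integrating f against this kernel gives the difference of the partial sums of f at x
  with p + i and with p terms.\<close>

definition block_kernel :: "nat \<Rightarrow> nat \<Rightarrow> real \<Rightarrow> real \<Rightarrow> real" where
  "block_kernel p i x t = (\<Sum>l<i. \<phi> (p + l) x * \<phi> (p + l) t)"

lemma block_kernel_bound: "\<bar>block_kernel p i x t\<bar> \<le> real i * M\<^sup>2"
  unfolding block_kernel_def
  using sum_norm_bound[of "{..<i}" "\<lambda>l. \<phi> (p + l) x * \<phi> (p + l) t" "M\<^sup>2"] bound_mult by auto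

lemma block_kernel_measurable[measurable]: "block_kernel p i x \<in> borel_measurable unit_leb"
  unfolding block_kernel_def by simp

text \<open>The lengths \<open>i j\<close> stay below N, so at most N coefficients of g enter, and
  all their indices tend to infinity with \<open>p j\<close>.\<close>

lemma block_kernels_weakly_null:
  assumes p: "filterlim p at_top sequentially" and i: "\<And>j. i j \<le> N"
    and g[measurable]: "g \<in> borel_measurable unit_leb" and g1: "\<And>x. \<bar>g x\<bar> \<le> 1"
  shows "(\<lambda>j. \<integral>t. block_kernel (p j) (i j) x t * g t \<partial>unit_leb) \<longlonglongrightarrow> 0"
proof (rule Lim_null_comparison)
  define c where "c n = (\<integral>t. g t * \<phi> n t \<partial>unit_leb)" for n
  have ig: "integrable unit_leb (\<lambda>t. g t * \<phi> n t)" for n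
    using mult_mono[OF g1 bound] by (intro integrable_bounded_unit_leb[of _ M]) (auto simp: abs_mult)
  have "(\<lambda>j. \<Sum>l<N. M * \<bar>c (p j + l)\<bar>) \<longlonglongrightarrow> (\<Sum>l<N. M * \<bar>0\<bar>)"
    unfolding c_def
    by (intro tendsto_intros filterlim_compose[OF coeff_tendsto_0[OF g g1]] filterlim_at_top_mono[OF p]) auto
  then show "(\<lambda>j. \<Sum>l<N. M * \<bar>c (p j + l)\<bar>) \<longlonglongrightarrow> 0" by simp
  show "\<forall>\<^sub>F j in sequentially. norm (\<integral>t. block_kernel (p j) (i j) x t * g t \<partial>unit_leb) \<le> (\<Sum>l<N. M * \<bar>c (p j + l)\<bar>)"
  proof (rule always_eventually, rule allI)
    fix j
    have "(\<integral>t. block_kernel (p j) (i j) x t * g t \<partial>unit_leb) = (\<integral>t. (\<Sum>l<i j. \<phi> (p j + l) x * (g t * \<phi> (p j + l) t)) \<partial>unit_leb)"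
      unfolding block_kernel_def sum_distrib_right
      by (intro Bochner_Integration.integral_cong sum.cong) (simp_all add: mult_ac)
    also have "\<dots> = (\<Sum>l<i j. \<phi> (p j + l) x * c (p j + l))"
      using ig by (simp add: c_def)
    finally have "norm (\<integral>t. block_kernel (p j) (i j) x t * g t \<partial>unit_leb) \<le> (\<Sum>l<i j. \<bar>\<phi> (p j + l) x * c (p j + l)\<bar>)"
      by (simp only: real_norm_def sum_abs)
    also have "\<dots> \<le> (\<Sum>l<i j. M * \<bar>c (p j + l)\<bar>)"
      unfolding abs_mult by (intro sum_mono mult_right_mono bound) auto
    also have "\<dots> \<le> (\<Sum>l<N. M * \<bar>c (p j + l)\<bar>)"
      using i[of j] M_pos by (intro sum_mono2) auto
    finally show "norm (\<integral>t. block_kernel (p j) (i j) x t * g t \<partial>unit_leb) \<le> (\<Sum>l<N. M * \<bar>c (p j + l)\<bar>)" .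
  qed
qed

text \<open>The starts p with x in \<open>block_set R p\<close> are infinitely many; enumerated,
  they give a weakly null sequence of large kernels. This sequence depends on x, but the resulting
  probability bound does not.\<close>

lemma random_points_block_kernel:
  fixes n :: nat
  assumes R: "R \<ge> 1" and A: "A > 0" "harm R / (128 * M\<^sup>2) \<ge> A" and B: "B \<ge> real (3 * R) * M\<^sup>2"
    and x: "x \<in> (\<Inter>n. \<Union>p\<in>{n..}. block_set R p)"
  defines "P \<equiv> Pi\<^sub>M {..<n} (\<lambda>_::nat. unit_leb)"
  shows "measure P {t \<in> space P. \<forall>p. \<forall>i\<le>3*R. (\<Sum>k<n. block_kernel p i x (t k)) \<le> real n * (A / 8)}
    \<le> (1 - A\<^sup>2 / (4096 * B\<^sup>2)) ^ n"
proof -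
  interpret P: finite_product_prob_space "\<lambda>_. unit_leb" "{..<n}"
    by unfold_locales (rule finite_lessThan)
  define S where "S = {p. x \<in> block_set R p}"
  have "infinite S" unfolding infinite_nat_iff_unbounded_le S_def using x by auto
  then have p: "strict_mono (enumerate S)" "enumerate S j \<in> S" for j
    by (auto simp: strict_mono_enumerate enumerate_in_set)
  have "\<exists>i\<le>3*R. (\<integral>t. \<bar>block_kernel (enumerate S j) i x t\<bar> \<partial>unit_leb) \<ge> harm R / (128 * M\<^sup>2)" for j
    unfolding block_kernel_def using p(2)[of j]
    by (intro block_kernel_large R) (auto simp: S_def block_set_def)
  then obtain i where i: "\<And>j. i j \<le> 3 * R"
    "\<And>j. (\<integral>t. \<bar>block_kernel (enumerate S j) (i j) x t\<bar> \<partial>unit_leb) \<ge> harm R / (128 * M\<^sup>2)"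
    by metis
  let ?K = "\<lambda>j. block_kernel (enumerate S j) (i j) x"
  have "measure P {t \<in> space P. \<forall>j. (\<Sum>k<n. ?K j (t k)) \<le> real n * (A / 8)} \<le> (1 - A\<^sup>2 / (4096 * B\<^sup>2)) ^ n"
    unfolding P_def
  proof (rule random_points_kernel_large[OF _ _ _ A(1)])
    show "\<bar>?K j t\<bar> \<le> B" for j t
    proof -
      have "\<bar>?K j t\<bar> \<le> real (i j) * M\<^sup>2" by (rule block_kernel_bound)
      also have "\<dots> \<le> real (3 * R) * M\<^sup>2" using i(1)[of j] by (intro mult_right_mono) auto
      finally show ?thesis using B by simp
    qed
    show "(\<lambda>j. \<integral>t. ?K j t * g t \<partial>unit_leb) \<longlonglongrightarrow> 0"
      if "g \<in> borel_measurable unit_leb" "\<And>x. \<bar>g x\<bar> \<le> 1" for g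
      by (rule block_kernels_weakly_null[OF filterlim_subseq[OF p(1)] i(1) that])
    show "A \<le> (\<integral>t. \<bar>?K j t\<bar> \<partial>unit_leb)" for j using i(2)[of j] A(2) by linarith
  qed simp
  moreover have "measure P {t \<in> space P. \<forall>p. \<forall>i\<le>3*R. (\<Sum>k<n. block_kernel p i x (t k)) \<le> real n * (A / 8)}
     \<le> measure P {t \<in> space P. \<forall>j. (\<Sum>k<n. ?K j (t k)) \<le> real n * (A / 8)}"
    unfolding P_def
  proof (rule P.finite_measure_mono)
    show "{t \<in> space (Pi\<^sub>M {..<n} (\<lambda>_. unit_leb)). \<forall>j. (\<Sum>k<n. ?K j (t k)) \<le> real n * (A / 8)}
      \<in> sets (Pi\<^sub>M {..<n} (\<lambda>_. unit_leb))" by measurable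
  qed (use i(1) in auto)
  ultimately show ?thesis by linarith
qed

text \<open>For every x in infinitely many block sets, a set of measure at least
  \<open>1 / (2 * M\<^sup>2)\<close>, the points succeed with probability at least 1 / 2; Fubini
  then gives \<open>1 / (4 * M\<^sup>2)\<close> for the pairs (x, t). The property Q is quantified
  after n and N because it will say that the points lie in cells of positive measure, and those
  cells depend on N.\<close>

lemma points_with_large_kernel_sums:
  assumes A: "A > 0"
  obtains n N :: nat where "n \<ge> 1"
    "\<And>Q. AE t in Pi\<^sub>M {..<n} (\<lambda>_::nat. unit_leb). Q t \<Longrightarrow>
       \<exists>t \<in> space (Pi\<^sub>M {..<n} (\<lambda>_::nat. unit_leb)). Q t \<and>
        measure unit_leb {x \<in> space unit_leb. \<exists>p i. p + i \<le> N \<and> (\<Sum>k<n. block_kernel p i x (t k)) > real n * A} \<ge> 1 / (8 * M\<^sup>2)"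
proof -
  define A0 where "A0 = 8 * A"
  have A0: "A0 > 0" "A0 / 8 = A" using A by (auto simp: A0_def)
  have "eventually (\<lambda>R. harm R \<ge> A0 * (128 * M\<^sup>2)) sequentially"
    using harm_at_top by (simp add: filterlim_at_top)
  then have "eventually (\<lambda>R. R \<ge> 1 \<and> harm R \<ge> A0 * (128 * M\<^sup>2)) sequentially"
    using eventually_ge_at_top[of "1::nat"] by eventually_elim auto
  then obtain R where "R \<ge> 1 \<and> harm R \<ge> A0 * (128 * M\<^sup>2)"
    using eventually_happens'[OF sequentially_bot] by blast
  then have R: "R \<ge> 1" and hR: "harm R / (128 * M\<^sup>2) \<ge> A0"
    using M_pos by (auto simp: field_simps)
  \<comment> \<open>The summand A0 guarantees B \<ge> A0, which puts q into [0, 1).\<close>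
  define B where "B = real (3 * R) * M\<^sup>2 + A0"
  have B: "B \<ge> real (3 * R) * M\<^sup>2" "B \<ge> A0" "B > 0"
    using A0 M_pos by (auto simp: B_def intro!: add_nonneg_pos)
  define q where "q = 1 - A0\<^sup>2 / (4096 * B\<^sup>2)"
  have "A0\<^sup>2 \<le> B\<^sup>2" using A0 B by (intro power_mono) auto
  moreover have "B\<^sup>2 > 0" using B by simp
  ultimately have "A0\<^sup>2 \<le> 4096 * B\<^sup>2" "B\<^sup>2 > 0" by linarith+
  then have "A0\<^sup>2 / (4096 * B\<^sup>2) \<le> 1" by (simp add: divide_le_eq)
  moreover have "A0\<^sup>2 / (4096 * B\<^sup>2) > 0" using A0 B by simp
  ultimately have q: "0 \<le> q" "q < 1" by (auto simp: q_def)
  have "(\<lambda>n. q ^ n) \<longlonglongrightarrow> 0" using q by (intro LIMSEQ_realpow_zero) auto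
  then have "eventually (\<lambda>n. q ^ n < 1 / 2) sequentially" by (rule order_tendstoD) simp
  then have "eventually (\<lambda>n. n \<ge> 1 \<and> q ^ n < 1 / 2) sequentially"
    using eventually_ge_at_top[of "1::nat"] by eventually_elim auto
  then obtain n where "n \<ge> 1 \<and> q ^ n < 1 / 2"
    using eventually_happens'[OF sequentially_bot] by blast
  then have n: "n \<ge> 1" and qn: "q ^ n < 1 / 2" by auto
  define P where "P = Pi\<^sub>M {..<n} (\<lambda>_::nat. unit_leb)"
  interpret F: finite_product_prob_space "\<lambda>_. unit_leb" "{..<n}"
    by unfold_locales (rule finite_lessThan)
  interpret PS: prob_space P unfolding P_def by (rule F.prob_space_axioms)
  interpret pair_sigma_finite unit_leb P ..
  interpret PP: pair_prob_space unit_leb P ..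
  define X where "X = (\<Inter>n. \<Union>p\<in>{n..}. block_set R p)"
  have X[measurable]: "X \<in> sets unit_leb" unfolding X_def by measurable
  have mX: "measure unit_leb X \<ge> 1 / (2 * M\<^sup>2)"
    unfolding X_def by (intro unit.measure_limsup_ge measure_block_set R) auto
  have coord: "(\<lambda>t. t k) \<in> P \<rightarrow>\<^sub>M unit_leb" if "k < n" for k
    unfolding P_def using that by (intro measurable_component_singleton) simp
  define T where "T p i x t = (\<Sum>k<n. block_kernel p i x (t k))" for p i x and t :: "nat \<Rightarrow> real"
  have T[measurable]: "(\<lambda>z. T p i (fst z) (snd z)) \<in> borel_measurable (unit_leb \<Otimes>\<^sub>M P)" for p i
    unfolding T_def block_kernel_def
  proof (intro borel_measurable_sum borel_measurable_times)
    fix k l assume "k \<in> {..<n}"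
    then have [measurable]: "(\<lambda>z. snd z k) \<in> unit_leb \<Otimes>\<^sub>M P \<rightarrow>\<^sub>M unit_leb"
      using measurable_compose[OF measurable_snd, of "\<lambda>t. t k" P unit_leb unit_leb] coord[of k] by simp
    show "(\<lambda>z. \<phi> (p + l) (snd z k)) \<in> borel_measurable (unit_leb \<Otimes>\<^sub>M P)" by measurable
    show "(\<lambda>z. \<phi> (p + l) (fst z)) \<in> borel_measurable (unit_leb \<Otimes>\<^sub>M P)" by measurable
  qed
  \<comment> \<open>Bounding p by m leaves finitely many kernels, hence a common N. By continuity of
    the measure some m loses less than half of \<open>1 / (4 * M\<^sup>2)\<close>.\<close>
  define H where "H m = {z \<in> space (unit_leb \<Otimes>\<^sub>M P). fst z \<in> X \<and> (\<exists>p\<le>m. \<exists>i\<le>3*R. T p i (fst z) (snd z) > real n * A)}" for m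
  have H[measurable]: "H m \<in> sets (unit_leb \<Otimes>\<^sub>M P)" for m unfolding H_def by measurable
  have slice: "emeasure P (Pair x -` (\<Union>m. H m)) \<ge> ennreal (1 / 2)" if x: "x \<in> X" for x
  proof -
    have xs: "x \<in> {0..1}" using sets.sets_into_space[OF X] x by auto
    let ?bad = "{t \<in> space P. \<forall>p. \<forall>i\<le>3*R. T p i x t \<le> real n * A}"
    have Tx[measurable]: "T p i x \<in> borel_measurable P" for p i
      using measurable_compose[OF measurable_Pair1'[of x unit_leb P] T] xs by simp
    have bad: "?bad \<in> sets P" by measurable
    have "measure P ?bad \<le> 1 / 2"
      using random_points_block_kernel[OF R A0(1) hR B(1), of x n] x qn
      unfolding T_def P_def X_def q_def[symmetric] A0(2) by linarith
    then have "1 / 2 \<le> measure P (space P - ?bad)" using PS.prob_compl[OF bad] by simp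
    moreover have "Pair x -` (\<Union>m. H m) = space P - ?bad"
    proof (intro set_eqI iffI)
      fix t assume "t \<in> Pair x -` (\<Union>m. H m)"
      then obtain m p i where "t \<in> space P" "i \<le> 3 * R" "T p i x t > real n * A"
        by (auto simp: H_def space_pair_measure)
      then show "t \<in> space P - ?bad" using not_le by blast
    next
      fix t assume t: "t \<in> space P - ?bad"
      then obtain p i where "i \<le> 3 * R" "T p i x t > real n * A" by (auto simp: not_le)
      then have "(x, t) \<in> H p" using t x xs unfolding H_def space_pair_measure by auto
      then show "t \<in> Pair x -` (\<Union>m. H m)" by blast
    qed
    ultimately show ?thesis by (simp only: PS.emeasure_eq_measure ennreal_leI)
  qed
  have "ennreal (1 / (4 * M\<^sup>2)) \<le> ennreal (1 / 2 * measure unit_leb X)"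
    using mX by (intro ennreal_leI) (simp add: field_simps)
  also have "\<dots> = (\<integral>\<^sup>+x. ennreal (1 / 2) * indicator X x \<partial>unit_leb)"
    by (subst nn_integral_cmult_indicator[OF X], subst unit.emeasure_eq_measure, rule ennreal_mult) auto
  also have "\<dots> \<le> (\<integral>\<^sup>+x. emeasure P (Pair x -` (\<Union>m. H m)) \<partial>unit_leb)"
    using slice by (intro nn_integral_mono) (auto split: split_indicator)
  also have "\<dots> = emeasure (unit_leb \<Otimes>\<^sub>M P) (\<Union>m. H m)"
    by (subst PS.emeasure_pair_measure_alt) auto
  finally have "1 / (4 * M\<^sup>2) \<le> measure (unit_leb \<Otimes>\<^sub>M P) (\<Union>m. H m)"
    by (simp add: PP.emeasure_eq_measure)
  then have "measure (unit_leb \<Otimes>\<^sub>M P) (\<Union>m. H m) > 1 / (8 * M\<^sup>2)"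
    by (rule less_le_trans[rotated]) (use M_pos in \<open>simp add: field_simps\<close>)
  moreover have "(\<lambda>m. measure (unit_leb \<Otimes>\<^sub>M P) (H m)) \<longlonglongrightarrow> measure (unit_leb \<Otimes>\<^sub>M P) (\<Union>m. H m)"
    by (rule PP.finite_Lim_measure_incseq) (auto simp: incseq_def H_def, meson order_trans)
  ultimately have "eventually (\<lambda>m. measure (unit_leb \<Otimes>\<^sub>M P) (H m) > 1 / (8 * M\<^sup>2)) sequentially"
    by (metis order_tendstoD(1))
  then obtain m where m: "measure (unit_leb \<Otimes>\<^sub>M P) (H m) > 1 / (8 * M\<^sup>2)"
    using eventually_happens'[OF sequentially_bot] by blast
  show ?thesis
  proof (rule that[of n "m + 3 * R"])
    fix Q assume "AE t in Pi\<^sub>M {..<n} (\<lambda>_::nat. unit_leb). Q t"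
    then have Q: "AE t in P. Q t" unfolding P_def .
    let ?S = "\<lambda>t. {x \<in> space unit_leb. \<exists>p i. p + i \<le> m + 3 * R \<and> (\<Sum>k<n. block_kernel p i x (t k)) > real n * A}"
    show "\<exists>t \<in> space (Pi\<^sub>M {..<n} (\<lambda>_::nat. unit_leb)). Q t \<and> measure unit_leb (?S t) \<ge> 1 / (8 * M\<^sup>2)"
    proof (rule ccontr)
      assume "\<not> ?thesis"
      then have neg: "measure unit_leb (?S t) < 1 / (8 * M\<^sup>2)" if "t \<in> space P" "Q t" for t
        using that unfolding P_def by force
      have "emeasure (unit_leb \<Otimes>\<^sub>M P) (H m) = (\<integral>\<^sup>+t. emeasure unit_leb ((\<lambda>x. (x, t)) -` H m) \<partial>P)"
        by (rule emeasure_pair_measure_alt2[OF H])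
      also have "\<dots> \<le> (\<integral>\<^sup>+t. ennreal (1 / (8 * M\<^sup>2)) \<partial>P)"
      proof (rule nn_integral_mono_AE)
        show "AE t in P. emeasure unit_leb ((\<lambda>x. (x, t)) -` H m) \<le> ennreal (1 / (8 * M\<^sup>2))"
          using Q
        proof (elim AE_mp, intro AE_I2 impI)
          fix t assume t: "t \<in> space P" "Q t"
          have "(\<lambda>x. T p i x t) \<in> borel_measurable unit_leb" for p i
            using measurable_compose[OF measurable_Pair2'[OF t(1)] T] by simp
          then have [measurable]: "(\<lambda>x. \<Sum>k<n. block_kernel p i x (t k)) \<in> borel_measurable unit_leb" for p i
            unfolding T_def .
          have "?S t \<in> sets unit_leb" by measurable
          moreover have "(\<lambda>x. (x, t)) -` H m \<subseteq> ?S t"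
          proof
            fix x assume "x \<in> (\<lambda>x. (x, t)) -` H m"
            then obtain p i where "x \<in> space unit_leb" "p \<le> m" "i \<le> 3 * R" "T p i x t > real n * A"
              by (auto simp: H_def space_pair_measure)
            then show "x \<in> ?S t" unfolding T_def using add_mono[of p m i "3 * R"] by blast
          qed
          ultimately have "emeasure unit_leb ((\<lambda>x. (x, t)) -` H m) \<le> emeasure unit_leb (?S t)"
            by (intro emeasure_mono)
          also have "\<dots> \<le> ennreal (1 / (8 * M\<^sup>2))"
            unfolding unit.emeasure_eq_measure using neg[OF t] by (intro ennreal_leI) simp
          finally show "emeasure unit_leb ((\<lambda>x. (x, t)) -` H m) \<le> ennreal (1 / (8 * M\<^sup>2))" .
        qed
      qed
      also have "\<dots> = ennreal (1 / (8 * M\<^sup>2))" using PS.emeasure_space_1 by simp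
      finally have "measure (unit_leb \<Otimes>\<^sub>M P) (H m) \<le> 1 / (8 * M\<^sup>2)"
        by (simp add: PP.emeasure_eq_measure ennreal_le_iff)
      then show False using m by simp
    qed
  qed (rule n)
qed

end

section \<open>From random points to small sets\<close>

lemma abs_diff_le_of_floor_eq:
  fixes x y e :: real
  assumes "\<lfloor>x / e\<rfloor> = \<lfloor>y / e\<rfloor>" "e > 0"
  shows "\<bar>x - y\<bar> \<le> e"
proof -
  have "\<bar>x / e - y / e\<bar> \<le> 1" using assms(1) by linarith
  then have "\<bar>x - y\<bar> / e \<le> 1" using assms(2) by (simp add: diff_divide_distrib[symmetric])
  then show ?thesis using assms(2) by simp
qed

lemma (in bounded_ons) fourier_partial_sum_measurable[measurable]:
  "(\<lambda>x. fourier_partial_sum \<phi> f m x) \<in> borel_measurable unit_leb"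
  unfolding fourier_partial_sum_def by measurable

text \<open>The point mass at t i is spread over a set of measure s inside the cell of t i, on which
  every \<phi> k with k < N varies by at most \<epsilon>; so each of the first N coefficients is off
  by at most \<epsilon>. Every small s works with the same n and N, which leaves s free to be
  matched with the exponent later.\<close>

lemma (in bounded_ons) concentrated_large_partial_sums:
  assumes A: "A > 0"
  obtains n N :: nat and s0 :: real where "n \<ge> 1" "s0 > 0"
    "\<And>s. 0 < s \<Longrightarrow> s \<le> s0 \<Longrightarrow> \<exists>V. (\<forall>i<n. V i \<in> sets unit_leb \<and> measure unit_leb (V i) = s) \<and>
       measure unit_leb {x \<in> space unit_leb. \<exists>m\<le>N.
          \<bar>fourier_partial_sum \<phi> (\<lambda>t. (\<Sum>i<n. indicator (V i) t) / (real n * s)) m x\<bar> \<ge> A} \<ge> 1 / (8 * M\<^sup>2)"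
proof -
  obtain n N :: nat where n: "n \<ge> 1"
    and pts: "\<And>Q. AE t in Pi\<^sub>M {..<n} (\<lambda>_::nat. unit_leb). Q t \<Longrightarrow>
       \<exists>t \<in> space (Pi\<^sub>M {..<n} (\<lambda>_::nat. unit_leb)). Q t \<and>
        measure unit_leb {x \<in> space unit_leb. \<exists>p i. p + i \<le> N \<and> (\<Sum>k<n. block_kernel p i x (t k)) > real n * (4 * A)} \<ge> 1 / (8 * M\<^sup>2)"
    using points_with_large_kernel_sums[of "4 * A"] A by auto
  \<comment> \<open>At most N terms, each with error at most \<epsilon> M, add up to at most 2A, so
    the difference of two partial sums still exceeds 4A - 2A = 2A and one of the two reaches A.
    Writing N + 1 keeps the quotient meaningful for N = 0.\<close>
  define \<epsilon> where "\<epsilon> = 2 * A / (real (N + 1) * M)"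
  have \<epsilon>: "\<epsilon> > 0" using A M_pos by (simp add: \<epsilon>_def)
  define c where "c t = map (\<lambda>k. \<lfloor>\<phi> k t / \<epsilon>\<rfloor>) [0..<N]" for t
  define U where "U v = {t \<in> space unit_leb. c t = v}" for v
  have U: "U v \<in> sets unit_leb" for v
  proof (cases "length v = N")
    case True
    then have "U v = {t \<in> space unit_leb. \<forall>k\<in>{..<N}. \<lfloor>\<phi> k t / \<epsilon>\<rfloor> = v ! k}"
      by (auto simp: U_def c_def list_eq_iff_nth_eq)
    also have "\<dots> \<in> sets unit_leb" by measurable
    finally show ?thesis .
  next
    case False
    then have "U v = {}" by (auto simp: U_def c_def)
    then show ?thesis by simp
  qed
  have "AE t in unit_leb. measure unit_leb (U (c t)) > 0"
    using AE_cell_positive[of c] U unfolding U_def by blast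
  then have "AE t in Pi\<^sub>M {..<n} (\<lambda>_::nat. unit_leb). \<forall>i\<in>{..<n}. measure unit_leb (U (c (t i))) > 0"
    by (intro AE_finite_allI AE_PiM_component[of _ "\<lambda>_. unit_leb"] prob_space_unit_leb) auto
  then obtain t where t: "\<And>i. i < n \<Longrightarrow> measure unit_leb (U (c (t i))) > 0"
    and big: "measure unit_leb {x \<in> space unit_leb. \<exists>p i. p + i \<le> N \<and> (\<Sum>k<n. block_kernel p i x (t k)) > real n * (4 * A)} \<ge> 1 / (8 * M\<^sup>2)"
    using pts by force
  define s0 where "s0 = Min ((\<lambda>i. measure unit_leb (U (c (t i)))) ` {..<n})"
  have ne: "(\<lambda>i. measure unit_leb (U (c (t i)))) ` {..<n} \<noteq> {}" using n by (auto simp: lessThan_empty_iff)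
  have s0: "s0 > 0" unfolding s0_def using t ne by (subst Min_gr_iff) auto
  have s0_le: "s0 \<le> measure unit_leb (U (c (t i)))" if "i < n" for i
    unfolding s0_def using that by (intro Min_le) auto
  show ?thesis
  proof (rule that[OF n s0, of N])
    fix s assume s: "0 < s" "s \<le> s0"
    have "\<exists>V. V \<in> sets unit_leb \<and> V \<subseteq> U (c (t i)) \<and> measure unit_leb V = s" if "i < n" for i
      using exists_subset_of_measure[OF U[of "c (t i)"], of s] s s0_le[OF that] by auto
    then obtain V where V: "\<And>i. i < n \<Longrightarrow> V i \<in> sets unit_leb" "\<And>i. i < n \<Longrightarrow> V i \<subseteq> U (c (t i))"
      "\<And>i. i < n \<Longrightarrow> measure unit_leb (V i) = s"
      by metis
    define f where "f = (\<lambda>t. (\<Sum>i<n. indicator (V i) t) / (real n * s))"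
    have iV: "integrable unit_leb (\<lambda>y. indicator (V i) y * \<phi> k y)" if "i < n" for i k
      using V(1)[OF that] bound[of k] order_trans[OF abs_ge_zero bound]
      by (intro integrable_bounded_unit_leb[of _ M]) (auto split: split_indicator)
    have V_int: "\<bar>(\<integral>y. indicator (V i) y * \<phi> k y \<partial>unit_leb) - s * \<phi> k (t i)\<bar> \<le> s * \<epsilon>" if "i < n" "k < N" for i k
    proof -
      have iI: "integrable unit_leb (indicator (V i) :: real \<Rightarrow> real)"
        using V(1)[OF that(1)] by (intro integrable_real_indicator) (auto simp: unit.emeasure_eq_measure)
      have Vs: "V i \<inter> {0..1} = V i" using sets.sets_into_space[OF V(1)[OF that(1)]] by auto
      have "(\<integral>y. indicator (V i) y * \<phi> k y \<partial>unit_leb) - s * \<phi> k (t i)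
        = (\<integral>y. indicator (V i) y * \<phi> k y - indicator (V i) y * \<phi> k (t i) \<partial>unit_leb)"
        using iV[OF that(1)] iI V(3)[OF that(1)] by (simp add: Vs)
      also have "\<bar>\<dots>\<bar> \<le> (\<integral>y. \<bar>indicator (V i) y * \<phi> k y - indicator (V i) y * \<phi> k (t i)\<bar> \<partial>unit_leb)"
        by (rule integral_abs_bound)
      also have "\<dots> \<le> (\<integral>y. indicator (V i) y * \<epsilon> \<partial>unit_leb)"
      proof (rule integral_mono)
        show "integrable unit_leb (\<lambda>y. \<bar>indicator (V i) y * \<phi> k y - indicator (V i) y * \<phi> k (t i)\<bar>)"
          using iV[OF that(1)] iI by (intro integrable_abs Bochner_Integration.integrable_diff) auto
        show "integrable unit_leb (\<lambda>y. indicator (V i) y * \<epsilon>)" using iI by simp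
        fix y
        have "\<bar>\<phi> k y - \<phi> k (t i)\<bar> \<le> \<epsilon>" if "y \<in> V i"
        proof (rule abs_diff_le_of_floor_eq[OF _ \<epsilon>])
          have "c y = c (t i)" using V(2)[OF \<open>i < n\<close>] that by (auto simp: U_def)
          then show "\<lfloor>\<phi> k y / \<epsilon>\<rfloor> = \<lfloor>\<phi> k (t i) / \<epsilon>\<rfloor>"
            using \<open>k < N\<close> by (simp add: c_def)
        qed
        then show "\<bar>indicator (V i) y * \<phi> k y - indicator (V i) y * \<phi> k (t i)\<bar> \<le> indicator (V i) y * \<epsilon>"
          by (auto split: split_indicator)
      qed
      also have "\<dots> = s * \<epsilon>" using V(3)[OF that(1)] by (simp add: Vs)
      finally show ?thesis .
    qed
    have coeff: "\<bar>fourier_coeff \<phi> f k - (\<Sum>i<n. \<phi> k (t i)) / real n\<bar> \<le> \<epsilon>" if k: "k < N" for k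
    proof -
      have "fourier_coeff \<phi> f k = (\<integral>y. (\<Sum>i<n. indicator (V i) y * \<phi> k y) / (real n * s) \<partial>unit_leb)"
        unfolding fourier_coeff_def f_def by (simp add: sum_distrib_right)
      also have "\<dots> = (\<Sum>i<n. \<integral>y. indicator (V i) y * \<phi> k y \<partial>unit_leb) / (real n * s)"
        using iV by (subst Bochner_Integration.integral_divide_zero, subst Bochner_Integration.integral_sum) auto
      finally have "fourier_coeff \<phi> f k - (\<Sum>i<n. \<phi> k (t i)) / real n
         = (\<Sum>i<n. (\<integral>y. indicator (V i) y * \<phi> k y \<partial>unit_leb) - s * \<phi> k (t i)) / (real n * s)"
        using n s by (simp add: sum_subtractf diff_divide_distrib sum_distrib_left[symmetric])
      also have "\<bar>\<dots>\<bar> = \<bar>\<Sum>i<n. (\<integral>y. indicator (V i) y * \<phi> k y \<partial>unit_leb) - s * \<phi> k (t i)\<bar> / (real n * s)"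
        using s by (simp add: abs_divide)
      also have "\<dots> \<le> (\<Sum>i<n. s * \<epsilon>) / (real n * s)"
        using s V_int[OF _ k] by (intro divide_right_mono order_trans[OF sum_abs] sum_mono) auto
      also have "\<dots> = \<epsilon>" using n s by simp
      finally show ?thesis .
    qed
    have "{x \<in> space unit_leb. \<exists>p i. p + i \<le> N \<and> (\<Sum>k<n. block_kernel p i x (t k)) > real n * (4 * A)}
      \<subseteq> {x \<in> space unit_leb. \<exists>m\<le>N. \<bar>fourier_partial_sum \<phi> f m x\<bar> \<ge> A}"
    proof safe
      fix x p i assume x: "x \<in> space unit_leb" and pi: "p + i \<le> N"
        and gt: "(\<Sum>k<n. block_kernel p i x (t k)) > real n * (4 * A)"
      let ?S = "\<lambda>m. fourier_partial_sum \<phi> f m x"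
      let ?a = "\<lambda>k. (\<Sum>j<n. \<phi> k (t j)) / real n"
      have S_diff: "?S (p + i) - ?S p = (\<Sum>l<i. fourier_coeff \<phi> f (p + l) * \<phi> (p + l) x)"
        unfolding fourier_partial_sum_def by (induction i) auto
      have "(\<Sum>k<n. block_kernel p i x (t k)) / real n = (\<Sum>l<i. ?a (p + l) * \<phi> (p + l) x)"
        unfolding block_kernel_def
        by (subst sum.swap) (simp add: sum_divide_distrib sum_distrib_left sum_distrib_right mult_ac)
      moreover have "4 * A < (\<Sum>k<n. block_kernel p i x (t k)) / real n"
        using gt n by (simp add: field_simps)
      ultimately have "4 * A < (\<Sum>l<i. ?a (p + l) * \<phi> (p + l) x)" by simp
      moreover have "\<bar>(?S (p + i) - ?S p) - (\<Sum>l<i. ?a (p + l) * \<phi> (p + l) x)\<bar> \<le> 2 * A"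
      proof -
        have "\<bar>(?S (p + i) - ?S p) - (\<Sum>l<i. ?a (p + l) * \<phi> (p + l) x)\<bar>
           = \<bar>\<Sum>l<i. (fourier_coeff \<phi> f (p + l) - ?a (p + l)) * \<phi> (p + l) x\<bar>"
          unfolding S_diff by (simp add: sum_subtractf left_diff_distrib)
        also have "\<dots> \<le> (\<Sum>l<i. \<epsilon> * M)"
        proof (rule order_trans[OF sum_abs], rule sum_mono)
          fix l assume "l \<in> {..<i}"
          then show "\<bar>(fourier_coeff \<phi> f (p + l) - ?a (p + l)) * \<phi> (p + l) x\<bar> \<le> \<epsilon> * M"
            unfolding abs_mult using pi \<epsilon> by (intro mult_mono coeff bound) auto
        qed
        also have "\<dots> = real i * (\<epsilon> * M)" by simp
        also have "\<dots> \<le> real (N + 1) * (\<epsilon> * M)"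
          using pi \<epsilon> M_pos by (intro mult_right_mono) auto
        also have "\<dots> = 2 * A" unfolding \<epsilon>_def using M_pos by (simp del: of_nat_Suc of_nat_add)
        finally show ?thesis .
      qed
      ultimately have "\<bar>?S (p + i)\<bar> \<ge> A \<or> \<bar>?S p\<bar> \<ge> A" by linarith
      then show "\<exists>m\<le>N. \<bar>?S m\<bar> \<ge> A" using pi by (metis add_leD1)
    qed
    then have "1 / (8 * M\<^sup>2) \<le> measure unit_leb {x \<in> space unit_leb. \<exists>m\<le>N. \<bar>fourier_partial_sum \<phi> f m x\<bar> \<ge> A}"
      by (intro order_trans[OF big] unit.finite_measure_mono) measurable
    then show "\<exists>V. (\<forall>i<n. V i \<in> sets unit_leb \<and> measure unit_leb (V i) = s) \<and>
       measure unit_leb {x \<in> space unit_leb. \<exists>m\<le>N.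
          \<bar>fourier_partial_sum \<phi> (\<lambda>t. (\<Sum>i<n. indicator (V i) t) / (real n * s)) m x\<bar> \<ge> A} \<ge> 1 / (8 * M\<^sup>2)"
      using V unfolding f_def by (intro exI[of _ V]) auto
  qed
qed

subsection \<open>Measure preserving rearrangements\<close>

text \<open>Without atoms the distribution function is continuous. The points where it is at most a
  form a closed half-line, and at its endpoint the value is exactly a.\<close>

lemma cdf_transform_measure_le:
  fixes h :: "real \<Rightarrow> real"
  assumes h[measurable]: "h \<in> borel_measurable unit_leb"
    and atom: "\<And>c. measure unit_leb {x \<in> space unit_leb. h x = c} = 0"
    and a: "0 < a" "a < 1"
  shows "measure unit_leb {x \<in> space unit_leb. measure unit_leb {y \<in> space unit_leb. h y \<le> h x} \<le> a} = a"
proof -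
  define D where "D = distr unit_leb borel h"
  interpret D: real_distribution D unfolding D_def by (rule unit.real_distribution_distr) simp
  have cdf: "cdf D c = measure unit_leb {y \<in> space unit_leb. h y \<le> c}" for c
    unfolding cdf_def D_def by (subst measure_distr) (auto intro!: arg_cong[where f="measure unit_leb"])
  have cont: "isCont (cdf D) c" for c
  proof -
    have "measure D {c} = measure unit_leb {x \<in> space unit_leb. h x = c}"
      unfolding D_def by (subst measure_distr) (auto intro!: arg_cong[where f="measure unit_leb"])
    then show ?thesis unfolding D.isCont_cdf using atom by simp
  qed
  obtain lo where lo: "cdf D lo < a"
    using order_tendstoD(2)[OF D.cdf_lim_at_bot a(1)] by (auto simp: eventually_at_bot_linorder)
  obtain hi where hi: "cdf D hi > a" "\<And>x. x \<ge> hi \<Longrightarrow> cdf D x > a"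
    using order_tendstoD(1)[OF D.cdf_lim_at_top_prob a(2)] by (auto simp: eventually_at_top_linorder)
  define S where "S = {c. cdf D c \<le> a}"
  have S: "lo \<in> S" "\<And>c. c \<in> S \<Longrightarrow> c \<le> hi" "closed S"
  proof -
    show "lo \<in> S" using lo by (simp add: S_def)
    show "c \<in> S \<Longrightarrow> c \<le> hi" for c using hi(2)[of c] by (fastforce simp: S_def)
    show "closed S" unfolding S_def
      using cont by (intro closed_Collect_le continuous_at_imp_continuous_on) auto
  qed
  define c where "c = Sup S"
  have bdd: "bdd_above S" using S(2) by (auto simp: bdd_above_def)
  have c: "c \<in> S" unfolding c_def using S bdd by (intro closed_contains_Sup) auto
  have S_eq: "x \<in> S \<longleftrightarrow> x \<le> c" for x
    using c cSup_upper[OF _ bdd] D.cdf_nondecreasing[of x c] unfolding c_def S_def by force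
  have "cdf D c = a"
  proof (rule antisym)
    show "cdf D c \<le> a" using c by (simp add: S_def)
    have "((cdf D) \<longlongrightarrow> cdf D c) (at_right c)"
      using cont[of c] by (simp add: isCont_def filterlim_at_split)
    moreover have "eventually (\<lambda>x. a \<le> cdf D x) (at_right c)"
    proof (rule eventually_at_rightI[of c "c + 1"])
      fix x assume "x \<in> {c<..<c + 1}"
      then have "x \<notin> S" using S_eq[of x] by auto
      then show "a \<le> cdf D x" by (simp add: S_def)
    qed simp
    ultimately show "a \<le> cdf D c" by (intro tendsto_lowerbound) auto
  qed
  moreover have "{x \<in> space unit_leb. measure unit_leb {y \<in> space unit_leb. h y \<le> h x} \<le> a} = {y \<in> space unit_leb. h y \<le> c}"
    using S_eq unfolding cdf[symmetric] S_def by auto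
  ultimately show ?thesis unfolding cdf by simp
qed

lemma null_sets_unit_leb_subset:
  assumes N: "N' \<in> null_sets unit_leb" "N \<subseteq> N'"
  shows "N \<in> null_sets unit_leb"
proof -
  have N': "N' \<in> null_sets lebesgue"
    using N by (auto simp: null_sets_def sets_restrict_space_iff emeasure_restrict_space)
  then have "N \<in> null_sets lebesgue" using N(2) by (rule null_sets_completion_subset[rotated])
  moreover have "N \<subseteq> {0..1}" using N sets.sets_into_space[of N' unit_leb] by auto
  ultimately show ?thesis
    by (auto simp: null_sets_def sets_restrict_space_iff emeasure_restrict_space)
qed

text \<open>Probability integral transform: a random variable without atoms, put into its own
  distribution function, is uniform on [0;1], as a comparison of distribution functions
  shows.\<close>

lemma measure_preserving_cdf_transform:
  fixes h :: "real \<Rightarrow> real"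
  assumes h[measurable]: "h \<in> borel_measurable unit_leb"
    and atom: "\<And>c. measure unit_leb {x \<in> space unit_leb. h x = c} = 0"
  shows "measure_preserving_01 (\<lambda>x. measure unit_leb {y \<in> space unit_leb. h y \<le> h x})"
proof -
  define \<omega> where "\<omega> = (\<lambda>x. measure unit_leb {y \<in> space unit_leb. h y \<le> h x})"
  have \<omega>01: "0 \<le> \<omega> x" "\<omega> x \<le> 1" for x unfolding \<omega>_def by auto
  have \<omega>[measurable]: "\<omega> \<in> borel_measurable unit_leb"
  proof -
    have "mono (\<lambda>c. measure unit_leb {y \<in> space unit_leb. h y \<le> c})"
    proof (rule monoI, rule unit.finite_measure_mono)
      show "{y \<in> space unit_leb. h y \<le> c} \<in> sets unit_leb" for c by measurable
    qed auto
    then have "(\<lambda>c. measure unit_leb {y \<in> space unit_leb. h y \<le> c}) \<in> borel_measurable borel"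
      by (rule borel_measurable_mono)
    from measurable_compose[OF h this] show ?thesis unfolding \<omega>_def .
  qed
  define E where "E = distr unit_leb borel \<omega>"
  define F where "F = distr unit_leb borel (\<lambda>x. x)"
  have idm[measurable]: "(\<lambda>x. x) \<in> borel_measurable unit_leb"
    using id_borel_measurable_lebesgue_on[of "{0..1}"] by (simp add: id_def)
  interpret E: real_distribution E unfolding E_def by (rule unit.real_distribution_distr) simp
  interpret F: real_distribution F unfolding F_def by (rule unit.real_distribution_distr) simp
  have cE: "cdf E a = measure unit_leb {x \<in> space unit_leb. \<omega> x \<le> a}" for a
    unfolding cdf_def E_def by (subst measure_distr) (auto intro!: arg_cong[where f="measure unit_leb"])
  have cF: "cdf F a = measure unit_leb {x \<in> space unit_leb. x \<le> a}" for a
    unfolding cdf_def F_def by (subst measure_distr) (auto intro!: arg_cong[where f="measure unit_leb"])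
  have cE_mid: "cdf E a = a" if "0 < a" "a < 1" for a
    unfolding cE \<omega>_def by (rule cdf_transform_measure_le[OF h atom that])
  have cF_mid: "cdf F a = a" if "0 \<le> a" "a \<le> 1" for a
  proof -
    have "{x \<in> space unit_leb. x \<le> a} = {0..a}" using that by auto
    then show ?thesis unfolding cF using that by (simp add: measure_restrict_space)
  qed
  have "cdf E a = cdf F a" for a
  proof -
    consider "a < 0" | "a = 0" | "0 < a" "a < 1" | "a \<ge> 1" by linarith
    then show ?thesis
    proof cases
      case 1
      then have "{x \<in> space unit_leb. \<omega> x \<le> a} = {}" "{x \<in> space unit_leb. x \<le> a} = {}"
        using \<omega>01 by (auto simp: not_le intro: less_le_trans)
      then show ?thesis unfolding cE cF by (simp only:)
    next
      case 2
      have "cdf E 0 \<le> e" if "0 < e" for e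
      proof -
        have "cdf E 0 \<le> cdf E (min e (1/2))" using that by (intro E.cdf_nondecreasing) auto
        also have "\<dots> \<le> e" using that by (subst cE_mid) auto
        finally show ?thesis .
      qed
      then have "cdf E 0 \<le> 0" by (rule field_le_epsilon) simp
      then show ?thesis using 2 cF_mid[of 0] E.cdf_nonneg[of 0] by simp
    next
      case 3
      then show ?thesis using cE_mid cF_mid by simp
    next
      case 4
      then have "{x \<in> space unit_leb. \<omega> x \<le> a} = space unit_leb" "{x \<in> space unit_leb. x \<le> a} = space unit_leb"
        using \<omega>01 by (auto intro: order_trans)
      then show ?thesis unfolding cE cF by (simp only:)
    qed
  qed
  then have EF: "E = F" by (intro cdf_unique ext) (unfold_locales)
  have bor: "\<omega> -` S \<inter> {0..1} \<in> sets unit_leb \<and>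
      emeasure unit_leb (\<omega> -` S \<inter> {0..1}) = emeasure unit_leb (S \<inter> {0..1})" if S: "S \<in> sets borel" for S
  proof
    show "\<omega> -` S \<inter> {0..1} \<in> sets unit_leb" using measurable_sets[OF \<omega> S] by simp
    have "emeasure E S = emeasure F S" unfolding EF ..
    then show "emeasure unit_leb (\<omega> -` S \<inter> {0..1}) = emeasure unit_leb (S \<inter> {0..1})"
      unfolding E_def F_def using S by (simp add: emeasure_distr vimage_def)
  qed
  \<comment> \<open>A Lebesgue set is a Borel set together with a part of a Borel null set. The
    preimage of that null set is null by the Borel case, and completeness handles the part.\<close>
  have leb: "\<omega> -` A \<inter> {0..1} \<in> sets unit_leb \<and>
      emeasure unit_leb (\<omega> -` A \<inter> {0..1}) = emeasure unit_leb A" if A: "A \<in> sets unit_leb" for A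
  proof -
    have "A \<in> sets lebesgue" "A \<subseteq> {0..1}" using A by (auto simp: sets_restrict_space)
    then obtain S N N' where SN: "A = S \<union> N" "N \<subseteq> N'" "N' \<in> null_sets lborel" "S \<in> sets lborel"
      by (elim sets_completionE)
    have "N' \<in> null_sets lebesgue" using SN(3) by (rule null_sets_completionI)
    then have N'0: "N' \<inter> {0..1} \<in> null_sets unit_leb"
      by (auto simp: null_sets_def sets_restrict_space_iff emeasure_restrict_space
          intro!: null_sets_subset[of N' lebesgue, THEN null_setsD1])
    have N'1: "\<omega> -` N' \<inter> {0..1} \<in> null_sets unit_leb"
      using bor[of N'] SN(3) N'0 by (auto simp: null_sets_def)
    then have N0: "\<omega> -` N \<inter> {0..1} \<in> null_sets unit_leb"
      using SN(2) by (intro null_sets_unit_leb_subset[OF N'1]) blast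
    have N1: "N \<in> null_sets unit_leb"
      using SN(1,2) \<open>A \<subseteq> {0..1}\<close> by (intro null_sets_unit_leb_subset[OF N'0]) blast
    have S: "S \<inter> {0..1} = S" using SN(1) \<open>A \<subseteq> {0..1}\<close> by auto
    have Sb: "\<omega> -` S \<inter> {0..1} \<in> sets unit_leb"
        "emeasure unit_leb (\<omega> -` S \<inter> {0..1}) = emeasure unit_leb S"
      using bor[of S] SN(4) S by auto
    have pre: "\<omega> -` A \<inter> {0..1} = (\<omega> -` S \<inter> {0..1}) \<union> (\<omega> -` N \<inter> {0..1})" using SN(1) by auto
    have "S \<in> sets lebesgue" using SN(4) by (rule sets_completionI_sets)
    then have "S \<in> sets unit_leb" using S by (subst sets_restrict_space_iff) auto
    then have "emeasure unit_leb A = emeasure unit_leb S"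
      unfolding SN(1) using N1 by (rule emeasure_Un_null_set)
    then show ?thesis
      unfolding pre emeasure_Un_null_set[OF Sb(1) N0] Sb(2)
      using sets.Un[OF Sb(1) null_setsD2[OF N0]] by simp
  qed
  have "\<omega> \<in> unit_leb \<rightarrow>\<^sub>M unit_leb"
    by (rule measurableI) (use leb \<omega>01 in auto)
  then show ?thesis
    unfolding measure_preserving_01_def \<omega>_def[symmetric] using leb by auto
qed

text \<open>Points are ordered by the number of tail unions that contain them, the deepest ones
  first, and \<omega> x is the measure of the points up to x in this order. If x lies in W k, then
  everything up to x lies in the k-th tail union, so \<omega> x \<le> \<sigma> k.\<close>

lemma rearrangement_to_zero:
  assumes W[measurable]: "\<And>k. W k \<in> sets unit_leb"
    and \<sigma>: "\<And>k::nat. measure unit_leb (\<Union>j\<in>{k..}. W j) \<le> \<sigma> k" "\<sigma> \<longlonglongrightarrow> 0"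
  obtains \<omega> where "measure_preserving_01 \<omega>" "AE x in unit_leb. \<forall>k. x \<in> W k \<longrightarrow> \<omega> x \<le> \<sigma> k"
proof -
  define T where "T k = (\<Union>j\<in>{k..}. W j)" for k
  have T[measurable]: "T k \<in> sets unit_leb" for k unfolding T_def by measurable
  have anti: "T l \<subseteq> T k" if "k \<le> l" for k l using that unfolding T_def by force
  \<comment> \<open>For points in all T k this value is arbitrary; they form a null set.\<close>
  define lev where "lev x = (LEAST k. x \<notin> T k)" for x
  have lev[measurable]: "lev \<in> measurable unit_leb (count_space UNIV)" unfolding lev_def by measurable
  \<comment> \<open>The factor 2 exceeds the length of [0;1], so a higher level always means a
    smaller h. The summand x makes every level set of h countable, so there are no atoms.\<close>
  define h where "h x = x - 2 * real (lev x)" for x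
  have idm[measurable]: "(\<lambda>x. x) \<in> borel_measurable unit_leb"
    using id_borel_measurable_lebesgue_on[of "{0..1}"] by (simp add: id_def)
  have h[measurable]: "h \<in> borel_measurable unit_leb"
    unfolding h_def using measurable_compose[OF lev, of real borel]
    by (intro borel_measurable_diff borel_measurable_times idm) auto
  have atom: "measure unit_leb {x \<in> space unit_leb. h x = c} = 0" for c
  proof -
    have "{x \<in> space unit_leb. h x = c} \<subseteq> range (\<lambda>m::nat. c + 2 * real m)" by (auto simp: h_def)
    then have "countable {x \<in> space unit_leb. h x = c}" by (rule countable_subset) auto
    then have "{x \<in> space unit_leb. h x = c} \<in> null_sets lebesgue"
      by (intro null_sets_completionI countable_imp_null_set_lborel)
    then have "emeasure lebesgue {x \<in> space unit_leb. h x = c} = 0" by (rule null_setsD1)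
    moreover have "emeasure unit_leb {x \<in> space unit_leb. h x = c} = emeasure lebesgue {x \<in> space unit_leb. h x = c}"
      by (rule emeasure_restrict_space) auto
    ultimately show ?thesis unfolding measure_def by simp
  qed
  have "measure unit_leb (\<Inter>k. T k) \<le> \<sigma> k" for k
  proof -
    have "measure unit_leb (\<Inter>k. T k) \<le> measure unit_leb (T k)"
      by (rule unit.finite_measure_mono[OF _ T]) blast
    then show ?thesis using \<sigma>(1)[of k] unfolding T_def by linarith
  qed
  then have "measure unit_leb (\<Inter>k. T k) \<le> 0"
    by (intro LIMSEQ_le_const[OF \<sigma>(2)]) blast
  then have "(\<Inter>k. T k) \<in> null_sets unit_leb"
    by (auto simp: null_sets_def unit.emeasure_eq_measure measure_le_0_iff)
  then have "AE x in unit_leb. x \<notin> (\<Inter>k. T k)" by (rule AE_not_in)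
  then have "AE x in unit_leb. \<forall>k. x \<in> W k \<longrightarrow> measure unit_leb {y \<in> space unit_leb. h y \<le> h x} \<le> \<sigma> k"
  proof (elim AE_mp, intro AE_I2 impI allI)
    fix x k assume x: "x \<in> space unit_leb" "x \<notin> (\<Inter>k. T k)" "x \<in> W k"
    have levx: "lev x > k"
    proof (rule ccontr)
      assume "\<not> lev x > k"
      then have "x \<in> T (lev x)" using x(3) by (auto simp: T_def)
      moreover have "\<exists>k. x \<notin> T k" using x(2) by blast
      then have "x \<notin> T (lev x)" unfolding lev_def by (rule LeastI_ex)
      ultimately show False by simp
    qed
    have "{y \<in> space unit_leb. h y \<le> h x} \<subseteq> T k"
    proof
      fix y assume y: "y \<in> {y \<in> space unit_leb. h y \<le> h x}"
      then have "real (lev x) < real (lev y) + 1" using x(1) by (simp add: h_def)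
      then have "lev x \<le> lev y" by linarith
      then have "k < lev y" using levx by simp
      then have "k < (LEAST k. y \<notin> T k)" unfolding lev_def .
      from not_less_Least[OF this] show "y \<in> T k" by simp
    qed
    then have "measure unit_leb {y \<in> space unit_leb. h y \<le> h x} \<le> measure unit_leb (T k)"
      by (intro unit.finite_measure_mono) auto
    then show "measure unit_leb {y \<in> space unit_leb. h y \<le> h x} \<le> \<sigma> k"
      using \<sigma>(1)[of k] unfolding T_def by linarith
  qed
  with measure_preserving_cdf_transform[OF h atom] show ?thesis by (rule that)
qed

subsection \<open>Random signs\<close>

definition fair_coin :: "bool measure" where "fair_coin = measure_pmf (pmf_of_set UNIV)"

definition coin_sign :: "bool \<Rightarrow> real" where "coin_sign b = (if b then 1 else - 1)"

lemma coin_sign_Not: "coin_sign (\<not> b) = - coin_sign b"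
  by (simp add: coin_sign_def)

lemma abs_coin_sign: "\<bar>coin_sign b\<bar> = 1"
  by (simp add: coin_sign_def)

lemma prob_space_fair_coin: "prob_space fair_coin"
  unfolding fair_coin_def by (rule prob_space_measure_pmf)

lemma emeasure_fair_coin_Not: "emeasure fair_coin (Not -` A) = emeasure fair_coin A"
proof -
  have "map_pmf Not (pmf_of_set (UNIV :: bool set)) = pmf_of_set (Not ` UNIV)"
    by (rule map_pmf_of_set_inj) (auto simp: inj_on_def)
  also have "Not ` UNIV = (UNIV :: bool set)" by (auto simp: image_iff)
  finally show ?thesis unfolding fair_coin_def by (metis emeasure_map_pmf)
qed

interpretation fair_coin: prob_space fair_coin
  by (rule prob_space_fair_coin)

interpretation coins: product_prob_space "\<lambda>_::nat. fair_coin" UNIV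
  by unfold_locales

lemma measurable_flip_coin:
  "(\<lambda>\<eta>. \<eta>(k := \<not> \<eta> k)) \<in> Pi\<^sub>M UNIV (\<lambda>_::nat. fair_coin) \<rightarrow>\<^sub>M Pi\<^sub>M UNIV (\<lambda>_. fair_coin)"
proof (rule measurable_fun_upd[where J=UNIV])
  have "Not \<in> fair_coin \<rightarrow>\<^sub>M fair_coin" by (simp add: fair_coin_def)
  then show "(\<lambda>\<eta>. \<not> \<eta> k) \<in> Pi\<^sub>M UNIV (\<lambda>_. fair_coin) \<rightarrow>\<^sub>M fair_coin"
    by (rule measurable_compose[rotated]) (rule measurable_component_singleton, simp)
qed auto

text \<open>Flipping one coordinate maps a cylinder to a cylinder with one factor replaced by its
  image under \<open>Not\<close>, which has the same measure for a fair coin; cylinders determine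
  the product measure.\<close>

lemma distr_flip_coin:
  "distr (Pi\<^sub>M UNIV (\<lambda>_::nat. fair_coin)) (Pi\<^sub>M UNIV (\<lambda>_. fair_coin)) (\<lambda>\<eta>. \<eta>(k := \<not> \<eta> k)) = Pi\<^sub>M UNIV (\<lambda>_. fair_coin)"
    (is "distr ?S ?S ?f = _")
proof (rule coins.PiM_eq)
  have f: "?f \<in> ?S \<rightarrow>\<^sub>M ?S" by (rule measurable_flip_coin)
  fix J :: "nat set" and F :: "nat \<Rightarrow> bool set"
  assume J: "finite J" "J \<subseteq> UNIV" and F: "\<And>j. j \<in> J \<Longrightarrow> F j \<in> sets fair_coin"
  let ?F = "\<lambda>j. if j = k then Not -` F j else F j"
  have any: "A \<in> sets fair_coin" for A by (simp add: fair_coin_def)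
  have emb: "prod_emb UNIV (\<lambda>_. fair_coin) J (Pi\<^sub>E J G) = {\<eta>. \<forall>j\<in>J. \<eta> j \<in> G j}" for G :: "nat \<Rightarrow> bool set"
    by (auto simp: prod_emb_def fair_coin_def PiE_iff)
  have "emeasure (distr ?S ?S ?f) (prod_emb UNIV (\<lambda>_. fair_coin) J (Pi\<^sub>E J F)) =
      emeasure ?S (?f -` prod_emb UNIV (\<lambda>_. fair_coin) J (Pi\<^sub>E J F) \<inter> space ?S)"
    using J by (intro emeasure_distr f sets_PiM_I) (auto simp: any)
  also have "?f -` prod_emb UNIV (\<lambda>_. fair_coin) J (Pi\<^sub>E J F) \<inter> space ?S = prod_emb UNIV (\<lambda>_. fair_coin) J (Pi\<^sub>E J ?F)"
    unfolding emb by (auto simp: space_PiM fair_coin_def split: if_splits)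
  also have "emeasure ?S \<dots> = (\<Prod>j\<in>J. emeasure fair_coin (?F j))"
    using J by (intro coins.emeasure_PiM_emb any) auto
  also have "\<dots> = (\<Prod>j\<in>J. emeasure fair_coin (F j))"
    by (intro prod.cong) (auto simp: emeasure_fair_coin_Not)
  finally show "emeasure (distr ?S ?S ?f) (prod_emb UNIV (\<lambda>_. fair_coin) J (Pi\<^sub>E J F)) = (\<Prod>j\<in>J. emeasure fair_coin (F j))" .
qed simp

text \<open>Flipping the \<open>k\<close>-th coin changes a signed series by twice its \<open>k\<close>-th term, so at least
  one of the two series is as large as that term.\<close>
lemma coin_series_large:
  fixes g :: "nat \<Rightarrow> real"
  assumes g: "summable (\<lambda>j. \<bar>g j\<bar>)" and L: "\<bar>g k\<bar> \<ge> L"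
  defines "S \<equiv> Pi\<^sub>M UNIV (\<lambda>_::nat. fair_coin)"
  shows "measure S {\<eta> \<in> space S. \<bar>\<Sum>j. coin_sign (\<eta> j) * g j\<bar> \<ge> L} \<ge> 1 / 2"
proof -
  interpret S: prob_space S unfolding S_def by (rule coins.P.prob_space_axioms)
  let ?f = "\<lambda>\<eta>::nat \<Rightarrow> bool. \<eta>(k := \<not> \<eta> k)"
  let ?F = "\<lambda>\<eta>. \<Sum>j. coin_sign (\<eta> j) * g j"
  let ?T = "{\<eta> \<in> space S. \<bar>?F \<eta>\<bar> \<ge> L}"
  have coord: "(\<lambda>\<eta>. coin_sign (\<eta> j)) \<in> borel_measurable S" for j
    unfolding S_def
    by (rule measurable_compose[OF measurable_component_singleton]) (auto simp: fair_coin_def)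
  have F[measurable]: "?F \<in> borel_measurable S"
    using coord by (intro borel_measurable_suminf borel_measurable_times) auto
  have T[measurable]: "?T \<in> sets S" by measurable
  have sm: "summable (\<lambda>j. coin_sign (\<eta> j) * g j)" for \<eta>
    by (rule summable_rabs_cancel) (simp add: abs_mult abs_coin_sign g)
  have flip: "?F (?f \<eta>) = ?F \<eta> - 2 * (coin_sign (\<eta> k) * g k)" for \<eta>
  proof -
    have "(\<lambda>j. if j = k then 2 * (coin_sign (\<eta> k) * g k) else 0) sums (2 * (coin_sign (\<eta> k) * g k))"
      by (rule sums_single)
    from sums_diff[OF summable_sums[OF sm[of \<eta>]] this]
    have "(\<lambda>j. coin_sign (?f \<eta> j) * g j) sums (?F \<eta> - 2 * (coin_sign (\<eta> k) * g k))"
      by (rule sums_cong[THEN iffD1, rotated]) (auto simp: coin_sign_Not)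
    then show ?thesis by (rule sums_unique[symmetric])
  qed
  have fm: "?f \<in> S \<rightarrow>\<^sub>M S" unfolding S_def by (rule measurable_flip_coin)
  \<comment> \<open>The event and its preimage under the flip cover the space and have the same
    measure, since the flip preserves it.\<close>
  have "space S \<subseteq> ?T \<union> (?f -` ?T \<inter> space S)"
  proof
    fix \<eta> assume \<eta>: "\<eta> \<in> space S"
    have "\<bar>coin_sign (\<eta> k) * g k\<bar> \<ge> L" using L by (simp add: abs_mult abs_coin_sign)
    then have "\<bar>?F \<eta>\<bar> \<ge> L \<or> \<bar>?F (?f \<eta>)\<bar> \<ge> L" unfolding flip by linarith
    moreover have "?f \<eta> \<in> space S" using measurable_space[OF fm \<eta>] .
    ultimately show "\<eta> \<in> ?T \<union> (?f -` ?T \<inter> space S)" using \<eta> by blast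
  qed
  then have "1 \<le> measure S (?T \<union> (?f -` ?T \<inter> space S))"
    using S.prob_space S.finite_measure_mono[of "space S" "?T \<union> (?f -` ?T \<inter> space S)"] T
      measurable_sets[OF fm T] by auto
  also have "\<dots> \<le> measure S ?T + measure S (?f -` ?T \<inter> space S)"
    using T measurable_sets[OF fm T] by (intro measure_Un_le)
  also have "measure S (?f -` ?T \<inter> space S) = measure (distr S S ?f) ?T"
    using fm T by (simp add: measure_distr)
  also have "distr S S ?f = S" unfolding S_def by (rule distr_flip_coin)
  finally show ?thesis by simp
qed

text \<open>In a sum with fixed signs the other terms could cancel a large k-th term. With random
  signs the k-th term survives with probability at least 1 / 2 at each x where it is large, so the
  sets D k of pairs have measure at least c / 2, and so has the set of pairs in infinitely many of
  them. By Fubini some sequence of signs has a slice of positive measure.\<close>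

lemma random_signs_unbounded:
  fixes G :: "nat \<Rightarrow> nat \<Rightarrow> 'a \<Rightarrow> real"
  assumes N: "prob_space N" and G[measurable]: "\<And>m k. G m k \<in> borel_measurable N"
    and sm: "\<And>m x. summable (\<lambda>k. \<bar>G m k x\<bar>)"
    and large: "\<And>k. measure N {x \<in> space N. \<exists>m. \<bar>G m k x\<bar> \<ge> L k} \<ge> c"
    and L: "filterlim L at_top sequentially" and c: "c > 0"
  shows "\<exists>\<eta> E. E \<in> sets N \<and> measure N E > 0 \<and>
    (\<forall>x\<in>E. \<not> Bseq (\<lambda>m. \<Sum>k. coin_sign (\<eta> k) * G m k x))"
proof -
  define S where "S = Pi\<^sub>M UNIV (\<lambda>_::nat. fair_coin)"
  interpret N: prob_space N by (rule N)
  interpret S: prob_space S unfolding S_def by (rule coins.P.prob_space_axioms)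
  interpret pair_sigma_finite N S ..
  interpret NS: pair_prob_space N S ..
  define F where "F m x \<eta> = (\<Sum>k. coin_sign (\<eta> k) * G m k x)" for m x \<eta>
  have coord[measurable]: "(\<lambda>\<eta>. coin_sign (\<eta> j)) \<in> borel_measurable S" for j
    unfolding S_def
    by (rule measurable_compose[OF measurable_component_singleton]) (auto simp: fair_coin_def)
  have F[measurable]: "(\<lambda>z. F m (fst z) (snd z)) \<in> borel_measurable (N \<Otimes>\<^sub>M S)" for m
    unfolding F_def
    by (intro borel_measurable_suminf borel_measurable_times
        measurable_compose[OF measurable_snd coord] measurable_compose[OF measurable_fst G])
  define D where "D k = {z \<in> space (N \<Otimes>\<^sub>M S). \<exists>m. \<bar>F m (fst z) (snd z)\<bar> \<ge> L k}" for k
  have D[measurable]: "D k \<in> sets (N \<Otimes>\<^sub>M S)" for k unfolding D_def by measurable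
  have "measure (N \<Otimes>\<^sub>M S) (D k) \<ge> c / 2" for k
  proof -
    let ?Z = "{x \<in> space N. \<exists>m. \<bar>G m k x\<bar> \<ge> L k}"
    have Z: "?Z \<in> sets N" by measurable
    have slice: "emeasure S (Pair x -` D k) \<ge> ennreal (1 / 2)" if x: "x \<in> ?Z" for x
    proof -
      from x obtain m where m: "\<bar>G m k x\<bar> \<ge> L k" and xs: "x \<in> space N" by auto
      have "1 / 2 \<le> measure S {\<eta> \<in> space S. \<bar>F m x \<eta>\<bar> \<ge> L k}"
        unfolding S_def F_def by (rule coin_series_large[OF sm m])
      also have "\<dots> \<le> measure S (Pair x -` D k)"
        using xs by (intro S.finite_measure_mono[OF _ sets_Pair1[OF D]])
          (auto simp: D_def space_pair_measure)
      finally show ?thesis by (simp only: S.emeasure_eq_measure ennreal_leI)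
    qed
    have "ennreal (c / 2) \<le> ennreal (1 / 2 * measure N ?Z)"
      using large[of k] by (intro ennreal_leI) simp
    also have "\<dots> = (\<integral>\<^sup>+x. ennreal (1 / 2) * indicator ?Z x \<partial>N)"
      by (subst nn_integral_cmult_indicator[OF Z], subst N.emeasure_eq_measure, rule ennreal_mult) auto
    also have "\<dots> \<le> (\<integral>\<^sup>+x. emeasure S (Pair x -` D k) \<partial>N)"
      using slice by (intro nn_integral_mono) (auto split: split_indicator)
    also have "\<dots> = emeasure (N \<Otimes>\<^sub>M S) (D k)"
      by (subst S.emeasure_pair_measure_alt) auto
    finally show ?thesis by (simp add: NS.emeasure_eq_measure)
  qed
  then have lims: "measure (N \<Otimes>\<^sub>M S) (\<Inter>n. \<Union>k\<in>{n..}. D k) \<ge> c / 2"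
    by (intro NS.measure_limsup_ge D)
  define I where "I = (\<Inter>n. \<Union>k\<in>{n..}. D k)"
  have I: "I \<in> sets (N \<Otimes>\<^sub>M S)" unfolding I_def by measurable
  have "\<exists>\<eta>\<in>space S. emeasure N ((\<lambda>x. (x, \<eta>)) -` I) \<noteq> 0"
  proof (rule ccontr)
    assume "\<not> ?thesis"
    then have "(\<integral>\<^sup>+\<eta>. emeasure N ((\<lambda>x. (x, \<eta>)) -` I) \<partial>S) = (\<integral>\<^sup>+\<eta>. 0 \<partial>S)"
      by (intro nn_integral_cong) auto
    then have "emeasure (N \<Otimes>\<^sub>M S) I = 0" using emeasure_pair_measure_alt2[OF I] by simp
    then show False using lims c unfolding I_def[symmetric] by (simp add: measure_def)
  qed
  then obtain \<eta> where \<eta>: "\<eta> \<in> space S" "emeasure N ((\<lambda>x. (x, \<eta>)) -` I) \<noteq> 0" by blast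
  let ?E = "(\<lambda>x. (x, \<eta>)) -` I"
  have "\<not> Bseq (\<lambda>m. \<Sum>k. coin_sign (\<eta> k) * G m k x)" if x: "x \<in> ?E" for x
  proof
    assume "Bseq (\<lambda>m. \<Sum>k. coin_sign (\<eta> k) * G m k x)"
    then obtain b where b: "\<And>m. \<bar>F m x \<eta>\<bar> \<le> b" unfolding F_def Bseq_def by auto
    from L obtain n where n: "\<And>k. k \<ge> n \<Longrightarrow> L k > b"
      unfolding filterlim_at_top_dense by (auto simp: eventually_sequentially)
    from x obtain k where "k \<ge> n" "(x, \<eta>) \<in> D k" unfolding I_def by blast
    then obtain m where "\<bar>F m x \<eta>\<bar> \<ge> L k" by (auto simp: D_def)
    then show False using b[of m] n[OF \<open>k \<ge> n\<close>] by linarith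
  qed
  moreover have "?E \<in> sets N" using I by (rule sets_Pair2)
  moreover have "measure N ?E > 0" using \<eta>(2) by (simp add: N.emeasure_eq_measure measure_nonneg order_less_le)
  ultimately show ?thesis by blast
qed

subsection \<open>Modular estimates\<close>

text \<open>A finite lower limit gives good scales arbitrarily close to 0, not a whole interval of
  them; all scales used later are picked among these.\<close>

lemma P_ln_scales:
  assumes "P_ln p"
  shows "\<exists>C. \<forall>\<delta>>0. \<exists>\<sigma>. 0 < \<sigma> \<and> \<sigma> < \<delta> \<and> (p \<sigma> - 1) * ln (exp 1 / \<sigma>) \<le> C"
proof -
  have "Liminf (at_right 0) (\<lambda>t. ereal ((p t - 1) * ln (exp 1 / t))) \<noteq> \<infinity>"
    using assms unfolding P_ln_def by auto
  then obtain n :: nat where n: "Liminf (at_right 0) (\<lambda>t. ereal ((p t - 1) * ln (exp 1 / t))) < ereal (real n)"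
    unfolding less_PInf_Ex_of_nat by blast
  have "\<exists>\<sigma>. 0 < \<sigma> \<and> \<sigma> < \<delta> \<and> (p \<sigma> - 1) * ln (exp 1 / \<sigma>) \<le> real n" if \<delta>: "\<delta> > 0" for \<delta>
  proof (rule ccontr)
    assume "\<not> ?thesis"
    then have big: "real n < (p \<sigma> - 1) * ln (exp 1 / \<sigma>)" if "0 < \<sigma>" "\<sigma> < \<delta>" for \<sigma>
      using that by (meson not_le)
    have "eventually (\<lambda>t. ereal (real n) \<le> ereal ((p t - 1) * ln (exp 1 / t))) (at_right 0)"
      using big \<delta> by (intro eventually_at_rightI[of 0 \<delta>]) (auto intro: less_imp_le)
    from Liminf_bounded[OF this] show False using n by simp
  qed
  then show ?thesis by blast
qed

text \<open>Splitting \<open>(1 / 4) ^ k\<close> as \<open>(1 / 2) ^ k * (1 / 2) ^ k\<close>, one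
  factor bounds the k-th term by \<open>B powr (1 / r)\<close>, B being the right-hand side, and the
  other sums to 2. The constants are free of r, as a variable exponent requires.\<close>

lemma powr_half_series_le:
  fixes y :: "nat \<Rightarrow> real"
  assumes y: "\<And>k. y k \<ge> 0" and fin: "eventually (\<lambda>k. y k = 0) sequentially" and r: "r \<ge> 1"
  shows "((\<Sum>k. (1 / 4) ^ k * y k) / 2) powr r \<le> (\<Sum>k. (1 / 2) ^ k * y k powr r)"
proof -
  define B where "B = (\<Sum>k. (1 / 2) ^ k * y k powr r)"
  have smB: "summable (\<lambda>k. (1 / 2) ^ k * y k powr r)"
    by (rule summable_cong[THEN iffD2, OF _ summable_zero]) (use fin in eventually_elim, simp)
  have smF: "summable (\<lambda>k. (1 / 4) ^ k * y k)"
    by (rule summable_cong[THEN iffD2, OF _ summable_zero]) (use fin in eventually_elim, simp)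
  have B0: "B \<ge> 0" unfolding B_def by (rule suminf_nonneg[OF smB]) simp
  have term_le: "(1 / 2) ^ k * y k \<le> B powr (1 / r)" for k
  proof -
    have "((1 / 2) ^ k * y k) powr r = ((1 / 2) ^ k) powr r * y k powr r"
      using y by (simp add: powr_mult)
    also have "\<dots> \<le> ((1 / 2) ^ k) powr 1 * y k powr r"
      using r by (intro mult_right_mono powr_mono') (auto simp: power_le_one)
    also have "\<dots> \<le> B"
      unfolding B_def using sum_le_suminf[OF smB, of "{k}"] by simp
    finally have "(((1 / 2) ^ k * y k) powr r) powr (1 / r) \<le> B powr (1 / r)"
      using r by (intro powr_mono2) auto
    then show ?thesis using r y[of k] by (simp add: powr_powr)
  qed
  have "(\<Sum>k. (1 / 4) ^ k * y k) \<le> (\<Sum>k. (1 / 2) ^ k * B powr (1 / r))"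
  proof (rule suminf_le[OF _ smF])
    fix k
    have "(1 / 4 :: real) ^ k * y k = (1 / 2) ^ k * ((1 / 2) ^ k * y k)"
      by (simp add: power_mult_distrib[symmetric])
    also have "\<dots> \<le> (1 / 2) ^ k * B powr (1 / r)" using term_le by (intro mult_left_mono) auto
    finally show "(1 / 4) ^ k * y k \<le> (1 / 2) ^ k * B powr (1 / r)" .
  qed (intro summable_mult2 summable_geometric, simp)
  also have "\<dots> = 2 * B powr (1 / r)"
    by (subst suminf_mult2[symmetric]) (simp_all add: suminf_geometric)
  finally have "(\<Sum>k. (1 / 4) ^ k * y k) / 2 \<le> B powr (1 / r)" by simp
  moreover have "(\<Sum>k. (1 / 4) ^ k * y k) \<ge> 0" using y by (intro suminf_nonneg[OF smF]) simp
  ultimately have "((\<Sum>k. (1 / 4) ^ k * y k) / 2) powr r \<le> (B powr (1 / r)) powr r"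
    using r by (intro powr_mono2) auto
  also have "\<dots> = B" using r B0 by (simp add: powr_powr)
  finally show ?thesis unfolding B_def .
qed

text \<open>To be used with a mean a of indicators and a height u = 1 / s: lowering the exponent of
  a to 1 and raising that of u to P only increases the product.\<close>

lemma powr_scaled_le:
  fixes a u :: real
  assumes "0 \<le> a" "a \<le> 1" "1 \<le> u" "1 \<le> r" "r \<le> P"
  shows "(a * u) powr r \<le> a * u powr P"
proof -
  have "(a * u) powr r = a powr r * u powr r" using assms by (simp add: powr_mult)
  also have "\<dots> \<le> a powr 1 * u powr P"
    using assms by (intro mult_mono powr_mono powr_mono') auto
  finally show ?thesis using assms by simp
qed

text \<open>With \<open>P = p \<sigma>\<close>, the left-hand side is the modular of a function of height \<open>1 / s\<close> on a set of
  measure \<open>s\<close> on which the exponent is at most \<open>P\<close>.\<close>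
lemma scale_powr_bound:
  fixes \<sigma> s P C :: real
  assumes \<sigma>: "0 < \<sigma>" "\<sigma> \<le> 1 / (2 * real n)" and n: "n \<ge> 1" and P: "1 \<le> P"
    and C: "(P - 1) * ln (exp 1 / \<sigma>) \<le> C"
  defines "s \<equiv> \<sigma> / (2 * real n)"
  shows "s * (1 / s) powr P \<le> exp (2 * C)"
proof -
  have s: "s > 0" using \<sigma> n by (simp add: s_def)
  \<comment> \<open>Hence 1 / s = 2n / \<sigma> is at most the square of 1 / \<sigma>, which is the
    source of the factor 2 in \<open>exp (2 * C)\<close>.\<close>
  have \<sigma>1: "2 * real n \<le> 1 / \<sigma>" using \<sigma> n by (simp add: field_simps)
  have "s * (1 / s) powr P = (1 / s) powr (P - 1)"
    using s by (simp add: powr_diff)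
  also have "\<dots> = exp ((P - 1) * ln (1 / s))" using s by (simp add: powr_def)
  also have "\<dots> \<le> exp (2 * C)"
  proof -
    have "1 / s = (2 * real n) * (1 / \<sigma>)" by (simp add: s_def)
    also have "ln \<dots> = ln (2 * real n) + ln (1 / \<sigma>)"
      using \<sigma> n by (intro ln_mult_pos) auto
    also have "ln (2 * real n) \<le> ln (1 / \<sigma>)" using \<sigma>1 n \<sigma> by (subst ln_le_cancel_iff) auto
    finally have "ln (1 / s) \<le> 2 * ln (1 / \<sigma>)" by simp
    also have "\<dots> \<le> 2 * ln (exp 1 / \<sigma>)" using \<sigma> by (simp add: ln_div)
    finally have "(P - 1) * ln (1 / s) \<le> (P - 1) * (2 * ln (exp 1 / \<sigma>))"
      using P by (intro mult_left_mono) auto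
    then show ?thesis using C by simp
  qed
  finally show ?thesis .
qed

section \<open>Fourier sums of absolutely convergent series and choice of scales\<close>

lemma (in bounded_ons) fourier_partial_sum_bound:
  assumes f: "integrable unit_leb f"
  shows "\<bar>fourier_coeff \<phi> f n\<bar> \<le> M * (\<integral>t. \<bar>f t\<bar> \<partial>unit_leb)"
    and "\<bar>fourier_partial_sum \<phi> f m x\<bar> \<le> real m * (M * (\<integral>t. \<bar>f t\<bar> \<partial>unit_leb) * M)"
proof -
  have fm[measurable]: "f \<in> borel_measurable unit_leb" using f by auto
  show coeff: "\<bar>fourier_coeff \<phi> f n\<bar> \<le> M * (\<integral>t. \<bar>f t\<bar> \<partial>unit_leb)" for n
  proof -
    have bd: "\<bar>f t * \<phi> n t\<bar> \<le> M * \<bar>f t\<bar>" for t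
      using mult_left_mono[OF bound[of n t] abs_ge_zero[of "f t"]] by (simp add: abs_mult mult_ac)
    have iM: "integrable unit_leb (\<lambda>t. M * \<bar>f t\<bar>)" using f by simp
    have i1: "integrable unit_leb (\<lambda>t. f t * \<phi> n t)"
      using bd M_pos by (intro Bochner_Integration.integrable_bound[OF iM]) (auto simp: abs_mult)
    have "\<bar>fourier_coeff \<phi> f n\<bar> \<le> (\<integral>t. \<bar>f t * \<phi> n t\<bar> \<partial>unit_leb)"
      unfolding fourier_coeff_def by (rule integral_abs_bound)
    also have "\<dots> \<le> (\<integral>t. M * \<bar>f t\<bar> \<partial>unit_leb)"
      using i1 iM bd by (intro integral_mono integrable_abs) auto
    finally show ?thesis using f by simp
  qed
  have "\<bar>fourier_partial_sum \<phi> f m x\<bar> \<le> (\<Sum>n<m. \<bar>fourier_coeff \<phi> f n * \<phi> n x\<bar>)"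
    unfolding fourier_partial_sum_def by (rule sum_abs)
  also have "\<dots> \<le> (\<Sum>n<m. M * (\<integral>t. \<bar>f t\<bar> \<partial>unit_leb) * M)"
    unfolding abs_mult using M_pos by (intro sum_mono mult_mono coeff bound) auto
  finally show "\<bar>fourier_partial_sum \<phi> f m x\<bar> \<le> real m * (M * (\<integral>t. \<bar>f t\<bar> \<partial>unit_leb) * M)" by simp
qed

text \<open>Each coefficient may be computed termwise by dominated convergence, and a partial sum
  involves finitely many of them. So the identity holds at every x, although the series of functions
  converges only almost everywhere.\<close>

lemma (in bounded_ons) fourier_partial_sum_series:
  fixes g :: "nat \<Rightarrow> real \<Rightarrow> real"
  assumes g: "\<And>k. integrable unit_leb (g k)"
    and ae: "AE x in unit_leb. summable (\<lambda>k. \<bar>g k x\<bar>)"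
    and sm: "summable (\<lambda>k. \<integral>x. \<bar>g k x\<bar> \<partial>unit_leb)"
  shows "fourier_partial_sum \<phi> (\<lambda>x. \<Sum>k. g k x) m x = (\<Sum>k. fourier_partial_sum \<phi> (g k) m x)"
proof -
  have gm[measurable]: "g k \<in> borel_measurable unit_leb" for k using g[of k] by auto
  have bd: "\<bar>g k t * \<phi> n t\<bar> \<le> \<bar>g k t\<bar> * M" for k n t
    unfolding abs_mult by (intro mult_left_mono bound) auto
  have i1: "integrable unit_leb (\<lambda>t. g k t * \<phi> n t)" for k n
  proof (rule Bochner_Integration.integrable_bound[of unit_leb "\<lambda>t. \<bar>g k t\<bar> * M"])
    show "integrable unit_leb (\<lambda>t. \<bar>g k t\<bar> * M)" using g by simp
    show "AE t in unit_leb. norm (g k t * \<phi> n t) \<le> norm (\<bar>g k t\<bar> * M)"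
      using bd M_pos by (auto simp: abs_mult)
  qed simp
  have coeff_sums: "(\<lambda>k. fourier_coeff \<phi> (g k) n) sums fourier_coeff \<phi> (\<lambda>x. \<Sum>k. g k x) n" for n
  proof -
    have "fourier_coeff \<phi> (\<lambda>x. \<Sum>k. g k x) n = (\<integral>t. (\<Sum>k. g k t * \<phi> n t) \<partial>unit_leb)"
      unfolding fourier_coeff_def
    proof (rule integral_cong_AE)
      show "AE t in unit_leb. (\<Sum>k. g k t) * \<phi> n t = (\<Sum>k. g k t * \<phi> n t)"
        using ae by eventually_elim (rule suminf_mult2, rule summable_rabs_cancel)
    qed measurable
    moreover have "(\<lambda>k. \<integral>t. g k t * \<phi> n t \<partial>unit_leb) sums (\<integral>t. (\<Sum>k. g k t * \<phi> n t) \<partial>unit_leb)"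
    proof (rule sums_integral[OF i1])
      show "AE t in unit_leb. summable (\<lambda>k. norm (g k t * \<phi> n t))"
        using ae
      proof eventually_elim
        case (elim t)
        then show ?case
          using bd by (intro summable_comparison_test'[OF summable_mult2[OF elim, of M], of 0]) simp
      qed
      show "summable (\<lambda>k. \<integral>t. norm (g k t * \<phi> n t) \<partial>unit_leb)"
      proof (rule summable_comparison_test'[OF summable_mult2[OF sm, of M]])
        fix k
        have "(\<integral>t. norm (g k t * \<phi> n t) \<partial>unit_leb) \<le> (\<integral>t. \<bar>g k t\<bar> * M \<partial>unit_leb)"
          using bd g i1 by (intro integral_mono integrable_norm) auto
        then show "norm (\<integral>t. norm (g k t * \<phi> n t) \<partial>unit_leb) \<le> (\<integral>x. \<bar>g k x\<bar> \<partial>unit_leb) * M"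
          by simp
      qed
    qed
    ultimately show ?thesis unfolding fourier_coeff_def by simp
  qed
  have "(\<lambda>k. fourier_partial_sum \<phi> (g k) m x) sums fourier_partial_sum \<phi> (\<lambda>x. \<Sum>k. g k x) m x"
    unfolding fourier_partial_sum_def by (intro sums_sum sums_mult2 coeff_sums)
  then show ?thesis by (rule sums_unique)
qed

lemma fourier_partial_sum_cmult:
  "fourier_partial_sum \<phi> (\<lambda>t. c * f t) m x = c * fourier_partial_sum \<phi> f m x"
proof -
  have "fourier_coeff \<phi> (\<lambda>t. c * f t) n = c * fourier_coeff \<phi> f n" for n
    unfolding fourier_coeff_def by (simp add: mult.assoc)
  then show ?thesis unfolding fourier_partial_sum_def by (simp add: sum_distrib_left mult_ac)
qed

text \<open>Halving at each step makes the tails geometric, so that the unions of later supports can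
  be bounded by the current scale.\<close>

lemma exists_small_decreasing_scales:
  fixes Q :: "real \<Rightarrow> bool"
  assumes Q: "\<And>\<delta>. \<delta> > 0 \<Longrightarrow> \<exists>\<sigma>. 0 < \<sigma> \<and> \<sigma> < \<delta> \<and> Q \<sigma>" and d: "\<And>k::nat. d k > 0"
  obtains \<sigma> :: "nat \<Rightarrow> real" where "\<And>k. 0 < \<sigma> k" "\<And>k. \<sigma> k < d k" "\<And>k. Q (\<sigma> k)"
    "\<And>k j. \<sigma> (k + j) \<le> (1 / 2) ^ j * \<sigma> k"
proof -
  have "\<exists>\<sigma>. \<forall>k. (0 < \<sigma> k \<and> \<sigma> k < d k \<and> Q (\<sigma> k)) \<and> \<sigma> (Suc k) \<le> \<sigma> k / 2"
  proof (rule dependent_nat_choice)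
    show "\<exists>x. 0 < x \<and> x < d 0 \<and> Q x" using Q[OF d] .
    fix x k assume "0 < x \<and> x < d k \<and> Q x"
    then have "min (d (Suc k)) (x / 2) > 0" using d[of "Suc k"] by simp
    from Q[OF this] show "\<exists>y. (0 < y \<and> y < d (Suc k) \<and> Q y) \<and> y \<le> x / 2" by auto
  qed
  then obtain \<sigma> where \<sigma>: "\<And>k. 0 < \<sigma> k" "\<And>k. \<sigma> k < d k" "\<And>k. Q (\<sigma> k)" "\<And>k. \<sigma> (Suc k) \<le> \<sigma> k / 2"
    by blast
  have "\<sigma> (k + j) \<le> (1 / 2) ^ j * \<sigma> k" for k j
  proof (induction j)
    case (Suc j)
    then show ?case using \<sigma>(4)[of "k + j"] by simp
  qed simp
  with \<sigma> show ?thesis using that by blast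
qed

subsection \<open>Divergence on a set of positive measure\<close>

text \<open>The order of choices matters. The required size of the partial sums fixes n k, N k and
  s0 k; these limit the scale \<sigma> k, which fixes the supports and then \<omega>. The signs come
  last: the majorant of |f| in the modular estimate does not involve them, so divergence can be
  arranged without spoiling integrability.\<close>

lemma (in bounded_ons) divergent_fourier_series:
  assumes p: "P_ln p"
  shows "\<exists>\<omega> f E. measure_preserving_01 \<omega> \<and> in_var_Lebesgue (\<lambda>x. p (\<omega> x)) f \<and>
     E \<in> sets unit_leb \<and> emeasure unit_leb E > 0 \<and> (\<forall>x\<in>E. \<not> convergent (\<lambda>N. fourier_partial_sum \<phi> f N x))"
proof -
  have p1: "p t \<ge> 1" if "t \<in> {0..1}" for t using p that unfolding P_ln_def by blast
  have pmono: "p s \<le> p t" if "s \<in> {0..1}" "t \<in> {0..1}" "s \<le> t" for s t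
  proof -
    have "mono_on {0..1} p" using p unfolding P_ln_def by blast
    then show ?thesis using that by (rule mono_onD)
  qed
  obtain C where C: "\<And>\<delta>. \<delta> > 0 \<Longrightarrow> \<exists>\<sigma>. 0 < \<sigma> \<and> \<sigma> < \<delta> \<and> (p \<sigma> - 1) * ln (exp 1 / \<sigma>) \<le> C"
    using P_ln_scales[OF p] by blast

  \<comment> \<open>The size 8^k beats the weight 4^(-k) of the k-th function and leaves
    2^k.\<close>
  define bumps where "bumps k n N s V \<longleftrightarrow> (\<forall>i<n. V i \<in> sets unit_leb \<and> measure unit_leb (V i) = s) \<and>
     measure unit_leb {x \<in> space unit_leb. \<exists>m\<le>N.
        \<bar>fourier_partial_sum \<phi> (\<lambda>t. (\<Sum>i<n. indicator (V i) t) / (real n * s)) m x\<bar> \<ge> 8 ^ k} \<ge> 1 / (8 * M\<^sup>2)"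
    for k n N :: nat and s :: real and V
  have "\<exists>n N s0. n \<ge> 1 \<and> s0 > 0 \<and> (\<forall>s. 0 < s \<and> s \<le> s0 \<longrightarrow> (\<exists>V. bumps k n N s V))" for k
  proof -
    have "(8::real) ^ k > 0" by simp
    then obtain n N s0 where "n \<ge> 1" "s0 > 0" "\<And>s. 0 < s \<Longrightarrow> s \<le> s0 \<Longrightarrow> \<exists>V. bumps k n N s V"
      unfolding bumps_def by (rule concentrated_large_partial_sums) blast
    then show ?thesis by blast
  qed
  then obtain n N s0 where n: "\<And>k. n k \<ge> 1" and s0: "\<And>k. s0 k > 0"
    and bumps: "\<And>k s. 0 < s \<Longrightarrow> s \<le> s0 k \<Longrightarrow> \<exists>V. bumps k (n k) (N k) s V"
    by metis
  \<comment> \<open>The first entry ensures s k \<le> s0 k; the second gives \<sigma> k \<le> 1 and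
    the smallness needed for \<open>scale_powr_bound\<close>.\<close>
  define d where "d k = min (2 * real (n k) * s0 k) (1 / (2 * real (n k)))" for k
  have d: "d k > 0" for k using n[of k] s0[of k] by (auto simp: d_def)
  obtain \<sigma> where \<sigma>: "\<And>k. 0 < \<sigma> k" "\<And>k. \<sigma> k < d k"
    "\<And>k. (p (\<sigma> k) - 1) * ln (exp 1 / \<sigma> k) \<le> C" "\<And>k j. \<sigma> (k + j) \<le> (1 / 2) ^ j * \<sigma> k"
    using exists_small_decreasing_scales[of "\<lambda>t. (p t - 1) * ln (exp 1 / t) \<le> C" d, OF C d] by blast
  have \<sigma>1: "\<sigma> k \<le> 1" for k
  proof -
    have "1 / (2 * real (n k)) \<le> 1" using n[of k] by simp
    then show ?thesis using \<sigma>(2)[of k] by (simp add: d_def)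
  qed
  \<comment> \<open>With this choice n k sets of measure s k cover at most \<sigma> k / 2, and the
    geometric decay of \<sigma> bounds all supports from k on by \<sigma> k.\<close>
  define s where "s k = \<sigma> k / (2 * real (n k))" for k
  have s: "0 < s k" "s k \<le> s0 k" "s k \<le> 1" for k
  proof -
    show "0 < s k" using \<sigma>(1)[of k] n[of k] by (simp add: s_def)
    show "s k \<le> s0 k" using \<sigma>(2)[of k] n[of k] by (simp add: s_def d_def field_simps)
    show "s k \<le> 1" using \<sigma>1[of k] n[of k] by (simp add: s_def field_simps)
  qed
  obtain V where V: "\<And>k. bumps k (n k) (N k) (s k) (V k)" using bumps[OF s(1,2)] by metis
  have Vm[measurable]: "V k i \<in> sets unit_leb" and Vs: "measure unit_leb (V k i) = s k" if "i < n k" for k i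
    using V[of k] that unfolding bumps_def by auto

  define W where "W k = (\<Union>i<n k. V k i)" for k
  have Wm[measurable]: "W k \<in> sets unit_leb" for k unfolding W_def using Vm by auto
  have W_le: "measure unit_leb (W k) \<le> \<sigma> k / 2" for k
  proof -
    have "measure unit_leb (W k) \<le> (\<Sum>i<n k. measure unit_leb (V k i))"
      unfolding W_def using Vm by (intro unit.finite_measure_subadditive_finite) auto
    also have "\<dots> = \<sigma> k / 2" using Vs n[of k] by (simp add: s_def)
    finally show ?thesis .
  qed
  have geo: "(\<lambda>j. (1 / 2) ^ j * \<sigma> k / 2) sums \<sigma> k" for k
    using sums_mult2[OF geometric_sums[of "1 / 2 :: real"], of "\<sigma> k / 2"] by simp
  have tail_le: "measure unit_leb (\<Union>j\<in>{k..}. W j) \<le> \<sigma> k" for k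
  proof -
    have le: "measure unit_leb (W (k + j)) \<le> (1 / 2) ^ j * \<sigma> k / 2" for j
      using W_le[of "k + j"] \<sigma>(4)[of k j] by linarith
    have smW: "summable (\<lambda>j. measure unit_leb (W (k + j)))"
      by (rule summable_comparison_test'[OF sums_summable[OF geo], of 0]) (use le in simp)
    have "(\<Union>j\<in>{k..}. W j) = (\<Union>j. W (k + j))"
      by (auto simp: le_iff_add intro!: bexI[of _ "k + _"])
    then have "measure unit_leb (\<Union>j\<in>{k..}. W j) \<le> (\<Sum>j. measure unit_leb (W (k + j)))"
      using unit.finite_measure_subadditive_countably[of "\<lambda>j. W (k + j)"] smW
      by (simp add: image_subset_iff Wm)
    also have "\<dots> \<le> \<sigma> k"
      using suminf_le[OF le smW sums_summable[OF geo]] sums_unique[OF geo, of k] by simp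
    finally show ?thesis .
  qed
  have \<sigma>0: "\<sigma> \<longlonglongrightarrow> 0"
  proof (rule tendsto_sandwich[OF _ _ tendsto_const])
    show "(\<lambda>j. (1 / 2) ^ j * \<sigma> 0) \<longlonglongrightarrow> 0"
      by (intro tendsto_mult_left_zero LIMSEQ_realpow_zero) auto
    show "eventually (\<lambda>j. \<sigma> j \<le> (1 / 2) ^ j * \<sigma> 0) sequentially"
      using \<sigma>(4)[of 0] by (simp add: always_eventually)
    show "eventually (\<lambda>j. 0 \<le> \<sigma> j) sequentially"
      using \<sigma>(1) by (intro always_eventually allI less_imp_le)
  qed
  obtain \<omega> where \<omega>: "measure_preserving_01 \<omega>" "AE x in unit_leb. \<forall>k. x \<in> W k \<longrightarrow> \<omega> x \<le> \<sigma> k"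
    using rearrangement_to_zero[OF Wm tail_le \<sigma>0] by blast
  have \<omega>01: "\<omega> x \<in> {0..1}" if "x \<in> space unit_leb" for x
    using \<omega>(1) measurable_space[of \<omega> unit_leb unit_leb x] that by (auto simp: measure_preserving_01_def)

  \<comment> \<open>The sets V k i may overlap, so a k is only known to lie between 0 and 1; its
    integral is s k in any case, which makes F k of norm one.\<close>
  define a where "a k x = (\<Sum>i<n k. indicator (V k i) x) / real (n k)" for k and x :: real
  define F where "F k x = a k x * (1 / s k)" for k x
  have F_eq: "F k = (\<lambda>t. (\<Sum>i<n k. indicator (V k i) t) / (real (n k) * s k))" for k
    by (simp add: F_def a_def fun_eq_iff)
  have a01: "0 \<le> a k x" "a k x \<le> 1" for k x
  proof -
    show "0 \<le> a k x" unfolding a_def by (intro divide_nonneg_nonneg sum_nonneg) auto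
    have "(\<Sum>i<n k. indicator (V k i) x) \<le> (\<Sum>i<n k. 1 :: real)"
      by (intro sum_mono) (auto split: split_indicator)
    then show "a k x \<le> 1" unfolding a_def using n[of k] by simp
  qed
  have a_int: "integrable unit_leb (a k)" and a_val: "(\<integral>x. a k x \<partial>unit_leb) = s k" for k
  proof -
    have iV: "integrable unit_leb (indicator (V k i) :: real \<Rightarrow> real)"
      and vV: "(\<integral>x. indicator (V k i) x \<partial>unit_leb) = s k" if "i < n k" for i
      using Vm[OF that] Vs[OF that] sets.sets_into_space[OF Vm[OF that]]
      by (auto intro!: integrable_real_indicator simp: unit.emeasure_eq_measure Int_absorb2)
    show "integrable unit_leb (a k)"
      unfolding a_def using iV by (intro integrable_divide_zero Bochner_Integration.integrable_sum) auto
    have "(\<integral>x. a k x \<partial>unit_leb) = (\<Sum>i<n k. \<integral>x. indicator (V k i) x \<partial>unit_leb) / real (n k)"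
      unfolding a_def using iV
      by (subst Bochner_Integration.integral_divide_zero, subst Bochner_Integration.integral_sum) auto
    then show "(\<integral>x. a k x \<partial>unit_leb) = s k" using vV n[of k] by simp
  qed
  have F0: "F k x \<ge> 0" for k x using a01(1)[of k x] s(1)[of k] by (simp add: F_def)
  have F_int: "integrable unit_leb (F k)" for k unfolding F_def using a_int by simp
  have F_one: "(\<integral>x. \<bar>F k x\<bar> \<partial>unit_leb) = 1" for k
    unfolding abs_of_nonneg[OF F0] using a_val[of k] s(1)[of k] by (simp add: F_def)
  have F_out: "F k x = 0" if "x \<notin> W k" for k x
    using that by (auto simp: F_def a_def W_def intro!: sum.neutral)
  \<comment> \<open>Borel-Cantelli: almost every x lies in only finitely many supports, so at such x
    all series below are finite sums.\<close>
  have fin: "AE x in unit_leb. eventually (\<lambda>k. F k x = 0) sequentially"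
  proof -
    have "measure unit_leb (W j) \<le> (1 / 2) ^ j * \<sigma> 0 / 2" for j
      using W_le[of j] \<sigma>(4)[of 0 j] unfolding add_0 by linarith
    then have "summable (\<lambda>k. measure unit_leb (W k))"
      by (intro summable_comparison_test'[OF sums_summable[OF geo[of 0]], of 0]) simp
    then have "AE x in unit_leb. eventually (\<lambda>k. x \<in> space unit_leb - W k) sequentially"
      by (intro borel_cantelli_AE1) (auto simp: unit.emeasure_eq_measure)
    then show ?thesis
      by eventually_elim (auto elim!: eventually_mono intro: F_out)
  qed

  define G where "G m k x = fourier_partial_sum \<phi> (\<lambda>t. (1 / 4) ^ k * F k t) m x" for m k x
  have G_eq: "G m k x = (1 / 4) ^ k * fourier_partial_sum \<phi> (F k) m x" for m k x
    unfolding G_def by (rule fourier_partial_sum_cmult)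
  have "\<exists>\<eta> E. E \<in> sets unit_leb \<and> measure unit_leb E > 0 \<and>
      (\<forall>x\<in>E. \<not> Bseq (\<lambda>m. \<Sum>k. coin_sign (\<eta> k) * G m k x))"
  proof (rule random_signs_unbounded[OF prob_space_unit_leb, where L="\<lambda>k. 2 ^ k" and c="1 / (8 * M\<^sup>2)"])
    show "G m k \<in> borel_measurable unit_leb" for m k unfolding G_def by measurable
    show "summable (\<lambda>k. \<bar>G m k x\<bar>)" for m x
    proof (rule summable_comparison_test'[of "\<lambda>k. (1 / 4) ^ k * (real m * (M * 1 * M))" 0])
      show "summable (\<lambda>k. (1 / 4) ^ k * (real m * (M * 1 * M)))"
        by (intro summable_mult2 summable_geometric) simp
      show "norm \<bar>G m k x\<bar> \<le> (1 / 4) ^ k * (real m * (M * 1 * M))" for k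
        using fourier_partial_sum_bound(2)[OF F_int[of k], of m x]
        unfolding G_eq F_one by (simp add: abs_mult mult_left_mono)
    qed
    show "1 / (8 * M\<^sup>2) \<le> measure unit_leb {x \<in> space unit_leb. \<exists>m. 2 ^ k \<le> \<bar>G m k x\<bar>}" for k
    proof -
      have "1 / (8 * M\<^sup>2) \<le> measure unit_leb {x \<in> space unit_leb. \<exists>m\<le>N k. \<bar>fourier_partial_sum \<phi> (F k) m x\<bar> \<ge> 8 ^ k}"
        using V[of k] unfolding bumps_def F_eq by blast
      also have "\<dots> \<le> measure unit_leb {x \<in> space unit_leb. \<exists>m. 2 ^ k \<le> \<bar>G m k x\<bar>}"
      proof (rule unit.finite_measure_mono)
        show "{x \<in> space unit_leb. \<exists>m. 2 ^ k \<le> \<bar>G m k x\<bar>} \<in> sets unit_leb" unfolding G_def by measurable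
        have "2 ^ k \<le> \<bar>G m k x\<bar>" if "\<bar>fourier_partial_sum \<phi> (F k) m x\<bar> \<ge> 8 ^ k" for m x
        proof -
          have "(2 :: real) ^ k = (1 / 4) ^ k * 8 ^ k" by (simp add: power_mult_distrib[symmetric])
          also have "\<dots> \<le> \<bar>G m k x\<bar>" unfolding G_eq abs_mult using that by (simp add: mult_left_mono)
          finally show ?thesis .
        qed
        then show "{x \<in> space unit_leb. \<exists>m\<le>N k. \<bar>fourier_partial_sum \<phi> (F k) m x\<bar> \<ge> 8 ^ k}
          \<subseteq> {x \<in> space unit_leb. \<exists>m. 2 ^ k \<le> \<bar>G m k x\<bar>}" by blast
      qed
      finally show ?thesis .
    qed
    show "filterlim (\<lambda>k. 2 ^ k :: real) at_top sequentially"
      by (rule filterlim_at_top_mono[OF filterlim_real_sequentially])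
        (simp add: of_nat_less_two_power less_imp_le)
    show "1 / (8 * M\<^sup>2) > 0" using M_pos by simp
  qed
  then obtain \<eta> E where E: "E \<in> sets unit_leb" "measure unit_leb E > 0"
    "\<And>x. x \<in> E \<Longrightarrow> \<not> Bseq (\<lambda>m. \<Sum>k. coin_sign (\<eta> k) * G m k x)"
    by blast

  define g where "g k x = coin_sign (\<eta> k) * ((1 / 4) ^ k * F k x)" for k x
  define f where "f x = (\<Sum>k. g k x)" for x
  have g_int: "integrable unit_leb (g k)" for k unfolding g_def using F_int by simp
  have gm[measurable]: "g k \<in> borel_measurable unit_leb" for k using g_int[of k] by auto
  have g_abs: "\<bar>g k x\<bar> = (1 / 4) ^ k * F k x" for k x
    using F0[of k x] by (simp add: g_def abs_mult abs_coin_sign)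
  have g_sum: "summable (\<lambda>k. \<bar>g k x\<bar>)" if "eventually (\<lambda>k. F k x = 0) sequentially" for x
    unfolding g_abs
    by (rule summable_cong[THEN iffD2, OF _ summable_zero]) (use that in eventually_elim, simp)
  have S_eq: "fourier_partial_sum \<phi> f m x = (\<Sum>k. coin_sign (\<eta> k) * G m k x)" for m x
  proof -
    have "fourier_partial_sum \<phi> f m x = (\<Sum>k. fourier_partial_sum \<phi> (g k) m x)"
      unfolding f_def
    proof (rule fourier_partial_sum_series[OF g_int])
      show "AE x in unit_leb. summable (\<lambda>k. \<bar>g k x\<bar>)"
        using fin by eventually_elim (rule g_sum)
      have "(\<integral>x. \<bar>g k x\<bar> \<partial>unit_leb) = (1 / 4) ^ k" for k
        unfolding g_abs using F_one[of k] F0 by simp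
      then show "summable (\<lambda>k. \<integral>x. \<bar>g k x\<bar> \<partial>unit_leb)" by simp
    qed
    then show ?thesis unfolding g_def G_def fourier_partial_sum_cmult .
  qed
  have "\<not> convergent (\<lambda>m. fourier_partial_sum \<phi> f m x)" if "x \<in> E" for x
    using E(3)[OF that] unfolding S_eq using convergent_imp_Bseq by blast
  moreover have "emeasure unit_leb E > 0" using E(2) by (simp add: unit.emeasure_eq_measure)
  moreover have "in_var_Lebesgue (\<lambda>x. p (\<omega> x)) f"
    unfolding in_var_Lebesgue_def
  \<comment> \<open>The divisor 2 is the one in \<open>powr_half_series_le\<close>.\<close>
  proof (intro conjI exI[of _ 2])
    show "f \<in> borel_measurable unit_leb" unfolding f_def by measurable
    \<comment> \<open>Majorant of the k-th term of the modular, with the variable exponent replaced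
      by the constant \<open>p (\<sigma> k)\<close>; it is linear in a k, so its integral is
      explicit.\<close>
    define b where "b k x = (1 / 2) ^ k * (a k x * (1 / s k) powr p (\<sigma> k))" for k x
    have b0: "b k x \<ge> 0" for k x unfolding b_def using a01 by simp
    have b_int: "integrable unit_leb (b k)" for k unfolding b_def using a_int by simp
    have "(\<integral>\<^sup>+x. ennreal ((\<bar>f x\<bar> / 2) powr p (\<omega> x)) \<partial>unit_leb) \<le> (\<integral>\<^sup>+x. (\<Sum>k. ennreal (b k x)) \<partial>unit_leb)"
    proof (rule nn_integral_mono_AE)
      show "AE x in unit_leb. ennreal ((\<bar>f x\<bar> / 2) powr p (\<omega> x)) \<le> (\<Sum>k. ennreal (b k x))"
        using fin \<omega>(2) AE_space
      proof eventually_elim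
        case (elim x)
        let ?r = "p (\<omega> x)"
        have r: "?r \<ge> 1" using p1 \<omega>01 elim(3) by blast
        \<comment> \<open>On W k the point \<omega> x is at most \<sigma> k, so by monotonicity the
          exponent at x is at most \<open>p (\<sigma> k)\<close>; off W k the function F k
          vanishes.\<close>
        have F_le: "F k x powr ?r \<le> a k x * (1 / s k) powr p (\<sigma> k)" for k
        proof (cases "x \<in> W k")
          case True
          have "?r \<le> p (\<sigma> k)"
            using elim(2) True \<omega>01[OF elim(3)] \<sigma>(1)[of k] \<sigma>1[of k] by (intro pmono) auto
          then show ?thesis
            unfolding F_def using s[of k] a01[of k x] r by (intro powr_scaled_le) auto
        next
          case False
          then show ?thesis using F_out a01(1)[of k x] by simp
        qed
        have smF: "summable (\<lambda>k. (1 / 2) ^ k * F k x powr ?r)"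
          by (rule summable_cong[THEN iffD2, OF _ summable_zero]) (use elim(1) in eventually_elim, simp)
        have "eventually (\<lambda>k. b k x = 0) sequentially"
          using elim(1)
        proof eventually_elim
          case (elim k)
          then have "a k x = 0" using s(1)[of k] by (simp add: F_def)
          then show ?case by (simp add: b_def)
        qed
        then have smb: "summable (\<lambda>k. b k x)"
          using summable_cong[of "\<lambda>k. b k x" "\<lambda>_. 0"] by simp
        have "\<bar>f x\<bar> \<le> (\<Sum>k. \<bar>g k x\<bar>)"
          unfolding f_def by (rule summable_rabs[OF g_sum[OF elim(1)]])
        then have "(\<bar>f x\<bar> / 2) powr ?r \<le> ((\<Sum>k. (1 / 4) ^ k * F k x) / 2) powr ?r"
          unfolding g_abs using r by (intro powr_mono2) auto
        also have "\<dots> \<le> (\<Sum>k. (1 / 2) ^ k * F k x powr ?r)"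
          by (rule powr_half_series_le[OF F0 elim(1) r])
        also have "\<dots> \<le> (\<Sum>k. b k x)"
          unfolding b_def
          by (rule suminf_le[OF mult_left_mono[OF F_le] smF smb[unfolded b_def]]) simp
        finally show ?case
          by (simp add: suminf_ennreal2[OF b0 smb] ennreal_leI)
      qed
    qed
    also have "\<dots> = (\<Sum>k. \<integral>\<^sup>+x. ennreal (b k x) \<partial>unit_leb)"
      using b_int by (intro nn_integral_suminf) auto
    also have "\<dots> \<le> (\<Sum>k. ennreal ((1 / 2) ^ k * exp (2 * C)))"
    proof (rule suminf_le)
      fix k
      have "(\<integral>\<^sup>+x. ennreal (b k x) \<partial>unit_leb) = ennreal (\<integral>x. b k x \<partial>unit_leb)"
        using b_int b0 by (intro nn_integral_eq_integral) auto
      also have "(\<integral>x. b k x \<partial>unit_leb) = (1 / 2) ^ k * (s k * (1 / s k) powr p (\<sigma> k))"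
        unfolding b_def using a_val[of k] by simp
      also have "\<dots> \<le> (1 / 2) ^ k * exp (2 * C)"
        unfolding s_def using \<sigma>(1,3)[of k] \<sigma>(2)[of k, unfolded d_def] \<sigma>1[of k] n[of k]
        by (intro mult_left_mono scale_powr_bound p1) auto
      finally show "(\<integral>\<^sup>+x. ennreal (b k x) \<partial>unit_leb) \<le> ennreal ((1 / 2) ^ k * exp (2 * C))"
        by (simp add: ennreal_leI)
    qed auto
    also have "\<dots> = ennreal (\<Sum>k. (1 / 2) ^ k * exp (2 * C))"
      by (intro suminf_ennreal2 summable_mult2 summable_geometric) auto
    also have "\<dots> < \<infinity>" by simp
    finally show "(\<integral>\<^sup>+x. ennreal ((\<bar>f x\<bar> / 2) powr p (\<omega> x)) \<partial>unit_leb) < \<infinity>" .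
  qed simp
  ultimately show ?thesis using \<omega>(1) E(1) by blast
qed

section \<open>Reduction from bounds almost everywhere to bounds everywhere\<close>

theorem theorem1p2:
  fixes \<phi> :: "nat \<Rightarrow> real \<Rightarrow> real" and p :: "real \<Rightarrow> real"
  assumes "orthonormal_system \<phi>" and "uniformly_bounded \<phi>" and "P_ln p"
  shows "\<exists>\<omega> f E. measure_preserving_01 \<omega> \<and> in_var_Lebesgue (\<lambda>x. p (\<omega> x)) f \<and>
           E \<in> sets unit_leb \<and> emeasure unit_leb E > 0 \<and>
           (\<forall>x\<in>E. \<not> convergent (\<lambda>N. fourier_partial_sum \<phi> f N x))"
proof -
  obtain M where M: "M > 0" "\<And>n. AE t in unit_leb. \<bar>\<phi> n t\<bar> < M"
    using assms(2) unfolding uniformly_bounded_def by blast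
  have \<phi>[measurable]: "\<phi> n \<in> borel_measurable unit_leb" for n
    using assms(1) unfolding orthonormal_system_def by blast
  \<comment> \<open>Each function changes only on a null set, so orthonormality and all Fourier
    coefficients are preserved.\<close>
  define \<psi> where "\<psi> n x = (if \<bar>\<phi> n x\<bar> < M then \<phi> n x else 0)" for n x
  have \<psi>[measurable]: "\<psi> n \<in> borel_measurable unit_leb" for n unfolding \<psi>_def by measurable
  have ae: "AE x in unit_leb. \<psi> n x = \<phi> n x" for n
    using M(2)[of n] by eventually_elim (simp add: \<psi>_def)
  interpret \<psi>: bounded_ons \<psi> M
  proof
    show "\<bar>\<psi> n x\<bar> \<le> M" for n x using M(1) by (simp add: \<psi>_def)
    fix n k
    have "(\<integral>x. \<psi> n x * \<psi> k x \<partial>unit_leb) = (\<integral>x. \<phi> n x * \<phi> k x \<partial>unit_leb)"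
    proof (rule integral_cong_AE)
      show "AE x in unit_leb. \<psi> n x * \<psi> k x = \<phi> n x * \<phi> k x"
        using ae[of n] ae[of k] by eventually_elim simp
    qed measurable
    then show "(\<integral>x. \<psi> n x * \<psi> k x \<partial>unit_leb) = (if n = k then 1 else 0)"
      using assms(1) unfolding orthonormal_system_def by simp
  qed (rule \<psi>)
  obtain \<omega> f E where \<omega>: "measure_preserving_01 \<omega>" and f: "in_var_Lebesgue (\<lambda>x. p (\<omega> x)) f"
    and E: "E \<in> sets unit_leb" "emeasure unit_leb E > 0"
    and div: "\<And>x. x \<in> E \<Longrightarrow> \<not> convergent (\<lambda>N. fourier_partial_sum \<psi> f N x)"
    using \<psi>.divergent_fourier_series[OF assms(3)] by blast
  have fm[measurable]: "f \<in> borel_measurable unit_leb" using f unfolding in_var_Lebesgue_def by blast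
  have coeff: "fourier_coeff \<psi> f n = fourier_coeff \<phi> f n" for n
    unfolding fourier_coeff_def
  proof (rule integral_cong_AE)
    show "AE x in unit_leb. f x * \<psi> n x = f x * \<phi> n x"
      using ae[of n] by eventually_elim simp
  qed measurable
  \<comment> \<open>The points where some \<psi> n differs from \<phi> n are removed; they are
    covered by countably many null sets, and on the rest the partial sums of both systems
    agree.\<close>
  define E' where "E' = {x \<in> space unit_leb. x \<in> E \<and> (\<forall>n. \<psi> n x = \<phi> n x)}"
  have E': "E' \<in> sets unit_leb" unfolding E'_def using E(1) by measurable
  have "AE x in unit_leb. \<forall>n. \<psi> n x = \<phi> n x" using ae by (simp add: AE_all_countable)
  then have "emeasure unit_leb E' = emeasure unit_leb E"
    using E' E(1) by (intro emeasure_eq_AE) (auto simp: E'_def elim!: AE_mp)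
  moreover have "\<not> convergent (\<lambda>N. fourier_partial_sum \<phi> f N x)" if "x \<in> E'" for x
  proof -
    have "fourier_partial_sum \<phi> f N x = fourier_partial_sum \<psi> f N x" for N
      using that unfolding fourier_partial_sum_def coeff E'_def by simp
    then show ?thesis using div[of x] that by (simp add: E'_def)
  qed
  ultimately show ?thesis using \<omega> f E(2) E' by metis
qed

end
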